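(* Consider the 72 mDAGs with node set $\{a,b,c\}$ that are consistent with the nodal ordering $(a,b,c)$ (equivalently, whose directed edges form a subset of $\{a\to b,\ a\to c,\ b\to c\}$). (i) For any two such mDAGs $\mathfrak{G},\mathfrak{G}'$: $\mathfrak{G}$ observationally dominates $\mathfrak{G}'$ if and only if there is a finite sequence $\mathfrak{G}=\mathfrak{G}_1,\dots,\mathfrak{G}_m=\mathfrak{G}'$ of mDAGs with node set $\{a,b,c\}$ (not necessarily consistent with the ordering $(a,b,c)$) such that, for each $j<m$, the dominance of $\mathfrak{G}_j$ over $\mathfrak{G}_{j+1}$ is an instance of the Structural Dominance rule, the HLP Edge-Adding rule, or the Weak Facet-Adding rule. (ii) These 72 mDAGs are partitioned by observational equivalence into exactly 15 classes. (iii) Exactly 5 of these 15 observational equivalence classes are nonalgebraic.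
   Context: A pDAG $\mathcal{G}$ is a finite directed acyclic graph (DAG) whose nodes are partitioned into visible nodes $V$ and latent nodes $L$. Let $\mathrm{pa}_{\mathcal{G}}(a)$ denote the set of parents of node $a$, and $\mathrm{pa}_{\mathcal{G}}(S)=\bigcup_{a\in S}\mathrm{pa}_{\mathcal{G}}(a)$. For a vector $\vec c\in\mathbb{N}^{V}$ of (positive) cardinalities, $\mathcal{M}(\mathcal{G},\vec c)$ is the set of all probability distributions $P$ of $(X_v)_{v\in V}$, where $X_v$ takes values in a fixed set of size $c_v$, that can be written $$P(X_V)=\sum_{X_L}\sum_{E}\ \prod_{a\in V\cup L}\delta_{X_a,\,f_a(X_{\mathrm{pa}_{\mathcal{G}}(a)},E_a)}\,P(E_a)$$ for some choice of finite state spaces of arbitrary size for the latent variables $X_l$ ($l\in L$), of finite error variables $E_a$ with distributions $P(E_a)$ (one for each node $a$), and of functions $f_a$. An mDAG is a pair $\mathfrak{G}=(\mathcal{D},\mathcal{B})$, where $\mathcal{D}$ is a DAG (the directed structure) and $\mathcal{B}$ is a simplicial complex over the nodes of $\mathcal{D}$: a set of subsets of the node set that contains all singletons and is closed under taking subsets. Elements of $\mathcal{B}$ are faces; inclusion-maximal elements are facets. The canonical pDAG $\mathrm{can}(\mathfrak{G})$ has as visible nodes the nodes of $\mathcal{D}$, all edges of $\mathcal{D}$, and in addition, for each facet $A$ of $\mathcal{B}$, one parentless latent node whose set of children is exactly $A$. Put $\mathcal{M}(\mathfrak{G},\vec c)=\mathcal{M}(\mathrm{can}(\mathfrak{G}),\vec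 c)$. For two mDAGs with the same nodes, $\mathfrak{G}$ observationally dominates $\mathfrak{G}'$ if $\mathcal{M}(\mathfrak{G}',\vec c)\subseteq\mathcal{M}(\mathfrak{G},\vec c)$ for every $\vec c$; they are observationally equivalent if equality holds for every $\vec c$. An mDAG is consistent with an ordering of its nodes if no later node is an ancestor of an earlier one. Algebraic: an mDAG $\mathfrak{G}$ is algebraic if, for every $\vec c$, all nontrivial constraints defining $\mathcal{M}(\mathfrak{G},\vec c)$ (i.e. beyond nonnegativity and normalization of probabilities) are polynomial equalities; that is, $\mathcal{M}(\mathfrak{G},\vec c)$ is the intersection of a real algebraic set with the probability simplex. Otherwise it is nonalgebraic. This property depends only on the observational equivalence class. Rules (each yields an observational dominance): - Structural Dominance: $(\mathcal D,\mathcal B)$ dominates $(\mathcal D',\mathcal B')$ whenever every edge of $\mathcal D'$ is an edge of $\mathcal D$ and $\mathcal B'\subseteq\mathcal B$. - HLP Edge-Adding: let $\mathfrak{G}=(\mathcal D,\mathcal B)$ have nodes $x,y$ with $\mathrm{pa}_{\mathcal D}(x)\subseteq\mathrm{pa}_{\mathcal D}(y)$ and such that every facet containing $x$ also contains $y$. Then $\mathfrak{G}$ dominates the mDAG obtained by adding the directed edge $x\to y$ (when the result is an mDAG). - Weak Facet-Adding: let $\mathfrak{G}=(\mathcal D,\mathcal B)$ have disjoint faces $C,D$ with $\mathrm{pa}_{\mathcal D}(C)\cup C\subseteq\mathrm{pa}_{\mathcal D}(d)$ for each $d\in D$, and such that every face containing some $c\in C$ is a subset of $C$. Then $\mathfrak{G}$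 dominates the mDAG obtained by adding $C\cup D$ and all of its subsets to $\mathcal B$. *)

theory Defs
  imports "HOL-Probability.Probability" "HOL-Library.Poly_Mapping"
begin

text \<open>The node set of a pDAG is a disjoint sum: visible nodes are tagged by \<open>Inl\<close>, latent nodes
  by \<open>Inr\<close>.\<close>

record ('v, 'l) pdag =
  visible :: "'v set"
  latent :: "'l set"
  arrows :: "('v + 'l) rel"

definition pdag_nodes :: "('v, 'l) pdag \<Rightarrow> ('v + 'l) set" where
  "pdag_nodes G = visible G <+> latent G"

definition is_pdag :: "('v, 'l) pdag \<Rightarrow> bool" where
  "is_pdag G \<longleftrightarrow> finite (pdag_nodes G) \<and>
     arrows G \<subseteq> pdag_nodes G \<times> pdag_nodes G \<and> acyclic (arrows G)"

definition parents :: "'n rel \<Rightarrow> 'n set \<Rightarrow> 'n set" where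
  "parents E S = {u. \<exists>a\<in>S. (u, a) \<in> E}"

text \<open>The fixed set of size \<open>c v\<close> in which \<open>X\<^sub>v\<close> takes values is \<open>{..<c v}\<close>.\<close>

definition outcomes :: "'v set \<Rightarrow> ('v \<Rightarrow> nat) \<Rightarrow> ('v \<Rightarrow> nat) set" where
  "outcomes V c = (\<Pi>\<^sub>E v\<in>V. {..<c v})"

definition prob_simplex :: "'v set \<Rightarrow> ('v \<Rightarrow> nat) \<Rightarrow> ('v \<Rightarrow> nat) pmf set" where
  "prob_simplex V c = {P. set_pmf P \<subseteq> outcomes V c}"

text \<open>A choice of parameters consists of a finite state space \<open>S l\<close> for each latent node \<open>l\<close>, a
  finitely supported error distribution \<open>W a\<close> for each node \<open>a\<close>, and a function \<open>f a\<close> for each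
  node \<open>a\<close>, which receives the joint value of the parents of \<open>a\<close> and the value of the error
  variable. Every finite set embeds into \<open>nat\<close>, so taking all values in \<open>nat\<close> is no restriction.\<close>

definition state_space ::
  "('v \<Rightarrow> nat) \<Rightarrow> ('l \<Rightarrow> nat set) \<Rightarrow> 'v + 'l \<Rightarrow> nat set" where
  "state_space c S = case_sum (\<lambda>v. {..<c v}) S"

definition valid_params ::
  "('v, 'l) pdag \<Rightarrow> ('v \<Rightarrow> nat) \<Rightarrow> ('l \<Rightarrow> nat set) \<Rightarrow> ('v + 'l \<Rightarrow> nat pmf) \<Rightarrow>
   ('v + 'l \<Rightarrow> ('v + 'l \<Rightarrow> nat) \<Rightarrow> nat \<Rightarrow> nat) \<Rightarrow> bool" where
  "valid_params G c S W f \<longleftrightarrow>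
     (\<forall>l\<in>latent G. finite (S l)) \<and>
     (\<forall>a\<in>pdag_nodes G. finite (set_pmf (W a))) \<and>
     (\<forall>a\<in>pdag_nodes G. \<forall>z \<in> (\<Pi>\<^sub>E u\<in>parents (arrows G) {a}. state_space c S u).
        \<forall>e\<in>set_pmf (W a). f a z e \<in> state_space c S a)"

definition marginal_prob ::
  "('v, 'l) pdag \<Rightarrow> ('l \<Rightarrow> nat set) \<Rightarrow> ('v + 'l \<Rightarrow> nat pmf) \<Rightarrow>
   ('v + 'l \<Rightarrow> ('v + 'l \<Rightarrow> nat) \<Rightarrow> nat \<Rightarrow> nat) \<Rightarrow> ('v \<Rightarrow> nat) \<Rightarrow> real" where
  "marginal_prob G S W f x =
     (\<Sum>y \<in> (\<Pi>\<^sub>E l\<in>latent G. S l).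
      \<Sum>e \<in> (\<Pi>\<^sub>E a\<in>pdag_nodes G. set_pmf (W a)).
      \<Prod>a\<in>pdag_nodes G.
        (let X = case_sum x y in
         of_bool (X a = f a (restrict X (parents (arrows G) {a})) (e a)) * pmf (W a) (e a)))"

definition marginal_model ::
  "('v, 'l) pdag \<Rightarrow> ('v \<Rightarrow> nat) \<Rightarrow> ('v \<Rightarrow> nat) pmf set" where
  "marginal_model G c =
     {P \<in> prob_simplex (visible G) c. \<exists>S W f. valid_params G c S W f \<and>
        (\<forall>x\<in>outcomes (visible G) c. pmf P x = marginal_prob G S W f x)}"

record 'v mdag =
  nodes :: "'v set"
  edges :: "'v rel"
  faces :: "'v set set"

definition is_mdag :: "'v mdag \<Rightarrow> bool" where
  "is_mdag G \<longleftrightarrow> finite (nodes G) \<and>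
     edges G \<subseteq> nodes G \<times> nodes G \<and> acyclic (edges G) \<and>
     faces G \<subseteq> Pow (nodes G) \<and> (\<forall>v\<in>nodes G. {v} \<in> faces G) \<and>
     (\<forall>A\<in>faces G. \<forall>B. B \<subseteq> A \<longrightarrow> B \<in> faces G)"

definition facets :: "'v mdag \<Rightarrow> 'v set set" where
  "facets G = {A \<in> faces G. \<forall>B\<in>faces G. A \<subseteq> B \<longrightarrow> B = A}"

text \<open>The latent node added for a facet is named by the facet itself.\<close>

definition can :: "'v mdag \<Rightarrow> ('v, 'v set) pdag" where
  "can G = \<lparr>visible = nodes G, latent = facets G,
     arrows = {(Inl u, Inl v) |u v. (u, v) \<in> edges G} \<union> {(Inr A, Inl v) |A v. A \<in> facets G \<and> v \<in> A}\<rparr>"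

lemma is_pdag_can:
  assumes "is_mdag G"
  shows "is_pdag (can G)"
proof -
  let ?R = "arrows (can G)"
  have fin: "finite (facets G)"
    by (rule finite_subset[of _ "Pow (nodes G)"]) (use assms in \<open>auto simp: is_mdag_def facets_def\<close>)
  have step: "\<exists>v. y = Inl v \<and> (\<forall>u. x = Inl u \<longrightarrow> (u, v) \<in> (edges G)\<^sup>+)"
    if "(x, y) \<in> ?R\<^sup>+" for x y
    using that
  proof (induction rule: trancl_induct)
    case (base y)
    then show ?case by (auto simp: can_def)
  next
    case (step y z)
    then show ?case by (auto simp: can_def intro: trancl_into_trancl)
  qed
  have "acyclic ?R"
  proof (rule acyclicI, intro allI notI)
    fix x assume "(x, x) \<in> ?R\<^sup>+"
    from step[OF this] obtain v where "(v, v) \<in> (edges G)\<^sup>+" by auto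
    then show False using assms by (simp add: is_mdag_def acyclic_def)
  qed
  moreover have "finite (pdag_nodes (can G))"
    using assms fin by (simp add: pdag_nodes_def can_def is_mdag_def finite_Plus)
  moreover have "?R \<subseteq> pdag_nodes (can G) \<times> pdag_nodes (can G)"
    using assms by (fastforce simp: pdag_nodes_def can_def is_mdag_def facets_def)
  ultimately show ?thesis by (simp add: is_pdag_def)
qed

definition mdag_model :: "'v mdag \<Rightarrow> ('v \<Rightarrow> nat) \<Rightarrow> ('v \<Rightarrow> nat) pmf set" where
  "mdag_model G c = marginal_model (can G) c"

definition obs_dominates :: "'v mdag \<Rightarrow> 'v mdag \<Rightarrow> bool" where
  "obs_dominates G G' \<longleftrightarrow> nodes G = nodes G' \<and>
     (\<forall>c. (\<forall>v\<in>nodes G. 0 < c v) \<longrightarrow> mdag_model G' c \<subseteq> mdag_model G c)"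

definition obs_equivalent :: "'v mdag \<Rightarrow> 'v mdag \<Rightarrow> bool" where
  "obs_equivalent G G' \<longleftrightarrow> nodes G = nodes G' \<and>
     (\<forall>c. (\<forall>v\<in>nodes G. 0 < c v) \<longrightarrow> mdag_model G' c = mdag_model G c)"

text \<open>A list of distinct nodes is read as a nodal ordering.\<close>

definition consistent_with :: "'v list \<Rightarrow> 'v mdag \<Rightarrow> bool" where
  "consistent_with vs G \<longleftrightarrow> distinct vs \<and> set vs = nodes G \<and>
     (\<forall>i j. i < j \<and> j < length vs \<longrightarrow> (vs ! j, vs ! i) \<notin> (edges G)\<^sup>+)"

text \<open>Real polynomials in indeterminates indexed by \<open>'x\<close>: monomials are finitely supported exponent
  functions.\<close>

type_synonym 'x real_mpoly = "('x \<Rightarrow>\<^sub>0 nat) \<Rightarrow>\<^sub>0 real"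

definition mpoly_eval :: "'x real_mpoly \<Rightarrow> ('x \<Rightarrow> real) \<Rightarrow> real" where
  "mpoly_eval p z =
     (\<Sum>m\<in>Poly_Mapping.keys p. Poly_Mapping.lookup p m *
        (\<Prod>i\<in>Poly_Mapping.keys m. z i ^ Poly_Mapping.lookup m i))"

text \<open>Zero loci of polynomials that only involve the coordinates in \<open>I\<close>.\<close>

definition real_algebraic_set :: "'x set \<Rightarrow> ('x \<Rightarrow> real) set \<Rightarrow> bool" where
  "real_algebraic_set I Z \<longleftrightarrow>
     (\<exists>F :: 'x real_mpoly set.
        (\<forall>p\<in>F. \<forall>m\<in>Poly_Mapping.keys p. Poly_Mapping.keys m \<subseteq> I) \<and>
        Z = {z. \<forall>p\<in>F. mpoly_eval p z = 0})"

definition algebraic_mdag :: "'v mdag \<Rightarrow> bool" where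
  "algebraic_mdag G \<longleftrightarrow>
     (\<forall>c. (\<forall>v\<in>nodes G. 0 < c v) \<longrightarrow>
        (\<exists>Z. real_algebraic_set (outcomes (nodes G) c) Z \<and>
             mdag_model G c = {P \<in> prob_simplex (nodes G) c. pmf P \<in> Z}))"

text \<open>In each rule the first mDAG dominates the second one.\<close>

definition structural_dominance :: "'v mdag \<Rightarrow> 'v mdag \<Rightarrow> bool" where
  "structural_dominance G G' \<longleftrightarrow>
     nodes G = nodes G' \<and> edges G' \<subseteq> edges G \<and> faces G' \<subseteq> faces G"

definition hlp_edge_adding :: "'v mdag \<Rightarrow> 'v mdag \<Rightarrow> bool" where
  "hlp_edge_adding G G' \<longleftrightarrow>
     (\<exists>x\<in>nodes G. \<exists>y\<in>nodes G.
        parents (edges G) {x} \<subseteq> parents (edges G) {y} \<and>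
        (\<forall>A\<in>facets G. x \<in> A \<longrightarrow> y \<in> A) \<and>
        G' = G\<lparr>edges := insert (x, y) (edges G)\<rparr>)"

definition weak_facet_adding :: "'v mdag \<Rightarrow> 'v mdag \<Rightarrow> bool" where
  "weak_facet_adding G G' \<longleftrightarrow>
     (\<exists>C\<in>faces G. \<exists>D\<in>faces G. C \<inter> D = {} \<and>
        (\<forall>d\<in>D. parents (edges G) C \<union> C \<subseteq> parents (edges G) {d}) \<and>
        (\<forall>A\<in>faces G. A \<inter> C \<noteq> {} \<longrightarrow> A \<subseteq> C) \<and>
        G' = G\<lparr>faces := faces G \<union> Pow (C \<union> D)\<rparr>)"

text \<open>One step of a chain of rule applications within the mDAGs on the node set \<open>N\<close>; requiring
  \<open>is_mdag G'\<close> excludes edge additions that create a directed cycle.\<close>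

definition dominance_step :: "'v set \<Rightarrow> 'v mdag \<Rightarrow> 'v mdag \<Rightarrow> bool" where
  "dominance_step N G G' \<longleftrightarrow>
     is_mdag G \<and> nodes G = N \<and> is_mdag G' \<and> nodes G' = N \<and>
     (structural_dominance G G' \<or> hlp_edge_adding G G' \<or> weak_facet_adding G G')"

datatype abc = Node_a | Node_b | Node_c

definition three_mdags :: "abc mdag set" where
  "three_mdags = {G. is_mdag G \<and> nodes G = {Node_a, Node_b, Node_c} \<and>
     consistent_with [Node_a, Node_b, Node_c] G}"

definition obs_classes :: "abc mdag set set" where
  "obs_classes =
     three_mdags // {(G, G'). G \<in> three_mdags \<and> G' \<in> three_mdags \<and> obs_equivalent G G'}"

end

(* The model of an mDAG is rewritten as a structural equation model without error terms: one
   independent latent per face, and each node a function of its parents and of the latents of the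
   faces that contain it. In this form the three rules are sound: under the HLP hypotheses y can
   recompute x, and for weak facet-adding the latent shared by C and D is replaced by one latent for
   C and one for D that holds, for each value of C and its parents, a conditioned sample of the
   old latent.

   Conversely, the rules reduce the 72 mDAGs to 15 representatives, and nine distributions on bits
   show that no further dominance holds. Each is excluded from a model by splicing two samples of the
   independent latents, which only depends on the support of the distribution.

   Ten representatives are equivalent to an mDAG without confounding, whose model is cut out by the
   quadratic equations of the ordered Markov property. For the other five there is a line in the
   probability simplex that has a segment inside the model but leaves it later, and a polynomial
   that vanishes on the segment vanishes on the whole line. *)

theory Submission
  imports Defs "HOL-Computational_Algebra.Polynomial"
begin

section \<open>Structural equation models\<close>

text \<open>Latent state spaces have no size bound, so a distribution cannot be excluded from a
  model by a search over parameters. What remains is possibilistic: latent values that occur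
  separately also occur jointly, so a recombination of samples that would yield an outcome of
  probability zero is a contradiction.

  Latents are indexed by an arbitrary set with a scope for each index, not by the faces themselves.
  Error terms, facets, faces and the auxiliary latents of weak facet-adding are then all compared by
  one inclusion lemma, \<open>sem_model_mono\<close>.

  The unconfounded forms of two algebraic classes are colliders at a and at b, whose edges violate
  the ordering; one chain between members of the 72 mDAGs also passes through such an edge.

  In the instrumental scenarios \<open>reps ! 10\<close>, \<open>reps ! 11\<close> and
  \<open>reps ! 13\<close> the line runs towards a distribution in which the outcome copies the
  instrument while the treatment is constantly 0. It leaves the region allowed by Pearl's
  instrumental inequality at t = 1/2. For the triangle the line runs towards the uniform
  distribution on the outcomes with exactly one 1.\<close>

definition local_eqs ::
  "'v rel \<Rightarrow> 'i set \<Rightarrow> ('i \<Rightarrow> 'v set) \<Rightarrow> ('v \<Rightarrow> ('v \<Rightarrow> nat) \<Rightarrow> ('i \<Rightarrow> 'l) \<Rightarrow> nat) \<Rightarrow> bool" where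
  "local_eqs E L sc f \<longleftrightarrow> (\<forall>v x x' u u'.
     (\<forall>w. (w, v) \<in> E \<longrightarrow> x w = x' w) \<longrightarrow> (\<forall>l\<in>L. v \<in> sc l \<longrightarrow> u l = u' l) \<longrightarrow>
     f v x u = f v x' u')"

lemma local_eqsD:
  assumes "local_eqs E L sc f" "\<And>w. (w, v) \<in> E \<Longrightarrow> x w = x' w"
    "\<And>l. l \<in> L \<Longrightarrow> v \<in> sc l \<Longrightarrow> u l = u' l"
  shows "f v x u = f v x' u'"
  using assms unfolding local_eqs_def by blast

definition solutions ::
  "'v set \<Rightarrow> ('v \<Rightarrow> ('v \<Rightarrow> nat) \<Rightarrow> 'u \<Rightarrow> nat) \<Rightarrow> ('v \<Rightarrow> nat) \<Rightarrow> 'u set" where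
  "solutions N f x = {u. \<forall>v\<in>N. x v = f v x u}"

text \<open>Error terms are absorbed: singletons are faces of an mDAG, so every node has a private
  latent. Latent values are natural numbers because a type cannot be quantified existentially inside
  a definition; \<open>sem_modelI\<close> admits every other type.\<close>

definition sem_model ::
  "'v set \<Rightarrow> 'v rel \<Rightarrow> 'i set \<Rightarrow> ('i \<Rightarrow> 'v set) \<Rightarrow> ('v \<Rightarrow> nat) \<Rightarrow> ('v \<Rightarrow> nat) pmf set" where
  "sem_model N E L sc c = {P \<in> prob_simplex N c. \<exists>(Q :: 'i \<Rightarrow> nat pmf) f.
     (\<forall>l\<in>L. finite (set_pmf (Q l))) \<and> local_eqs E L sc f \<and>
     (\<forall>v\<in>N. \<forall>x u. f v x u < c v) \<and>
     (\<forall>x\<in>outcomes N c.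
        pmf P x = measure_pmf.prob (Pi_pmf L undefined Q) (solutions N f x))}"

lemma prob_Pi_pmf_default:
  assumes "finite L" and "\<And>u u'. (\<forall>l\<in>L. u l = u' l) \<Longrightarrow> u \<in> B \<longleftrightarrow> u' \<in> B"
  shows "measure_pmf.prob (Pi_pmf L d Q) B = measure_pmf.prob (Pi_pmf L d' Q) B"
proof -
  have "measure_pmf.prob (Pi_pmf L d' Q) B =
      measure_pmf.prob (Pi_pmf L d Q) ((\<lambda>u x. if x \<in> L then u x else d') -` B)"
    unfolding Pi_pmf_default_swap[OF assms(1), symmetric, where dflt = d and dflt' = d'] by simp
  also have "(\<lambda>u x. if x \<in> L then u x else d') -` B = B"
  proof (rule set_eqI)
    fix u
    show "u \<in> (\<lambda>u x. if x \<in> L then u x else d') -` B \<longleftrightarrow> u \<in> B"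
      using assms(2)[of "\<lambda>x. if x \<in> L then u x else d'" u] by simp
  qed
  finally show ?thesis by simp
qed

lemma prob_cong_set_pmf:
  assumes "\<And>u. u \<in> set_pmf M \<Longrightarrow> u \<in> A \<longleftrightarrow> u \<in> B"
  shows "measure_pmf.prob M A = measure_pmf.prob M B"
proof -
  have "A \<inter> set_pmf M = B \<inter> set_pmf M" using assms by auto
  then show ?thesis by (metis measure_Int_set_pmf)
qed

text \<open>The finitely many latent values that occur are encoded into \<open>nat\<close>. It
  suffices to bound the mechanisms on outcomes and on the supports, since larger values are cut off
  to 0, which is admissible as the cardinalities are positive.\<close>

lemma sem_modelI:
  fixes Q :: "'i \<Rightarrow> 'l pmf" and f :: "'v \<Rightarrow> ('v \<Rightarrow> nat) \<Rightarrow> ('i \<Rightarrow> 'l) \<Rightarrow> nat"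
  assumes fin: "finite L" and P: "P \<in> prob_simplex N c" and Q: "\<And>l. l \<in> L \<Longrightarrow> finite (set_pmf (Q l))"
    and loc: "local_eqs E L sc f" and pos: "\<And>v. v \<in> N \<Longrightarrow> 0 < c v"
    and bd: "\<And>v x u. v \<in> N \<Longrightarrow> x \<in> outcomes N c \<Longrightarrow> (\<And>l. l \<in> L \<Longrightarrow> u l \<in> set_pmf (Q l)) \<Longrightarrow>
      f v x u < c v"
    and eq: "\<And>x. x \<in> outcomes N c \<Longrightarrow>
      pmf P x = measure_pmf.prob (Pi_pmf L d Q) (solutions N f x)"
  shows "P \<in> sem_model N E L sc c"
proof -
  define S where "S = (\<Union>l\<in>L. set_pmf (Q l))"
  have finS: "finite S" using fin Q by (simp add: S_def)
  define h where "h = to_nat_on S"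
  define k where "k = from_nat_into S"
  have kh: "k (h s) = s" if "s \<in> S" for s
    using that finS by (simp add: h_def k_def countable_finite)
  define Q' where "Q' l = map_pmf h (Q l)" for l
  define f' where "f' v x u = (let y = f v x (\<lambda>l. k (u l)) in if y < c v then y else 0)" for v x u
  have ext: "u \<in> solutions N f' x \<longleftrightarrow> u' \<in> solutions N f' x" if "\<forall>l\<in>L. u l = u' l" for u u' x
  proof -
    have "f v x (\<lambda>l. k (u l)) = f v x (\<lambda>l. k (u' l))" for v
      by (rule local_eqsD[OF loc]) (use that in auto)
    then show ?thesis by (simp add: solutions_def f'_def)
  qed
  have "pmf P x = measure_pmf.prob (Pi_pmf L undefined Q') (solutions N f' x)"
    if x: "x \<in> outcomes N c" for x
  proof -
    have "measure_pmf.prob (Pi_pmf L undefined Q') (solutions N f' x) =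
        measure_pmf.prob (Pi_pmf L (h d) Q') (solutions N f' x)"
      by (rule prob_Pi_pmf_default[OF fin ext])
    also have "\<dots> = measure_pmf.prob (Pi_pmf L d Q) ((\<lambda>g. h \<circ> g) -` solutions N f' x)"
      unfolding Q'_def by (subst Pi_pmf_map[OF fin refl]) simp
    also have "\<dots> = measure_pmf.prob (Pi_pmf L d Q) (solutions N f x)"
    proof (rule prob_cong_set_pmf)
      fix u assume "u \<in> set_pmf (Pi_pmf L d Q)"
      then have u: "u l \<in> set_pmf (Q l)" if "l \<in> L" for l
        using that fin by (auto simp: set_Pi_pmf PiE_dflt_def)
      have eq1: "f v x (\<lambda>l. k ((h \<circ> u) l)) = f v x u" for v
        by (rule local_eqsD[OF loc]) (use u kh in \<open>auto simp: S_def\<close>)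
      have "f' v x (h \<circ> u) = f v x u" if "v \<in> N" for v
        using bd[OF that x u] eq1 by (simp add: f'_def)
      then show "u \<in> (\<lambda>g. h \<circ> g) -` solutions N f' x \<longleftrightarrow> u \<in> solutions N f x"
        by (simp add: solutions_def)
    qed
    finally show ?thesis using eq[OF x] by simp
  qed
  moreover have "local_eqs E L sc f'"
    unfolding local_eqs_def
  proof (intro allI impI)
    fix v and x x' :: "'v \<Rightarrow> nat" and u u' :: "'i \<Rightarrow> nat"
    assume "\<forall>w. (w, v) \<in> E \<longrightarrow> x w = x' w" "\<forall>l\<in>L. v \<in> sc l \<longrightarrow> u l = u' l"
    then have "f v x (\<lambda>l. k (u l)) = f v x' (\<lambda>l. k (u' l))"
      by (intro local_eqsD[OF loc]) auto
    then show "f' v x u = f' v x' u'" by (simp add: f'_def)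
  qed
  moreover have "\<forall>v\<in>N. \<forall>x u. f' v x u < c v" using pos by (simp add: f'_def Let_def)
  moreover have "\<forall>l\<in>L. finite (set_pmf (Q' l))" using Q by (simp add: Q'_def)
  ultimately show ?thesis using P unfolding sem_model_def by blast
qed

text \<open>Bundling keeps independence: grouped along \<open>\<phi>\<close>, an independent family
  is an independent family of independent bundles. Point masses can be compared because each
  \<open>y\<close> with default values outside \<open>L\<close> has a single preimage in the
  support, namely \<open>z\<close>.\<close>

lemma Pi_pmf_group:
  fixes \<phi> :: "'i \<Rightarrow> 'j"
  assumes fin: "finite L" "finite L'" and \<phi>: "\<And>l. l \<in> L \<Longrightarrow> \<phi> l \<in> L'"
  shows "Pi_pmf L d Q = map_pmf (\<lambda>w l. if l \<in> L then w (\<phi> l) l else d)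
    (Pi_pmf L' d' (\<lambda>j. Pi_pmf {l\<in>L. \<phi> l = j} d Q))"
    (is "_ = map_pmf ?g ?M")
proof (rule pmf_eqI)
  fix y :: "'i \<Rightarrow> 'a"
  define z where "z j = (if j \<in> L' then (\<lambda>l. if l \<in> L \<and> \<phi> l = j then y l else d) else d')" for j
  show "pmf (Pi_pmf L d Q) y = pmf (map_pmf ?g ?M) y"
  proof (cases "\<forall>l. l \<notin> L \<longrightarrow> y l = d")
    case True
    have sub: "w = z" if w: "w \<in> set_pmf ?M" and g: "?g w = y" for w
    proof
      fix j
      have w': "w j = d'" if "j \<notin> L'" using w that fin by (auto simp: set_Pi_pmf PiE_dflt_def)
      show "w j = z j"
      proof (cases "j \<in> L'")
        case j: True
        then have *: "w j \<in> PiE_dflt {l\<in>L. \<phi> l = j} d (set_pmf \<circ> Q)"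
          using w fin by (auto simp: set_Pi_pmf PiE_dflt_def)
        have "w j l = z j l" for l
          using * j g[unfolded fun_eq_iff, rule_format, of l] by (auto simp: PiE_dflt_def z_def split: if_splits)
        then show ?thesis by auto
      qed (use w' in \<open>simp add: z_def\<close>)
    qed
    have gz: "?g z = y" using True \<phi> by (auto simp: z_def)
    have "pmf (map_pmf ?g ?M) y = measure_pmf.prob ?M (?g -` {y})" by (simp add: pmf_map)
    also have "\<dots> = measure_pmf.prob ?M {z}"
      by (rule prob_cong_set_pmf) (use sub gz in auto)
    also have "\<dots> = pmf ?M z" by (simp add: measure_pmf_single)
    also have "\<dots> = (\<Prod>j\<in>L'. pmf (Pi_pmf {l\<in>L. \<phi> l = j} d Q) (z j))"
      using fin by (subst pmf_Pi') (auto simp: z_def)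
    also have "\<dots> = (\<Prod>j\<in>L'. \<Prod>l\<in>{l\<in>L. \<phi> l = j}. pmf (Q l) (y l))"
      using fin by (intro prod.cong refl, subst pmf_Pi') (auto simp: z_def intro!: prod.cong)
    also have "\<dots> = (\<Prod>l\<in>L. pmf (Q l) (y l))"
      using fin \<phi> by (intro prod.group) auto
    also have "\<dots> = pmf (Pi_pmf L d Q) y" using fin True by (subst pmf_Pi') auto
    finally show ?thesis by simp
  next
    case False
    then obtain l where l: "l \<notin> L" "y l \<noteq> d" by auto
    then have "y \<notin> ?g ` set_pmf ?M" by auto
    then have "pmf (map_pmf ?g ?M) y = 0" by (simp add: pmf_eq_0_set_pmf)
    then show ?thesis using l fin by (subst pmf_Pi_outside) auto
  qed
qed

text \<open>The new latent \<open>j\<close> carries the tuple of all old latents sent to it. A node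
  that saw \<open>l\<close> also sees \<open>\<phi> l\<close> and reads off the component; a target
  without preimage carries a constant tuple.\<close>

lemma sem_model_mono:
  fixes \<phi> :: "'i \<Rightarrow> 'j" and N :: "'v set"
  assumes fin: "finite L" "finite L'" and E: "E \<subseteq> E'" and pos: "\<And>v. v \<in> N \<Longrightarrow> 0 < c v"
    and \<phi>: "\<And>l. l \<in> L \<Longrightarrow> \<phi> l \<in> L' \<and> sc l \<subseteq> sc' (\<phi> l)"
  shows "sem_model N E L sc c \<subseteq> sem_model N E' L' sc' c"
proof
  fix P assume "P \<in> sem_model N E L sc c"
  then obtain Q :: "'i \<Rightarrow> nat pmf" and f
    where P: "P \<in> prob_simplex N c" and Q: "\<And>l. l \<in> L \<Longrightarrow> finite (set_pmf (Q l))"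
      and loc: "local_eqs E L sc f" and bd: "\<And>v x u. v \<in> N \<Longrightarrow> f v x u < c v"
      and eq: "\<And>x. x \<in> outcomes N c \<Longrightarrow>
        pmf P x = measure_pmf.prob (Pi_pmf L undefined Q) (solutions N f x)"
    unfolding sem_model_def by blast
  define g :: "('j \<Rightarrow> 'i \<Rightarrow> nat) \<Rightarrow> 'i \<Rightarrow> nat"
    where "g w l = (if l \<in> L then w (\<phi> l) l else undefined)" for w l
  define Q' where "Q' j = Pi_pmf {l\<in>L. \<phi> l = j} undefined Q" for j
  define f' where "f' v x w = f v x (g w)" for v x w
  show "P \<in> sem_model N E' L' sc' c"
  proof (rule sem_modelI[where Q = Q' and f = f' and d = undefined])
    show "finite (set_pmf (Q' j))" for j
      unfolding Q'_def by (rule finite_subset[OF set_Pi_pmf_subset']) (use fin Q in auto)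
    show "local_eqs E' L' sc' f'"
      unfolding local_eqs_def f'_def
    proof (intro allI impI)
      fix v and x x' :: "'v \<Rightarrow> nat" and u u' :: "'j \<Rightarrow> 'i \<Rightarrow> nat"
      assume "\<forall>w. (w, v) \<in> E' \<longrightarrow> x w = x' w" "\<forall>l\<in>L'. v \<in> sc' l \<longrightarrow> u l = u' l"
      moreover from this have "u (\<phi> l) = u' (\<phi> l)" if "l \<in> L" "v \<in> sc l" for l
        using \<phi>[OF that(1)] that(2) by blast
      ultimately show "f v x (g u) = f v x' (g u')"
        by (intro local_eqsD[OF loc]) (use E in \<open>auto simp: g_def\<close>)
    qed
    fix x assume "x \<in> outcomes N c"
    have "Pi_pmf L undefined Q = map_pmf g (Pi_pmf L' undefined Q')"
      using Pi_pmf_group[OF fin, where \<phi> = \<phi> and d = undefined and Q = Q and d' = undefined] \<phi>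
      unfolding Q'_def g_def[abs_def] by blast
    moreover have "g -` solutions N f x = solutions N f' x" by (auto simp: solutions_def f'_def)
    ultimately show "pmf P x = measure_pmf.prob (Pi_pmf L' undefined Q') (solutions N f' x)"
      using eq[OF \<open>x \<in> outcomes N c\<close>] by simp
  qed (use fin P pos bd in \<open>auto simp: f'_def\<close>)
qed


section \<open>From canonical pDAGs to structural equations without error terms\<close>

lemma restrict_empty: "restrict f {} = (\<lambda>_. undefined)"
  by (simp add: restrict_def)

lemma prod_of_bool:
  "finite A \<Longrightarrow> (\<Prod>a\<in>A. of_bool (P a)) = (of_bool (\<forall>a\<in>A. P a) :: real)"
  by (induction A rule: finite_induct) auto

lemma prob_eq_sum:
  assumes "finite A" "set_pmf M \<subseteq> A"
  shows "measure_pmf.prob M B = (\<Sum>e\<in>A. pmf M e * of_bool (e \<in> B))"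
proof -
  have "measure_pmf.prob M B = measure_pmf.prob M (A \<inter> B)"
    by (rule prob_cong_set_pmf) (use assms in auto)
  also have "\<dots> = (\<Sum>e\<in>A \<inter> B. pmf M e)" using assms by (simp add: measure_measure_pmf_finite)
  also have "\<dots> = (\<Sum>e\<in>A. pmf M e * of_bool (e \<in> B))"
    using assms by (simp add: sum.inter_restrict of_bool_def if_distrib cong: if_cong)
  finally show ?thesis .
qed

lemma parents_can_Inl:
  "parents (arrows (can G)) {Inl v} = Inl ` parents (edges G) {v} \<union> Inr ` {A\<in>facets G. v \<in> A}"
  by (auto simp: parents_def can_def)

lemma parents_can_Inr: "parents (arrows (can G)) {Inr A} = {}"
  by (auto simp: parents_def can_def)

lemma pdag_nodes_can: "pdag_nodes (can G) = Inl ` nodes G \<union> Inr ` facets G"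
  by (simp add: pdag_nodes_def can_def Plus_def)

lemma valid_params_latent:
  assumes val: "valid_params (can G) c S W f" and A: "A \<in> facets G" and e: "e \<in> set_pmf (W (Inr A))"
  shows "f (Inr A) (\<lambda>_. undefined) e \<in> S A"
proof -
  have "Inr A \<in> pdag_nodes (can G)" using A by (simp add: pdag_nodes_can)
  then have "\<forall>z\<in>Pi\<^sub>E (parents (arrows (can G)) {Inr A}) (state_space c S).
      \<forall>e\<in>set_pmf (W (Inr A)). f (Inr A) z e \<in> state_space c S (Inr A)"
    using val unfolding valid_params_def by blast
  then have "f (Inr A) (\<lambda>_. undefined) e \<in> state_space c S (Inr A)"
    using e by (simp add: parents_can_Inr)
  then show ?thesis by (simp add: state_space_def)
qed

lemma finite_faces:
  assumes "is_mdag G" shows "finite (faces G)"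
  using assms finite_subset unfolding is_mdag_def by (metis finite_Pow_iff)

lemma facets_subset: "facets G \<subseteq> faces G"
  by (auto simp: facets_def)

lemma finite_pdag_nodes_can:
  assumes "is_mdag G" shows "finite (pdag_nodes (can G))"
  using is_pdag_can[OF assms] by (simp add: is_pdag_def)

lemma ex_facet:
  assumes "is_mdag G" "A \<in> faces G" shows "\<exists>B\<in>facets G. A \<subseteq> B"
proof -
  obtain B where "B \<in> faces G" "A \<subseteq> B" "\<forall>C\<in>faces G. B \<subseteq> C \<longrightarrow> B = C"
    using finite_has_maximal2[OF finite_faces[OF assms(1)] assms(2)] by blast
  then show ?thesis by (auto simp: facets_def)
qed

text \<open>The mechanism of a visible node after substitution: each latent parent is replaced by
  its function of its own error, and \<open>\<lambda>_. undefined\<close> is the empty tuple of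
  parents of a latent node.\<close>

definition can_eqs ::
  "'v mdag \<Rightarrow> ('v + 'v set \<Rightarrow> ('v + 'v set \<Rightarrow> nat) \<Rightarrow> nat \<Rightarrow> nat) \<Rightarrow>
   'v \<Rightarrow> ('v \<Rightarrow> nat) \<Rightarrow> ('v + 'v set \<Rightarrow> nat) \<Rightarrow> nat" where
  "can_eqs G f v x e = f (Inl v)
     (restrict (case_sum x (\<lambda>A. f (Inr A) (\<lambda>_. undefined) (e (Inr A)))) (parents (arrows (can G)) {Inl v}))
     (e (Inl v))"

text \<open>Latent nodes of a canonical pDAG have no parents. Once the errors are fixed, at most one
  latent assignment, \<open>y0\<close>, contributes; the sum over latents collapses and the errors
  become the independent exogenous variables.\<close>

lemma marginal_prob_can:
  assumes G: "is_mdag G" and val: "valid_params (can G) c S W f"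
  shows "marginal_prob (can G) S W f x =
    measure_pmf.prob (Pi_pmf (pdag_nodes (can G)) undefined W) (solutions (nodes G) (can_eqs G f) x)"
proof -
  let ?D = "pdag_nodes (can G)"
  let ?M = "Pi_pmf ?D undefined W"
  let ?Y = "\<Pi>\<^sub>E l\<in>latent (can G). S l"
  let ?E = "\<Pi>\<^sub>E a\<in>?D. set_pmf (W a)"
  have lat: "latent (can G) = facets G" by (simp add: can_def)
  have finD: "finite ?D" using finite_pdag_nodes_can[OF G] .
  have finW: "finite (set_pmf (W a))" if "a \<in> ?D" for a using val that by (simp add: valid_params_def)
  have finE: "finite ?E" using finD finW by (intro finite_PiE)
  have finF: "finite (facets G)" using finite_faces[OF G] facets_subset finite_subset by blast
  have finY: "finite ?Y" using val finF lat by (intro finite_PiE) (auto simp: valid_params_def)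
  let ?c = "\<lambda>y e a. case_sum x y a = f a (restrict (case_sum x y) (parents (arrows (can G)) {a})) (e a)"
  have inner: "(\<Sum>y\<in>?Y. of_bool (\<forall>a\<in>?D. ?c y e a)) =
      (of_bool (e \<in> solutions (nodes G) (can_eqs G f) x) :: real)" if e: "e \<in> ?E" for e
  proof -
    define y0 where "y0 = restrict (\<lambda>A. f (Inr A) (\<lambda>_. undefined) (e (Inr A))) (facets G)"
    have y0: "y0 \<in> ?Y"
    proof -
      have "f (Inr A) (\<lambda>_. undefined) (e (Inr A)) \<in> S A" if A: "A \<in> facets G" for A
      proof -
        have "Inr A \<in> ?D" using A by (simp add: pdag_nodes_can)
        then have "e (Inr A) \<in> set_pmf (W (Inr A))" using e by auto
        then show ?thesis by (rule valid_params_latent[OF val A])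
      qed
      then show ?thesis by (simp add: y0_def lat)
    qed
    have c_iff: "(\<forall>a\<in>?D. ?c y e a) \<longleftrightarrow> y = y0 \<and> e \<in> solutions (nodes G) (can_eqs G f) x"
      if y: "y \<in> ?Y" for y
    proof -
      have "(\<forall>A\<in>facets G. y A = f (Inr A) (\<lambda>_. undefined) (e (Inr A))) \<longleftrightarrow> y = y0"
      proof
        assume "\<forall>A\<in>facets G. y A = f (Inr A) (\<lambda>_. undefined) (e (Inr A))"
        then show "y = y0" using y by (intro PiE_ext[OF y y0]) (simp add: y0_def lat)
      qed (simp add: y0_def)
      moreover have "(\<forall>v\<in>nodes G. ?c y0 e (Inl v)) \<longleftrightarrow> e \<in> solutions (nodes G) (can_eqs G f) x"
      proof -
        have "restrict (case_sum x y0) (parents (arrows (can G)) {Inl v}) =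
          restrict (case_sum x (\<lambda>A. f (Inr A) (\<lambda>_. undefined) (e (Inr A)))) (parents (arrows (can G)) {Inl v})" for v
          unfolding parents_can_Inl by (rule restrict_ext) (auto simp: y0_def)
        then show ?thesis by (simp add: solutions_def can_eqs_def)
      qed
      moreover have "(\<forall>a\<in>?D. ?c y e a) \<longleftrightarrow> (\<forall>v\<in>nodes G. ?c y e (Inl v)) \<and>
          (\<forall>A\<in>facets G. y A = f (Inr A) (\<lambda>_. undefined) (e (Inr A)))"
        using restrict_empty[of "case_sum x y"]
        unfolding pdag_nodes_can ball_Un by (simp add: parents_can_Inr)
      ultimately show ?thesis by metis
    qed
    have "(\<Sum>y\<in>?Y. of_bool (\<forall>a\<in>?D. ?c y e a)) =
        (\<Sum>y\<in>?Y. if y = y0 then of_bool (e \<in> solutions (nodes G) (can_eqs G f) x) else (0::real))"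
      by (intro sum.cong refl) (use c_iff in auto)
    then show ?thesis using y0 finY by simp
  qed
  have "marginal_prob (can G) S W f x =
      (\<Sum>y\<in>?Y. \<Sum>e\<in>?E. of_bool (\<forall>a\<in>?D. ?c y e a) * (\<Prod>a\<in>?D. pmf (W a) (e a)))"
    unfolding marginal_prob_def Let_def by (simp only: prod.distrib prod_of_bool[OF finD])
  also have "\<dots> = (\<Sum>e\<in>?E. \<Sum>y\<in>?Y. of_bool (\<forall>a\<in>?D. ?c y e a) * (\<Prod>a\<in>?D. pmf (W a) (e a)))"
    by (rule sum.swap)
  also have "\<dots> = (\<Sum>e\<in>?E. of_bool (e \<in> solutions (nodes G) (can_eqs G f) x) * (\<Prod>a\<in>?D. pmf (W a) (e a)))"
    by (intro sum.cong refl) (simp only: sum_distrib_right[symmetric] inner)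
  also have "\<dots> = (\<Sum>e\<in>?E. pmf ?M e * of_bool (e \<in> solutions (nodes G) (can_eqs G f) x))"
  proof (intro sum.cong refl)
    fix e assume "e \<in> ?E"
    then have "pmf ?M e = (\<Prod>a\<in>?D. pmf (W a) (e a))"
      using finD by (intro pmf_Pi') (auto simp: PiE_def extensional_def)
    then show "of_bool (e \<in> solutions (nodes G) (can_eqs G f) x) * (\<Prod>a\<in>?D. pmf (W a) (e a)) =
        pmf ?M e * of_bool (e \<in> solutions (nodes G) (can_eqs G f) x)" by simp
  qed
  also have "\<dots> = measure_pmf.prob ?M (solutions (nodes G) (can_eqs G f) x)"
  proof (rule prob_eq_sum[symmetric, OF finE])
    show "set_pmf ?M \<subseteq> ?E"
      unfolding set_Pi_pmf[OF finD] by (auto simp: PiE_dflt_def PiE_def extensional_def)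
  qed
  finally show ?thesis .
qed

text \<open>The exogenous variables are the errors of all pDAG nodes: the error of \<open>v\<close>
  has scope \<open>{v}\<close>, the error of the latent of a facet has that facet as its
  scope.\<close>

lemma mdag_model_subset_sem:
  assumes G: "is_mdag G" and pos: "\<And>v. v \<in> nodes G \<Longrightarrow> 0 < c v"
  shows "mdag_model G c \<subseteq>
    sem_model (nodes G) (edges G) (pdag_nodes (can G)) (case_sum (\<lambda>v. {v}) id) c"
proof
  fix P assume "P \<in> mdag_model G c"
  then obtain S W f where P: "P \<in> prob_simplex (nodes G) c" and val: "valid_params (can G) c S W f"
    and eq: "\<And>x. x \<in> outcomes (nodes G) c \<Longrightarrow> pmf P x = marginal_prob (can G) S W f x"
    unfolding mdag_model_def marginal_model_def by (auto simp: can_def)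
  define g where "g v x e = (if v \<in> nodes G then can_eqs G f v x e else 0)" for v x e
  show "P \<in> sem_model (nodes G) (edges G) (pdag_nodes (can G)) (case_sum (\<lambda>v. {v}) id) c"
  proof (rule sem_modelI[where Q = W and f = g and d = undefined])
    show "local_eqs (edges G) (pdag_nodes (can G)) (case_sum (\<lambda>v. {v}) id) g"
      unfolding local_eqs_def
    proof (intro allI impI)
      fix v and x x' :: "'a \<Rightarrow> nat" and u u' :: "'a + 'a set \<Rightarrow> nat"
      assume x: "\<forall>w. (w, v) \<in> edges G \<longrightarrow> x w = x' w"
        and u: "\<forall>l\<in>pdag_nodes (can G). v \<in> case_sum (\<lambda>v. {v}) id l \<longrightarrow> u l = u' l"
      have u1: "u (Inr A) = u' (Inr A)" if "A \<in> facets G" "v \<in> A" for A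
        using u that by (auto simp: pdag_nodes_can)
      show "g v x u = g v x' u'"
      proof (cases "v \<in> nodes G")
        case True
        then have "u (Inl v) = u' (Inl v)" using u by (auto simp: pdag_nodes_can)
        moreover have "restrict (case_sum x (\<lambda>A. f (Inr A) (\<lambda>_. undefined) (u (Inr A))))
            (parents (arrows (can G)) {Inl v}) =
          restrict (case_sum x' (\<lambda>A. f (Inr A) (\<lambda>_. undefined) (u' (Inr A))))
            (parents (arrows (can G)) {Inl v})"
          unfolding parents_can_Inl by (rule restrict_ext) (use x u1 in \<open>auto simp: parents_def\<close>)
        ultimately show ?thesis by (simp add: can_eqs_def g_def)
      qed (simp add: g_def)
    qed
    fix v x and u :: "'a + 'a set \<Rightarrow> nat"
    assume v: "v \<in> nodes G" and x: "x \<in> outcomes (nodes G) c"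
      and u: "\<And>l. l \<in> pdag_nodes (can G) \<Longrightarrow> u l \<in> set_pmf (W l)"
    have lat: "f (Inr A) (\<lambda>_. undefined) (u (Inr A)) \<in> S A" if A: "A \<in> facets G" for A
    proof -
      have "Inr A \<in> pdag_nodes (can G)" using A by (simp add: pdag_nodes_can)
      then show ?thesis using valid_params_latent[OF val A] u by blast
    qed
    have "restrict (case_sum x (\<lambda>A. f (Inr A) (\<lambda>_. undefined) (u (Inr A)))) (parents (arrows (can G)) {Inl v})
      \<in> (\<Pi>\<^sub>E w\<in>parents (arrows (can G)) {Inl v}. state_space c S w)"
      unfolding parents_can_Inl
      using G x lat by (auto simp: state_space_def outcomes_def parents_def is_mdag_def)
    moreover have v': "Inl v \<in> pdag_nodes (can G)" using v by (simp add: pdag_nodes_can)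
    ultimately have "can_eqs G f v x u \<in> state_space c S (Inl v)"
      using val u[OF v'] unfolding valid_params_def can_eqs_def by blast
    then show "g v x u < c v" using v by (simp add: state_space_def g_def)
  next
    fix l assume "l \<in> pdag_nodes (can G)"
    then show "finite (set_pmf (W l))" using val by (simp add: valid_params_def)
  next
    fix x assume "x \<in> outcomes (nodes G) c"
    then show "pmf P x = measure_pmf.prob (Pi_pmf (pdag_nodes (can G)) undefined W)
        (solutions (nodes G) g x)"
      using eq marginal_prob_can[OF G val] by (simp add: solutions_def g_def)
  qed (use P pos finite_pdag_nodes_can[OF G] in auto)
qed

text \<open>In the other direction a latent node simply outputs its own error, and a visible node
  feeds its own error and the values of its latent parents into the given mechanism.\<close>

lemma sem_subset_mdag_model:
  assumes G: "is_mdag G"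
  shows "sem_model (nodes G) (edges G) (pdag_nodes (can G)) (case_sum (\<lambda>v. {v}) id) c \<subseteq> mdag_model G c"
proof
  fix P assume "P \<in> sem_model (nodes G) (edges G) (pdag_nodes (can G)) (case_sum (\<lambda>v. {v}) id) c"
  then obtain Q :: "'a + 'a set \<Rightarrow> nat pmf" and f where P: "P \<in> prob_simplex (nodes G) c"
    and Q: "\<And>l. l \<in> pdag_nodes (can G) \<Longrightarrow> finite (set_pmf (Q l))"
    and loc: "local_eqs (edges G) (pdag_nodes (can G)) (case_sum (\<lambda>v. {v}) id) f"
    and bd: "\<And>v x u. v \<in> nodes G \<Longrightarrow> f v x u < c v"
    and eq: "\<And>x. x \<in> outcomes (nodes G) c \<Longrightarrow>
      pmf P x = measure_pmf.prob (Pi_pmf (pdag_nodes (can G)) undefined Q) (solutions (nodes G) f x)"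
    unfolding sem_model_def by blast
  define S where "S A = set_pmf (Q (Inr A))" for A
  define f' where "f' a z e = (case a of Inr A \<Rightarrow> e
    | Inl v \<Rightarrow> f v (\<lambda>w. z (Inl w)) (\<lambda>l. case l of Inl w \<Rightarrow> e | Inr A \<Rightarrow> z (Inr A)))"
    for a :: "'a + 'a set" and z and e :: nat
  have val: "valid_params (can G) c S Q f'"
    unfolding valid_params_def
  proof (intro conjI ballI)
    fix a z e
    assume "a \<in> pdag_nodes (can G)" "e \<in> set_pmf (Q a)"
    then show "f' a z e \<in> state_space c S a"
      using bd by (auto simp: pdag_nodes_can f'_def state_space_def S_def)
  next
    fix A assume "A \<in> latent (can G)"
    then have "Inr A \<in> pdag_nodes (can G)" unfolding pdag_nodes_can by (simp add: can_def)
    then show "finite (S A)" using Q by (simp add: S_def)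
  qed (use Q in simp)
  have "solutions (nodes G) (can_eqs G f') x = solutions (nodes G) f x" for x
  proof -
    have "can_eqs G f' v x e = f v x e" if "v \<in> nodes G" for v e
      unfolding can_eqs_def f'_def sum.case
      by (rule local_eqsD[OF loc])
        (unfold parents_can_Inl, auto simp: parents_def pdag_nodes_can)
    then show ?thesis by (simp add: solutions_def)
  qed
  then have "pmf P x = marginal_prob (can G) S Q f' x" if "x \<in> outcomes (nodes G) c" for x
    using eq[OF that] marginal_prob_can[OF G val, of x] by simp
  then show "P \<in> mdag_model G c"
    using P val unfolding mdag_model_def marginal_model_def by (auto simp: can_def)
qed

text \<open>A private error goes into a singleton face and a face into a facet around it. Edge
  adding uses the facet form, since its hypothesis fails for the singleton face \<open>{x}\<close>;
  rules that compare or enlarge complexes use the face form.\<close>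

theorem mdag_model_eq_sem_model:
  assumes G: "is_mdag G" and pos: "\<And>v. v \<in> nodes G \<Longrightarrow> 0 < c v"
  shows "mdag_model G c = sem_model (nodes G) (edges G) (facets G) id c"
    and "mdag_model G c = sem_model (nodes G) (edges G) (faces G) id c"
proof -
  let ?D = "pdag_nodes (can G)"
  let ?M = "\<lambda>L. sem_model (nodes G) (edges G) L id c"
  have fin: "finite (faces G)" "finite (facets G)" "finite ?D"
    using finite_faces[OF G] facets_subset finite_subset finite_pdag_nodes_can[OF G] by blast+
  obtain \<psi> where \<psi>: "\<And>A. A \<in> faces G \<Longrightarrow> \<psi> A \<in> facets G \<and> A \<subseteq> \<psi> A"
    using ex_facet[OF G] by metis
  have "mdag_model G c \<subseteq> sem_model (nodes G) (edges G) ?D (case_sum (\<lambda>v. {v}) id) c"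
    by (rule mdag_model_subset_sem[OF G pos])
  moreover have "sem_model (nodes G) (edges G) ?D (case_sum (\<lambda>v. {v}) id) c \<subseteq> ?M (faces G)"
    by (rule sem_model_mono[where \<phi> = "case_sum (\<lambda>v. {v}) id"])
      (use fin pos G facets_subset[of G] in \<open>auto simp: pdag_nodes_can is_mdag_def\<close>)
  moreover have "?M (faces G) \<subseteq> ?M (facets G)"
    by (rule sem_model_mono[where \<phi> = \<psi>]) (use fin pos \<psi> in auto)
  moreover have "?M (facets G) \<subseteq> sem_model (nodes G) (edges G) ?D (case_sum (\<lambda>v. {v}) id) c"
    by (rule sem_model_mono[where \<phi> = Inr]) (use fin pos in \<open>auto simp: pdag_nodes_can\<close>)
  moreover have "sem_model (nodes G) (edges G) ?D (case_sum (\<lambda>v. {v}) id) c \<subseteq> mdag_model G c"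
    by (rule sem_subset_mdag_model[OF G])
  ultimately show "mdag_model G c = ?M (facets G)" "mdag_model G c = ?M (faces G)" by auto
qed

section \<open>Soundness of the rules\<close>

lemma structural_dominance_sound:
  assumes G: "is_mdag G" and G': "is_mdag G'" and s: "structural_dominance G G'"
  shows "obs_dominates G G'"
proof -
  have "mdag_model G' c \<subseteq> mdag_model G c" if pos: "\<forall>v\<in>nodes G. 0 < c v" for c
  proof -
    have "sem_model (nodes G) (edges G') (faces G') id c \<subseteq> sem_model (nodes G) (edges G) (faces G) id c"
      by (rule sem_model_mono[where \<phi> = id])
        (use s pos finite_faces[OF G] finite_faces[OF G'] in \<open>auto simp: structural_dominance_def\<close>)
    then show ?thesis
      using mdag_model_eq_sem_model(2)[OF G, of c] mdag_model_eq_sem_model(2)[OF G', of c] pos s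
      by (simp add: structural_dominance_def)
  qed
  then show ?thesis using s by (simp add: obs_dominates_def structural_dominance_def)
qed

lemma hlp_edge_adding_sound:
  assumes G: "is_mdag G" and G': "is_mdag G'" and h: "hlp_edge_adding G G'"
  shows "obs_dominates G G'"
proof -
  obtain a b where a: "a \<in> nodes G" and b: "b \<in> nodes G"
    and pa: "parents (edges G) {a} \<subseteq> parents (edges G) {b}"
    and fa: "\<And>A. A \<in> facets G \<Longrightarrow> a \<in> A \<Longrightarrow> b \<in> A"
    and eq: "G' = G\<lparr>edges := insert (a, b) (edges G)\<rparr>"
    using h unfolding hlp_edge_adding_def by blast
  \<comment> \<open>\<open>G'\<close> has no loop, so the new edge does not change the parents of
    \<open>a\<close>.\<close>
  have ne: "a \<noteq> b" using G' eq by (auto simp: is_mdag_def acyclic_def)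
  have facets: "facets G' = facets G" by (simp add: facets_def eq)
  have "mdag_model G' c \<subseteq> mdag_model G c" if pos: "\<forall>v\<in>nodes G. 0 < c v" for c
  proof
    fix P assume "P \<in> mdag_model G' c"
    then have "P \<in> sem_model (nodes G) (insert (a, b) (edges G)) (facets G) id c"
      using mdag_model_eq_sem_model(1)[OF G', of c] pos facets by (simp add: eq)
    then obtain Q :: "'a set \<Rightarrow> nat pmf" and f
      where P: "P \<in> prob_simplex (nodes G) c" and Q: "\<forall>l\<in>facets G. finite (set_pmf (Q l))"
        and loc: "local_eqs (insert (a, b) (edges G)) (facets G) id f"
        and bd: "\<forall>v\<in>nodes G. \<forall>x u. f v x u < c v"
        and eqP: "\<forall>x\<in>outcomes (nodes G) c.
          pmf P x = measure_pmf.prob (Pi_pmf (facets G) undefined Q) (solutions (nodes G) f x)"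
      unfolding sem_model_def by blast
    \<comment> \<open>\<open>b\<close> sees everything that determines \<open>X\<^sub>a\<close>, so it can recompute \<open>X\<^sub>a\<close> by itself.\<close>
    define f' where "f' v x u = (if v = b then f b (x(a := f a x u)) u else f v x u)" for v x u
    have "solutions (nodes G) f' x = solutions (nodes G) f x" for x
    proof -
      \<comment> \<open>A solution of either system satisfies the equation of \<open>a\<close>,
        which \<open>f'\<close> leaves as it is; overwriting \<open>x a\<close> by the recomputed
        value then changes nothing.\<close>
      have "x(a := f a x u) = x" if "x a = f a x u" for u using that by auto
      moreover have "x a = f a x u"
        if "u \<in> solutions (nodes G) f x \<or> u \<in> solutions (nodes G) f' x" for u
        using that a ne by (auto simp: solutions_def f'_def)
      ultimately show ?thesis
        unfolding solutions_def f'_def set_eq_iff mem_Collect_eq by metis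
    qed
    moreover have "local_eqs (edges G) (facets G) id f'"
      unfolding local_eqs_def
    proof (intro allI impI)
      fix v and x x' :: "'a \<Rightarrow> nat" and u u' :: "'a set \<Rightarrow> nat"
      assume x: "\<forall>w. (w, v) \<in> edges G \<longrightarrow> x w = x' w"
        and u: "\<forall>l\<in>facets G. v \<in> id l \<longrightarrow> u l = u' l"
      show "f' v x u = f' v x' u'"
      proof (cases "v = b")
        case True
        have "f a x u = f a x' u'"
          by (rule local_eqsD[OF loc]) (use x u pa fa ne True in \<open>auto simp: parents_def\<close>)
        then have "f b (x(a := f a x u)) u = f b (x'(a := f a x' u')) u'"
          by (intro local_eqsD[OF loc]) (use x u True in auto)
        then show ?thesis using True by (simp add: f'_def)
      next
        case False
        then have "f v x u = f v x' u'" by (intro local_eqsD[OF loc]) (use x u in auto)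
        then show ?thesis using False by (simp add: f'_def)
      qed
    qed
    moreover have "\<forall>v\<in>nodes G. \<forall>x u. f' v x u < c v" using bd b by (simp add: f'_def)
    ultimately have "P \<in> sem_model (nodes G) (edges G) (facets G) id c"
      using P Q eqP unfolding sem_model_def mem_Collect_eq by metis
    then show "P \<in> mdag_model G c" using mdag_model_eq_sem_model(1)[OF G, of c] pos by simp
  qed
  then show ?thesis by (simp add: obs_dominates_def eq)
qed

section \<open>Splitting a latent that two sets of nodes share\<close>

lemma prob_bind_pmf:
  "measure_pmf.prob (bind_pmf M K) A = measure_pmf.expectation M (\<lambda>m. measure_pmf.prob (K m) A)"
proof -
  have *: "measure_pmf.prob N A = pmf (map_pmf (\<lambda>y. y \<in> A) N) True" for N
    by (simp add: pmf_map vimage_def)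
  show ?thesis unfolding * map_bind_pmf pmf_bind by simp
qed

lemma expectation_of_bool:
  "measure_pmf.expectation M (\<lambda>y. of_bool (B y)) = measure_pmf.prob M {y. B y}"
proof -
  have "(\<lambda>y. of_bool (B y)) = indicat_real {y. B y}" by (auto simp: indicator_def)
  then show ?thesis by simp
qed

lemma Pi_pmf_insert_bind:
  assumes "finite L" "l \<notin> L"
  shows "Pi_pmf (insert l L) d Q = bind_pmf (Pi_pmf L d Q) (\<lambda>u. map_pmf (\<lambda>w. u(l := w)) (Q l))"
  unfolding Pi_pmf_insert'[OF assms] map_pmf_def by (subst bind_commute_pmf) simp

lemma prob_Pi_pmf_insert:
  assumes "finite L" "l \<notin> L"
  shows "measure_pmf.prob (Pi_pmf (insert l L) d Q) A =
    measure_pmf.expectation (Pi_pmf L d Q) (\<lambda>u. measure_pmf.prob (Q l) {w. u(l := w) \<in> A})"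
  unfolding Pi_pmf_insert_bind[OF assms] by (simp add: prob_bind_pmf vimage_def)

lemma prob_cond_pmf:
  assumes "set_pmf M \<inter> A \<noteq> {}"
  shows "measure_pmf.prob (cond_pmf M A) B = measure_pmf.prob M (A \<inter> B) / measure_pmf.prob M A"
proof -
  have "measure_pmf.prob M A > 0" using assms measure_pmf_posI by fast
  then show ?thesis
    by (simp add: cond_pmf.rep_eq[OF assms] measure_uniform_measure measure_pmf.emeasure_eq_measure)
qed

text \<open>The probability that one latent value fits both \<open>C\<close> and \<open>D\<close> is
  the probability that it fits \<open>C\<close>, times the conditional probability that it then fits
  \<open>D\<close>. Nodes of \<open>C\<close> see no latent but \<open>l0\<close>, so the fit with
  \<open>C\<close> depends only on the value \<open>t\<close> of \<open>C\<close> and its parents.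
  Every node of \<open>D\<close> sees \<open>t\<close> and can look up the entry \<open>t\<close> of
  the table \<open>l2\<close>. The indices \<open>l0\<close> and \<open>l1\<close> are allowed to
  coincide.\<close>

lemma split_latent:
  fixes N :: "'v set" and L :: "'i set"
  assumes fin: "finite L" "finite N" and nin: "l0 \<notin> L" "l1 \<notin> L" "l2 \<notin> L" "l1 \<noteq> l2"
    and CD: "C \<subseteq> N" "D \<subseteq> N" "C \<inter> D = {}" and E: "E \<subseteq> N \<times> N"
    and pa: "\<And>d. d \<in> D \<Longrightarrow> parents E C \<union> C \<subseteq> parents E {d}"
    and sep: "\<And>l. l \<in> L \<Longrightarrow> sc l \<inter> C = {}"
    and pos: "\<And>v. v \<in> N \<Longrightarrow> 0 < c v"
    and sc0: "sc l0 = C \<union> D"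
    and sc': "sc' l1 = C" "sc' l2 = D" "\<And>l. l \<in> L \<Longrightarrow> sc' l = sc l"
  shows "sem_model N E (insert l0 L) sc c \<subseteq> sem_model N E (insert l1 (insert l2 L)) sc' c"
proof
  fix P assume "P \<in> sem_model N E (insert l0 L) sc c"
  then obtain Q :: "'i \<Rightarrow> nat pmf" and f
    where P: "P \<in> prob_simplex N c" and Q: "\<And>l. l \<in> insert l0 L \<Longrightarrow> finite (set_pmf (Q l))"
      and loc: "local_eqs E (insert l0 L) sc f" and bd: "\<And>v x u. v \<in> N \<Longrightarrow> f v x u < c v"
      and eq: "\<And>x. x \<in> outcomes N c \<Longrightarrow>
        pmf P x = measure_pmf.prob (Pi_pmf (insert l0 L) undefined Q) (solutions N f x)"
    unfolding sem_model_def by blast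
  define S where "S = parents E C \<union> C"
  define T where "T = (\<lambda>x. restrict x S) ` outcomes N c"
  have finT: "finite T" using fin by (simp add: T_def outcomes_def finite_PiE)
  have SN: "S \<subseteq> N" using E CD by (auto simp: S_def parents_def)
  define W where "W t = {w. \<forall>v\<in>C. t v = f v t (\<lambda>_. w)}" for t
  \<comment> \<open>\<open>l2\<close> carries, for each value \<open>t\<close> that \<open>C\<close> and its parents can take, a sample of the old latent
    conditioned on being compatible with \<open>t\<close>.\<close>
  define K where "K t = (if set_pmf (Q l0) \<inter> W t = {} then Q l0 else cond_pmf (Q l0) (W t))" for t
  have K_sub: "set_pmf (K t) \<subseteq> set_pmf (Q l0)" for t
    by (auto simp: K_def set_cond_pmf)
  \<comment> \<open>This also holds for the arbitrary entry at a \<open>t\<close> that no latent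
    value fits: both sides are then 0.\<close>
  have K: "measure_pmf.prob (Q l0) (W t) * measure_pmf.prob (K t) B =
    measure_pmf.prob (Q l0) (W t \<inter> B)" for t B
  proof (cases "set_pmf (Q l0) \<inter> W t = {}")
    case True
    then have "measure_pmf.prob (Q l0) (W t) = 0" "measure_pmf.prob (Q l0) (W t \<inter> B) = 0"
      by (auto simp: measure_pmf_zero_iff)
    then show ?thesis by simp
  next
    case False
    then have pz: "measure_pmf.prob (Q l0) (W t) > 0" using measure_pmf_posI by fast
    then show ?thesis using False by (simp add: K_def prob_cond_pmf)
  qed
  \<comment> \<open>All latents must have one type, so an ordinary value is stored as a constant
    function, which \<open>val\<close> evaluates at an arbitrary argument.\<close>
  define Q' :: "'i \<Rightarrow> (('v \<Rightarrow> nat) \<Rightarrow> nat) pmf" where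
    "Q' l = (if l = l2 then Pi_pmf T undefined K
      else map_pmf (\<lambda>w _. w) (Q (if l = l1 then l0 else l)))" for l
  define val where "val u l = u l undefined" for u :: "'i \<Rightarrow> ('v \<Rightarrow> nat) \<Rightarrow> nat" and l
  \<comment> \<open>A node of \<open>C\<close> sees only \<open>l0\<close>, so a constant assignment
    of latents serves it. For a node outside \<open>C \<union> D\<close> the overwritten latent
    \<open>l0\<close> is out of scope, so locality makes the value independent of the
    override.\<close>
  define f' where "f' v x u =
    (if v \<in> C then f v x (\<lambda>_. val u l1)
     else f v x ((val u)(l0 := u l2 (restrict x S))))" for v x u
  show "P \<in> sem_model N E (insert l1 (insert l2 L)) sc' c"
  proof (rule sem_modelI[where Q = Q' and f = f' and d = "\<lambda>_. undefined"])
    show "local_eqs E (insert l1 (insert l2 L)) sc' f'"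
      unfolding local_eqs_def
    proof (intro allI impI)
      fix v and x x' :: "'v \<Rightarrow> nat" and u u' :: "'i \<Rightarrow> ('v \<Rightarrow> nat) \<Rightarrow> nat"
      assume x: "\<forall>w. (w, v) \<in> E \<longrightarrow> x w = x' w"
        and u: "\<forall>l\<in>insert l1 (insert l2 L). v \<in> sc' l \<longrightarrow> u l = u' l"
      show "f' v x u = f' v x' u'"
      proof (cases "v \<in> C")
        case True
        then have "f v x (\<lambda>_. val u l1) = f v x' (\<lambda>_. val u' l1)"
          by (intro local_eqsD[OF loc]) (use x u sc' in \<open>auto simp: val_def\<close>)
        then show ?thesis using True by (simp add: f'_def)
      next
        case False
        have "u l2 (restrict x S) = u' l2 (restrict x' S)" if "v \<in> D"
        proof -
          have "restrict x S = restrict x' S"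
            by (rule restrict_ext) (use pa[OF that] x in \<open>auto simp: S_def parents_def\<close>)
          then show ?thesis using u that sc' by simp
        qed
        then have "f v x ((val u)(l0 := u l2 (restrict x S))) = f v x' ((val u')(l0 := u' l2 (restrict x' S)))"
          by (intro local_eqsD[OF loc]) (use x u sc' sc0 False in \<open>auto simp: val_def\<close>)
        then show ?thesis using False by (simp add: f'_def)
      qed
    qed
    show "finite (set_pmf (Q' l))" if "l \<in> insert l1 (insert l2 L)" for l
    proof (cases "l = l2")
      case True
      have "finite (set_pmf (Pi_pmf T undefined K))"
        by (rule finite_subset[OF set_Pi_pmf_subset'[OF finT]])
          (use finT finite_subset[OF K_sub] Q in auto)
      then show ?thesis using True by (simp add: Q'_def)
    qed (use that Q in \<open>auto simp: Q'_def\<close>)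
    show "f' v x u < c v" if "v \<in> N" for v x u using bd that by (simp add: f'_def)
  next
    fix x assume x: "x \<in> outcomes N c"
    let ?t = "restrict x S"
    have t: "?t \<in> T" using x by (simp add: T_def)
    define R where "R u w \<longleftrightarrow> (\<forall>v\<in>N - C. x v = f v x (u(l0 := w)))" for u and w :: nat
    have W_iff: "w \<in> W ?t \<longleftrightarrow> (\<forall>v\<in>C. x v = f v x (\<lambda>_. w))" for w
    proof -
      have "f v ?t (\<lambda>_. w) = f v x (\<lambda>_. w)" if "v \<in> C" for v
        by (rule local_eqsD[OF loc]) (use that in \<open>auto simp: S_def parents_def\<close>)
      then show ?thesis by (simp add: W_def S_def)
    qed
    have sol: "u(l0 := w) \<in> solutions N f x \<longleftrightarrow> w \<in> W ?t \<and> R u w" for u w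
    proof -
      have "f v x (u(l0 := w)) = f v x (\<lambda>_. w)" if "v \<in> C" for v
        by (rule local_eqsD[OF loc]) (use that sep in auto)
      then show ?thesis using CD unfolding solutions_def W_iff R_def by auto
    qed
    have "measure_pmf.prob (Pi_pmf (insert l0 L) undefined Q) (solutions N f x) =
      measure_pmf.expectation (Pi_pmf L undefined Q)
        (\<lambda>u. measure_pmf.prob (Q l0) (W ?t) * measure_pmf.prob (K ?t) {w. R u w})"
      unfolding prob_Pi_pmf_insert[OF fin(1) nin(1)] sol K
      by (simp add: Int_def)
    also have "\<dots> = measure_pmf.prob (Pi_pmf (insert l1 (insert l2 L)) (\<lambda>_. undefined) Q') (solutions N f' x)"
    proof -
      have sol': "u(l2 := g, l1 := \<lambda>_. w) \<in> solutions N f' x \<longleftrightarrow> w \<in> W ?t \<and> R (val u) (g ?t)" for u g w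
      proof -
        have "f v x ((val (u(l2 := g, l1 := \<lambda>_. w)))(l0 := g ?t)) = f v x ((val u)(l0 := g ?t))" for v
          by (rule local_eqsD[OF loc]) (use nin in \<open>auto simp: val_def\<close>)
        then show ?thesis using CD nin unfolding solutions_def W_iff R_def f'_def
          by (auto simp: val_def)
      qed
      \<comment> \<open>At the outcome \<open>x\<close> only the entry \<open>?t\<close> of the
        table is read, and its marginal law is \<open>K ?t\<close>.\<close>
      have g: "measure_pmf.prob (Pi_pmf T undefined K) {g. R' (g ?t)} = measure_pmf.prob (K ?t) {w. R' w}" for R'
      proof -
        have "K ?t = map_pmf (\<lambda>g. g ?t) (Pi_pmf T undefined K)"
          using Pi_pmf_component[OF finT, of ?t undefined K] t by simp
        then show ?thesis by (simp add: vimage_def)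
      qed
      have L: "Pi_pmf L (\<lambda>_. undefined) Q' = map_pmf (\<lambda>h. (\<lambda>w _. w) \<circ> h) (Pi_pmf L undefined Q)"
      proof -
        have "Pi_pmf L (\<lambda>_. undefined) Q' = Pi_pmf L (\<lambda>_. undefined) (\<lambda>l. map_pmf (\<lambda>w _. w) (Q l))"
          by (rule Pi_pmf_cong) (use nin in \<open>auto simp: Q'_def\<close>)
        then show ?thesis by (subst Pi_pmf_map[OF fin(1), symmetric]) auto
      qed
      have val': "val ((\<lambda>w _. w) \<circ> u) = u" for u by (simp add: val_def fun_eq_iff)
      have ind: "measure_pmf.prob (Q l0) {w. w \<in> W ?t \<and> b} = measure_pmf.prob (Q l0) (W ?t) * of_bool b" for b
        by (cases b) auto
      have "measure_pmf.prob (Pi_pmf (insert l1 (insert l2 L)) (\<lambda>_. undefined) Q') (solutions N f' x) =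
measure_pmf.expectation (Pi_pmf L (\<lambda>_. undefined) Q')
          (\<lambda>u. measure_pmf.expectation (Pi_pmf T undefined K)
            (\<lambda>g. measure_pmf.prob (Q l0) {w. u(l2 := g, l1 := \<lambda>_. w) \<in> solutions N f' x}))"
        using nin fin by (simp add: Pi_pmf_insert_bind bind_assoc_pmf bind_map_pmf prob_bind_pmf)
          (simp add: Q'_def vimage_def)
      also have "\<dots> = measure_pmf.expectation (Pi_pmf L (\<lambda>_. undefined) Q')
          (\<lambda>u. measure_pmf.prob (Q l0) (W ?t) * measure_pmf.prob (K ?t) {w. R (val u) w})"
        unfolding sol' ind by (simp add: expectation_of_bool g)
      also have "\<dots> = measure_pmf.expectation (Pi_pmf L undefined Q)
        (\<lambda>u. measure_pmf.prob (Q l0) (W ?t) * measure_pmf.prob (K ?t) {w. R u w})"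
        unfolding L by (simp add: val')
      finally show ?thesis by simp
    qed
    finally show "pmf P x = measure_pmf.prob (Pi_pmf (insert l1 (insert l2 L)) (\<lambda>_. undefined) Q') (solutions N f' x)"
      using eq[OF x] by simp
  qed (use fin P pos in auto)
qed

lemma weak_facet_adding_sound:
  assumes G: "is_mdag G" and G': "is_mdag G'" and w: "weak_facet_adding G G'"
  shows "obs_dominates G G'"
proof -
  obtain C D where C: "C \<in> faces G" and D: "D \<in> faces G" and CD: "C \<inter> D = {}"
    and pa: "\<And>d. d \<in> D \<Longrightarrow> parents (edges G) C \<union> C \<subseteq> parents (edges G) {d}"
    and iso: "\<And>A. A \<in> faces G \<Longrightarrow> A \<inter> C \<noteq> {} \<Longrightarrow> A \<subseteq> C"
    and eq: "G' = G\<lparr>faces := faces G \<union> Pow (C \<union> D)\<rparr>"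
    using w unfolding weak_facet_adding_def by blast
  have sub: "C \<subseteq> nodes G" "D \<subseteq> nodes G" using C D G by (auto simp: is_mdag_def)
  have finN: "finite (nodes G)" and E: "edges G \<subseteq> nodes G \<times> nodes G" using G by (auto simp: is_mdag_def)
  \<comment> \<open>In \<open>G'\<close> every face that meets \<open>C\<close> is contained in
    \<open>C \<union> D\<close>, so one latent with that scope absorbs all of them; the faces in
    \<open>F\<close> keep their own latents.\<close>
  define F where "F = {A \<in> faces G. A \<inter> C = {}}"
  let ?L = "Inl ` F :: ('a set + bool) set"
  define sc where "sc l = (case l of Inl A \<Rightarrow> A | Inr _ \<Rightarrow> C \<union> D)" for l :: "'a set + bool"
  define sc' where "sc' l = (case l of Inl A \<Rightarrow> A | Inr b \<Rightarrow> if b then D else C)" for l :: "'a set + bool"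
  have finF: "finite F" using finite_faces[OF G] by (simp add: F_def)
  have "mdag_model G' c \<subseteq> mdag_model G c" if pos: "\<forall>v\<in>nodes G. 0 < c v" for c
  proof -
    have "mdag_model G' c = sem_model (nodes G) (edges G) (faces G \<union> Pow (C \<union> D)) id c"
      using mdag_model_eq_sem_model(2)[OF G', of c] pos by (simp add: eq)
    also have "\<dots> \<subseteq> sem_model (nodes G) (edges G) (insert (Inr False) ?L) sc c"
      by (rule sem_model_mono[where \<phi> = "\<lambda>A. if A \<in> F then Inl A else Inr False"])
        (use finF finite_faces[OF G'] pos iso in \<open>auto simp: eq sc_def F_def\<close>)
    \<comment> \<open>\<open>Inr False\<close> stands for both \<open>l0\<close> and
      \<open>l1\<close>: its scope shrinks from \<open>C \<union> D\<close> to \<open>C\<close>, and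
      \<open>Inr True\<close> takes over \<open>D\<close>.\<close>
    also have "\<dots> \<subseteq> sem_model (nodes G) (edges G) (insert (Inr False) (insert (Inr True) ?L)) sc' c"
      by (rule split_latent[where C = C and D = D])
        (use finF finN sub CD E pa pos in \<open>auto simp: sc_def sc'_def F_def\<close>)
    also have "\<dots> \<subseteq> sem_model (nodes G) (edges G) (faces G) id c"
      by (rule sem_model_mono[where \<phi> = sc']) (use finF finite_faces[OF G] pos C D in \<open>auto simp: sc'_def F_def\<close>)
    also have "\<dots> = mdag_model G c" using mdag_model_eq_sem_model(2)[OF G, of c] pos by simp
    finally show ?thesis .
  qed
  then show ?thesis by (simp add: obs_dominates_def eq)
qed

lemma dominance_chain_sound:
  assumes "(dominance_step N)\<^sup>*\<^sup>* G G'"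
  shows "obs_dominates G G'"
  using assms
proof (induction rule: rtranclp_induct)
  case base
  then show ?case by (simp add: obs_dominates_def)
next
  case (step G' G'')
  have "obs_dominates G' G''"
    using step(2) structural_dominance_sound hlp_edge_adding_sound weak_facet_adding_sound
    unfolding dominance_step_def by blast
  then show ?case using step(3) unfolding obs_dominates_def by (metis subset_trans)
qed

section \<open>Algebraic models\<close>

definition monomial_eval :: "('x \<Rightarrow>\<^sub>0 nat) \<Rightarrow> ('x \<Rightarrow> real) \<Rightarrow> real" where
  "monomial_eval m z = (\<Prod>i\<in>Poly_Mapping.keys m. z i ^ Poly_Mapping.lookup m i)"

text \<open>Reasoning with the functions that polynomials define avoids writing down explicit
  polynomials for the Markov equations.\<close>

definition poly_fun :: "'x set \<Rightarrow> (('x \<Rightarrow> real) \<Rightarrow> real) \<Rightarrow> bool" where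
  "poly_fun I f \<longleftrightarrow> (\<exists>p :: 'x real_mpoly.
     (\<forall>m\<in>Poly_Mapping.keys p. Poly_Mapping.keys m \<subseteq> I) \<and> (\<forall>z. mpoly_eval p z = f z))"

lemma mpoly_eval_superset:
  assumes "finite S" "Poly_Mapping.keys p \<subseteq> S"
  shows "mpoly_eval p z = (\<Sum>m\<in>S. Poly_Mapping.lookup p m * monomial_eval m z)"
  unfolding mpoly_eval_def monomial_eval_def[symmetric]
  by (rule sum.mono_neutral_left) (use assms in \<open>auto simp: in_keys_iff\<close>)

lemma monomial_eval_superset:
  assumes "finite S" "Poly_Mapping.keys m \<subseteq> S"
  shows "monomial_eval m z = (\<Prod>i\<in>S. z i ^ Poly_Mapping.lookup m i)"
  unfolding monomial_eval_def
  by (rule prod.mono_neutral_left) (use assms in \<open>auto simp: in_keys_iff\<close>)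

lemma monomial_eval_add: "monomial_eval (m + n) z = monomial_eval m z * monomial_eval n z"
proof -
  let ?S = "Poly_Mapping.keys m \<union> Poly_Mapping.keys n"
  have "monomial_eval m z = (\<Prod>i\<in>?S. z i ^ Poly_Mapping.lookup m i)"
    "monomial_eval n z = (\<Prod>i\<in>?S. z i ^ Poly_Mapping.lookup n i)"
    "monomial_eval (m + n) z = (\<Prod>i\<in>?S. z i ^ Poly_Mapping.lookup (m + n) i)"
    using Poly_Mapping.keys_add[of m n] by (auto intro!: monomial_eval_superset)
  then show ?thesis by (simp add: lookup_add power_add prod.distrib)
qed

lemma poly_fun_monomial:
  assumes "Poly_Mapping.keys m \<subseteq> I" shows "poly_fun I (\<lambda>z. r * monomial_eval m z)"
  unfolding poly_fun_def
proof (intro exI[of _ "Poly_Mapping.single m r"] conjI allI)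
  show "mpoly_eval (Poly_Mapping.single m r) z = r * monomial_eval m z" for z
    by (subst mpoly_eval_superset[of "{m}"]) auto
qed (use assms in auto)

lemma poly_fun_const: "poly_fun I (\<lambda>_. r)"
  using poly_fun_monomial[of 0 I r] by (simp add: monomial_eval_def)

lemma poly_fun_var:
  assumes "i \<in> I" shows "poly_fun I (\<lambda>z. z i)"
  using poly_fun_monomial[of "Poly_Mapping.single i 1" I 1] assms by (simp add: monomial_eval_def)

lemma poly_fun_add:
  assumes "poly_fun I f" "poly_fun I g" shows "poly_fun I (\<lambda>z. f z + g z)"
proof -
  obtain p q :: "'a real_mpoly" where p: "\<forall>m\<in>Poly_Mapping.keys p. Poly_Mapping.keys m \<subseteq> I" "\<forall>z. mpoly_eval p z = f z"
    and q: "\<forall>m\<in>Poly_Mapping.keys q. Poly_Mapping.keys m \<subseteq> I" "\<forall>z. mpoly_eval q z = g z"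
    using assms unfolding poly_fun_def by blast
  let ?S = "Poly_Mapping.keys p \<union> Poly_Mapping.keys q"
  have "mpoly_eval (p + q) z = f z + g z" for z
  proof -
    have "mpoly_eval p z = (\<Sum>m\<in>?S. Poly_Mapping.lookup p m * monomial_eval m z)"
      "mpoly_eval q z = (\<Sum>m\<in>?S. Poly_Mapping.lookup q m * monomial_eval m z)"
      "mpoly_eval (p + q) z = (\<Sum>m\<in>?S. Poly_Mapping.lookup (p + q) m * monomial_eval m z)"
      using Poly_Mapping.keys_add[of p q] by (auto intro!: mpoly_eval_superset)
    then show ?thesis using p q by (simp add: lookup_add sum.distrib distrib_right)
  qed
  moreover have "\<forall>m\<in>Poly_Mapping.keys (p + q). Poly_Mapping.keys m \<subseteq> I"
    using p(1) q(1) Poly_Mapping.keys_add[of p q] by blast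
  ultimately show ?thesis unfolding poly_fun_def by blast
qed

lemma poly_fun_sum:
  assumes "finite A" "\<And>a. a \<in> A \<Longrightarrow> poly_fun I (f a)"
  shows "poly_fun I (\<lambda>z. \<Sum>a\<in>A. f a z)"
  using assms
proof (induction A rule: finite_induct)
  case (insert a A)
  then have "poly_fun I (\<lambda>z. f a z + (\<Sum>a\<in>A. f a z))" by (intro poly_fun_add) auto
  then show ?case using insert by simp
qed (simp add: poly_fun_const)

lemma poly_fun_mult:
  assumes "poly_fun I f" "poly_fun I g" shows "poly_fun I (\<lambda>z. f z * g z)"
proof -
  obtain p q :: "'a real_mpoly" where p: "\<forall>m\<in>Poly_Mapping.keys p. Poly_Mapping.keys m \<subseteq> I" "\<forall>z. mpoly_eval p z = f z"
    and q: "\<forall>m\<in>Poly_Mapping.keys q. Poly_Mapping.keys m \<subseteq> I" "\<forall>z. mpoly_eval q z = g z"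
    using assms unfolding poly_fun_def by blast
  have "(\<lambda>z. f z * g z) = (\<lambda>z. \<Sum>m\<in>Poly_Mapping.keys p. \<Sum>n\<in>Poly_Mapping.keys q.
      (Poly_Mapping.lookup p m * Poly_Mapping.lookup q n) * monomial_eval (m + n) z)"
  proof
    fix z
    have "f z * g z = (\<Sum>m\<in>Poly_Mapping.keys p. Poly_Mapping.lookup p m * monomial_eval m z) *
        (\<Sum>n\<in>Poly_Mapping.keys q. Poly_Mapping.lookup q n * monomial_eval n z)"
      using p(2) q(2) mpoly_eval_superset[OF finite_keys order_refl] by metis
    then show "f z * g z = (\<Sum>m\<in>Poly_Mapping.keys p. \<Sum>n\<in>Poly_Mapping.keys q.
        (Poly_Mapping.lookup p m * Poly_Mapping.lookup q n) * monomial_eval (m + n) z)"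
      by (simp add: sum_product monomial_eval_add mult_ac)
  qed
  moreover have "Poly_Mapping.keys (m + n) \<subseteq> I" if "m \<in> Poly_Mapping.keys p" "n \<in> Poly_Mapping.keys q" for m n
    using that p(1) q(1) Poly_Mapping.keys_add[of m n] by blast
  ultimately show ?thesis by (simp add: poly_fun_sum poly_fun_monomial)
qed

lemma poly_fun_diff:
  assumes "poly_fun I f" "poly_fun I g" shows "poly_fun I (\<lambda>z. f z - g z)"
  using poly_fun_add[OF assms(1) poly_fun_mult[OF poly_fun_const[of I "-1"] assms(2)]] by simp

lemma real_algebraic_set_zeros:
  assumes "\<And>t. t \<in> T \<Longrightarrow> poly_fun I (f t)"
  shows "real_algebraic_set I {z. \<forall>t\<in>T. f t z = 0}"
proof -
  obtain p :: "'a \<Rightarrow> 'b real_mpoly" where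
    p: "\<And>t. t \<in> T \<Longrightarrow> (\<forall>m\<in>Poly_Mapping.keys (p t). Poly_Mapping.keys m \<subseteq> I) \<and> (\<forall>z. mpoly_eval (p t) z = f t z)"
    using assms unfolding poly_fun_def by metis
  show ?thesis unfolding real_algebraic_set_def
    by (intro exI[of _ "p ` T"]) (use p in auto)
qed

lemma mpoly_eval_on_line: "\<exists>q. \<forall>t. mpoly_eval p (\<lambda>i. \<alpha> i + t * \<beta> i) = poly q t"
  by (rule exI[of _ "\<Sum>m\<in>Poly_Mapping.keys p. [:Poly_Mapping.lookup p m:] *
      (\<Prod>i\<in>Poly_Mapping.keys m. [:\<alpha> i, \<beta> i:] ^ Poly_Mapping.lookup m i)"])
    (simp add: mpoly_eval_def poly_sum poly_prod)

section \<open>Lines in the probability simplex\<close>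

definition mixture :: "real \<Rightarrow> 'a pmf \<Rightarrow> 'a pmf \<Rightarrow> 'a pmf" where
  "mixture t P R = bind_pmf (bernoulli_pmf t) (\<lambda>b. if b then R else P)"

lemma pmf_bind_bernoulli:
  assumes "0 \<le> t" "t \<le> 1"
  shows "pmf (bind_pmf (bernoulli_pmf t) h) x = t * pmf (h True) x + (1 - t) * pmf (h False) x"
  using assms by (simp add: pmf_bind)

lemma pmf_mixture:
  assumes "0 \<le> t" "t \<le> 1"
  shows "pmf (mixture t P R) x = pmf P x + t * (pmf R x - pmf P x)"
  using assms by (simp add: mixture_def pmf_bind_bernoulli algebra_simps)

lemma algebraic_line_closed:
  assumes alg: "algebraic_mdag G" and pos: "\<And>v. v \<in> nodes G \<Longrightarrow> 0 < c v" and s: "0 < s" "s \<le> 1"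
    and mix: "\<And>t. 0 \<le> t \<Longrightarrow> t \<le> s \<Longrightarrow> mixture t P R \<in> mdag_model G c"
    and R: "R \<in> prob_simplex (nodes G) c"
  shows "R \<in> mdag_model G c"
proof -
  obtain F :: "('a \<Rightarrow> nat) real_mpoly set" where
    F: "mdag_model G c = {P \<in> prob_simplex (nodes G) c. \<forall>p\<in>F. mpoly_eval p (pmf P) = 0}"
  proof -
    have "\<exists>Z. real_algebraic_set (outcomes (nodes G) c) Z \<and>
        mdag_model G c = {P \<in> prob_simplex (nodes G) c. pmf P \<in> Z}"
      using alg pos unfolding algebraic_mdag_def by simp
    then obtain Z where Z: "real_algebraic_set (outcomes (nodes G) c) Z"
      "mdag_model G c = {P \<in> prob_simplex (nodes G) c. pmf P \<in> Z}"
      by (elim exE conjE)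
    from Z(1) obtain F where "Z = {z. \<forall>p\<in>F. mpoly_eval p z = 0}"
      unfolding real_algebraic_set_def by (elim exE conjE)
    then show thesis by (intro that[of F]) (simp add: Z(2))
  qed
  have "mpoly_eval p (pmf R) = 0" if "p \<in> F" for p
  proof -
    obtain q where q: "\<And>t. mpoly_eval p (\<lambda>x. pmf P x + t * (pmf R x - pmf P x)) = poly q t"
      using mpoly_eval_on_line[of p "pmf P" "\<lambda>x. pmf R x - pmf P x"] by blast
    have "poly q t = 0" if "0 \<le> t" "t \<le> s" for t
    proof -
      have "mpoly_eval p (pmf (mixture t P R)) = 0"
        using mix[OF that] \<open>p \<in> F\<close> unfolding F mem_Collect_eq by (elim conjE bspec)
      moreover have "pmf (mixture t P R) = (\<lambda>x. pmf P x + t * (pmf R x - pmf P x))"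
        by (rule ext, rule pmf_mixture) (use that s in auto)
      ultimately show ?thesis using q[of t] by simp
    qed
    then have "{0..s} \<subseteq> {t. poly q t = 0}" by auto
    then have "infinite {t. poly q t = 0}" using infinite_Icc[OF s(1)] infinite_super by metis
    then have "q = 0" using poly_roots_finite by metis
    then have "mpoly_eval p (\<lambda>x. pmf P x + 1 * (pmf R x - pmf P x)) = 0" using q[of 1] by (simp only: poly_0)
    then show ?thesis by simp
  qed
  then show ?thesis unfolding F mem_Collect_eq using R by (intro conjI ballI)
qed

section \<open>Bayesian network factorization and the ordered Markov property\<close>

lemma finite_outcomes: "finite N \<Longrightarrow> finite (outcomes N c)"
  by (simp add: outcomes_def finite_PiE)

lemma outcomes_upd: "x \<in> outcomes N c \<Longrightarrow> v \<in> N \<Longrightarrow> t < c v \<Longrightarrow> x(v := t) \<in> outcomes N c"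
  by (auto simp: outcomes_def PiE_def extensional_def)

definition kernel_prob :: "'v rel \<Rightarrow> ('v \<Rightarrow> ('v \<Rightarrow> nat) \<Rightarrow> nat pmf) \<Rightarrow> ('v \<Rightarrow> nat) \<Rightarrow> 'v \<Rightarrow> real" where
  "kernel_prob E K x v = pmf (K v (restrict x (parents E {v}))) (x v)"

text \<open>With private latents only, the model is the set of Bayesian network factorizations. To
  realise given kernels, the latent of \<open>v\<close> is a whole response table: an independent
  sample from \<open>K v t\<close> for every value \<open>t\<close> of the parents, from which the
  mechanism picks one entry.\<close>

lemma sem_model_singletons:
  fixes N :: "'v set"
  assumes fin: "finite N" and pos: "\<And>v. v \<in> N \<Longrightarrow> 0 < c v"
  shows "sem_model N E N (\<lambda>v. {v}) c = {P \<in> prob_simplex N c. \<exists>K.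
    (\<forall>v\<in>N. \<forall>t. set_pmf (K v t) \<subseteq> {..<c v}) \<and>
    (\<forall>x\<in>outcomes N c. pmf P x = (\<Prod>v\<in>N. kernel_prob E K x v))}" (is "_ = ?R")
proof (intro equalityI subsetI)
  fix P assume "P \<in> sem_model N E N (\<lambda>v. {v}) c"
  then obtain Q :: "'v \<Rightarrow> nat pmf" and f
    where P: "P \<in> prob_simplex N c" and Q: "\<And>l. l \<in> N \<Longrightarrow> finite (set_pmf (Q l))"
      and loc: "local_eqs E N (\<lambda>v. {v}) f" and bd: "\<And>v x u. v \<in> N \<Longrightarrow> f v x u < c v"
      and eq: "\<And>x. x \<in> outcomes N c \<Longrightarrow>
        pmf P x = measure_pmf.prob (Pi_pmf N undefined Q) (solutions N f x)"
    unfolding sem_model_def by blast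
  define K where "K v t = map_pmf (\<lambda>w. f v t (\<lambda>_. w)) (Q v)" for v t
  have "pmf P x = (\<Prod>v\<in>N. kernel_prob E K x v)" if x: "x \<in> outcomes N c" for x
  proof -
    have "f v x u = f v (restrict x (parents E {v})) (\<lambda>_. u v)" if "v \<in> N" for v u
      by (rule local_eqsD[OF loc]) (auto simp: parents_def)
    then have "solutions N f x = Pi N (\<lambda>v. {w. x v = f v (restrict x (parents E {v})) (\<lambda>_. w)})"
      by (auto simp: solutions_def Pi_def)
    then have "pmf P x = (\<Prod>v\<in>N. measure_pmf.prob (Q v) {w. x v = f v (restrict x (parents E {v})) (\<lambda>_. w)})"
      using eq[OF x] by (simp add: measure_Pi_pmf_Pi[OF fin])
    also have "\<dots> = (\<Prod>v\<in>N. kernel_prob E K x v)"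
      by (intro prod.cong refl) (simp add: kernel_prob_def K_def pmf_map vimage_def eq_commute)
    finally show ?thesis .
  qed
  moreover have "\<forall>v\<in>N. \<forall>t. set_pmf (K v t) \<subseteq> {..<c v}" using bd by (auto simp: K_def)
  ultimately show "P \<in> ?R" using P by blast
next
  fix P assume "P \<in> ?R"
  then obtain K where P: "P \<in> prob_simplex N c"
    and K: "\<And>v t. v \<in> N \<Longrightarrow> set_pmf (K v t) \<subseteq> {..<c v}"
    and eq: "\<And>x. x \<in> outcomes N c \<Longrightarrow> pmf P x = (\<Prod>v\<in>N. kernel_prob E K x v)"
    by blast
  define T where "T v = (\<lambda>x. restrict x (parents E {v})) ` outcomes N c" for v
  have finT: "finite (T v)" for v using finite_outcomes[OF fin] by (simp add: T_def)
  define Q where "Q v = Pi_pmf (T v) undefined (K v)" for v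
  define f where "f v x u = (if v \<in> N then u v (restrict x (parents E {v})) else 0)"
    for v and x :: "'v \<Rightarrow> nat" and u :: "'v \<Rightarrow> ('v \<Rightarrow> nat) \<Rightarrow> nat"
  have tab: "w t < c v" if "v \<in> N" "w \<in> set_pmf (Q v)" "t \<in> T v" for v w t
    using that K[of v t] by (auto simp: Q_def set_Pi_pmf[OF finT] PiE_dflt_def)
  show "P \<in> sem_model N E N (\<lambda>v. {v}) c"
  proof (rule sem_modelI[where Q = Q and d = "\<lambda>_. undefined" and f = f])
    show "local_eqs E N (\<lambda>v. {v}) f"
      unfolding local_eqs_def
    proof (intro allI impI)
      fix v and x x' :: "'v \<Rightarrow> nat" and u u' :: "'v \<Rightarrow> ('v \<Rightarrow> nat) \<Rightarrow> nat"
      assume "\<forall>w. (w, v) \<in> E \<longrightarrow> x w = x' w" and u: "\<forall>l\<in>N. v \<in> {l} \<longrightarrow> u l = u' l"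
      then have "restrict x (parents E {v}) = restrict x' (parents E {v})"
        by (intro restrict_ext) (simp add: parents_def)
      then show "f v x u = f v x' u'" using u by (simp add: f_def)
    qed
    show "finite (set_pmf (Q v))" if "v \<in> N" for v
      unfolding Q_def
      by (rule finite_subset[OF set_Pi_pmf_subset'[OF finT]])
        (use finT finite_subset[OF K[OF that]] in auto)
    show "f v x u < c v"
      if "v \<in> N" "x \<in> outcomes N c" "\<And>l. l \<in> N \<Longrightarrow> u l \<in> set_pmf (Q l)" for v x u
      using tab[OF that(1) that(3)[OF that(1)]] that by (simp add: f_def T_def)
    fix x assume x: "x \<in> outcomes N c"
    have "solutions N f x = Pi N (\<lambda>v. {w. x v = w (restrict x (parents E {v}))})"
      by (auto simp: solutions_def Pi_def f_def)
    then have "measure_pmf.prob (Pi_pmf N (\<lambda>_. undefined) Q) (solutions N f x) =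
        (\<Prod>v\<in>N. measure_pmf.prob (Q v) {w. x v = w (restrict x (parents E {v}))})"
      by (simp add: measure_Pi_pmf_Pi[OF fin])
    also have "\<dots> = (\<Prod>v\<in>N. kernel_prob E K x v)"
    proof (intro prod.cong refl)
      fix v assume "v \<in> N"
      have "map_pmf (\<lambda>w. w (restrict x (parents E {v}))) (Q v) = K v (restrict x (parents E {v}))"
        unfolding Q_def Pi_pmf_component[OF finT] using x by (simp add: T_def)
      then have "kernel_prob E K x v = pmf (map_pmf (\<lambda>w. w (restrict x (parents E {v}))) (Q v)) (x v)"
        by (simp add: kernel_prob_def)
      then show "measure_pmf.prob (Q v) {w. x v = w (restrict x (parents E {v}))} = kernel_prob E K x v"
        by (simp add: pmf_map vimage_def eq_commute)
    qed
    finally show "pmf P x = measure_pmf.prob (Pi_pmf N (\<lambda>_. undefined) Q) (solutions N f x)"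
      using eq[OF x] by simp
  qed (use fin P pos in auto)
qed

definition marg :: "('v \<Rightarrow> nat) pmf \<Rightarrow> 'v set \<Rightarrow> ('v \<Rightarrow> nat) \<Rightarrow> real" where
  "marg P S x = measure_pmf.prob P {y. \<forall>i\<in>S. y i = x i}"

lemma marg_mono: "S \<subseteq> S' \<Longrightarrow> marg P S' x \<le> marg P S x"
  unfolding marg_def by (rule measure_pmf.finite_measure_mono) auto

lemma marg_empty [simp]: "marg P {} x = 1"
  by (simp add: marg_def)

lemma marg_full:
  assumes "P \<in> prob_simplex N c" "x \<in> outcomes N c"
  shows "marg P N x = pmf P x"
proof -
  have "marg P N x = measure_pmf.prob P {x}"
    unfolding marg_def
  proof (rule prob_cong_set_pmf)
    fix y assume "y \<in> set_pmf P"
    then have "y \<in> outcomes N c" using assms by (auto simp: prob_simplex_def)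
    then show "y \<in> {y. \<forall>i\<in>N. y i = x i} \<longleftrightarrow> y \<in> {x}"
      using assms(2) unfolding outcomes_def by (auto intro: PiE_ext)
  qed
  then show ?thesis by (simp add: measure_pmf_single)
qed

lemma marg_eq_sum:
  assumes "finite N" "P \<in> prob_simplex N c"
  shows "marg P S x = (\<Sum>y\<in>{y \<in> outcomes N c. \<forall>i\<in>S. y i = x i}. pmf P y)"
proof -
  have "marg P S x = measure_pmf.prob P {y \<in> outcomes N c. \<forall>i\<in>S. y i = x i}"
    unfolding marg_def by (rule prob_cong_set_pmf) (use assms in \<open>auto simp: prob_simplex_def\<close>)
  then show ?thesis using finite_outcomes[OF assms(1)] by (simp add: measure_measure_pmf_finite)
qed

lemma marg_split:
  assumes P: "P \<in> prob_simplex N c" and v: "v \<in> N" "v \<notin> S"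
  shows "marg P S x = (\<Sum>t<c v. marg P (insert v S) (x(v := t)))"
proof -
  have "marg P S x = measure_pmf.prob P (\<Union>t\<in>{..<c v}. {y. \<forall>i\<in>insert v S. y i = (x(v := t)) i})"
    unfolding marg_def
    by (rule prob_cong_set_pmf) (use P v in \<open>fastforce simp: prob_simplex_def outcomes_def\<close>)
  also have "\<dots> = (\<Sum>t<c v. marg P (insert v S) (x(v := t)))"
    unfolding marg_def
    by (rule measure_pmf.finite_measure_finite_Union) (auto simp: disjoint_family_on_def)
  finally show ?thesis .
qed

lemma kernel_prob_cong:
  assumes "x v = x' v" "\<And>w. (w, v) \<in> E \<Longrightarrow> x w = x' w"
  shows "kernel_prob E K x v = kernel_prob E K x' v"
proof -
  have "restrict x (parents E {v}) = restrict x' (parents E {v})"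
    by (rule restrict_ext) (use assms in \<open>auto simp: parents_def\<close>)
  then show ?thesis using assms by (simp add: kernel_prob_def)
qed

lemma kernel_prob_upd_parents:
  assumes "u \<noteq> v" "u \<notin> parents E {v}"
  shows "kernel_prob E K (x(u := t)) v = kernel_prob E K x v"
  by (rule kernel_prob_cong) (use assms in \<open>auto simp: parents_def\<close>)

lemma sum_kernel_prob:
  assumes "v \<notin> parents E {v}" "\<And>t. set_pmf (K v t) \<subseteq> {..<n}"
  shows "(\<Sum>t<n. kernel_prob E K (x(v := t)) v) = 1"
proof -
  have "restrict (x(v := t)) (parents E {v}) = restrict x (parents E {v})" for t
    by (rule restrict_ext) (use assms in auto)
  then have "(\<Sum>t<n. kernel_prob E K (x(v := t)) v) = (\<Sum>t<n. pmf (K v (restrict x (parents E {v}))) t)"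
    by (simp add: kernel_prob_def)
  also have "\<dots> = 1" using assms by (intro sum_pmf_eq_1) auto
  finally show ?thesis .
qed

definition topological_order :: "'v rel \<Rightarrow> 'v list \<Rightarrow> bool" where
  "topological_order E vs \<longleftrightarrow> distinct vs \<and>
     (\<forall>k<length vs. parents E {vs ! k} \<subseteq> set (take k vs))"

text \<open>Independence of a node from its predecessors given its parents, with denominators
  cleared. The condition is thereby polynomial and also meaningful where the value of the parents
  has probability 0.\<close>

definition ordered_markov :: "'v rel \<Rightarrow> 'v list \<Rightarrow> ('v \<Rightarrow> nat) \<Rightarrow> ('v \<Rightarrow> nat) pmf \<Rightarrow> bool" where
  "ordered_markov E vs c P \<longleftrightarrow> (\<forall>x\<in>outcomes (set vs) c. \<forall>k<length vs.
     marg P (set (take (Suc k) vs)) x * marg P (parents E {vs ! k}) x =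
     marg P (set (take k vs)) x * marg P (insert (vs ! k) (parents E {vs ! k})) x)"

lemma set_take_Suc: "k < length vs \<Longrightarrow> set (take (Suc k) vs) = insert (vs ! k) (set (take k vs))"
  by (simp add: take_Suc_conv_app_nth)

lemma nth_notin_take: "distinct vs \<Longrightarrow> k < length vs \<Longrightarrow> vs ! k \<notin> set (take k vs)"
  using distinct_take[of vs "Suc k"] by (simp add: take_Suc_conv_app_nth)

text \<open>Downward induction from the full list: the last node of a prefix is a parent of none of
  the earlier ones, so summing it out removes just its own kernel, which sums to 1.\<close>

lemma marg_prefix_eq_prod:
  assumes P: "P \<in> prob_simplex (set vs) c" and top: "topological_order E vs"
    and K: "\<And>v t. v \<in> set vs \<Longrightarrow> set_pmf (K v t) \<subseteq> {..<c v}"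
    and eq: "\<And>x. x \<in> outcomes (set vs) c \<Longrightarrow> pmf P x = (\<Prod>v\<in>set vs. kernel_prob E K x v)"
    and k: "k \<le> length vs" and x: "x \<in> outcomes (set vs) c"
  shows "marg P (set (take k vs)) x = (\<Prod>v\<in>set (take k vs). kernel_prob E K x v)"
  using k x
proof (induction k arbitrary: x rule: inc_induct)
  case base
  then show ?case using marg_full[OF P] eq by simp
next
  case (step k)
  let ?S = "set (take k vs)" and ?v = "vs ! k"
  have dist: "distinct vs" using top by (simp add: topological_order_def)
  have v: "?v \<in> set vs" "?v \<notin> ?S" using nth_notin_take[OF dist] step(2) by auto
  have pa: "parents E {?v} \<subseteq> ?S" using top step(2) by (simp add: topological_order_def)
  have old: "kernel_prob E K (x(?v := t)) u = kernel_prob E K x u" if u: "u \<in> ?S" for u t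
  proof (rule kernel_prob_upd_parents)
    show "?v \<noteq> u" using v u by auto
    obtain j where j: "j < k" "u = vs ! j" using u step(2) by (auto simp: in_set_conv_nth)
    then have "parents E {u} \<subseteq> set (take j vs)" using top step(2) by (simp add: topological_order_def)
    also have "\<dots> \<subseteq> ?S" using j by (simp add: set_take_subset_set_take)
    finally show "?v \<notin> parents E {u}" using v by auto
  qed
  have "marg P ?S x = (\<Sum>t<c ?v. marg P (set (take (Suc k) vs)) (x(?v := t)))"
    using marg_split[OF P v] step(2) by (simp add: set_take_Suc)
  also have "\<dots> = (\<Sum>t<c ?v. \<Prod>u\<in>set (take (Suc k) vs). kernel_prob E K (x(?v := t)) u)"
    by (intro sum.cong refl step.IH outcomes_upd) (use step.prems v in auto)
  also have "\<dots> = (\<Sum>t<c ?v. kernel_prob E K (x(?v := t)) ?v * (\<Prod>u\<in>?S. kernel_prob E K x u))"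
    using v step(2) old by (simp add: set_take_Suc)
  also have "\<dots> = (\<Prod>u\<in>?S. kernel_prob E K x u)"
    using sum_kernel_prob[of ?v E K "c ?v" x] v pa K by (auto simp: sum_distrib_right[symmetric])
  finally show ?case .
qed

text \<open>For \<open>S\<close> equal to the whole prefix this is the product formula. The nodes
  missing from a smaller \<open>S\<close> are summed out one at a time; none of them is a parent of
  \<open>vs ! k\<close>, so the kernel factors out of each sum.\<close>

lemma marg_insert_eq_kernel:
  assumes P: "P \<in> prob_simplex (set vs) c" and top: "topological_order E vs"
    and K: "\<And>v t. v \<in> set vs \<Longrightarrow> set_pmf (K v t) \<subseteq> {..<c v}"
    and eq: "\<And>x. x \<in> outcomes (set vs) c \<Longrightarrow> pmf P x = (\<Prod>v\<in>set vs. kernel_prob E K x v)"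
    and k: "k < length vs"
    and S: "parents E {vs ! k} \<subseteq> S" "S \<subseteq> set (take k vs)" and x: "x \<in> outcomes (set vs) c"
  shows "marg P (insert (vs ! k) S) x = marg P S x * kernel_prob E K x (vs ! k)"
  using S x
proof (induction "card (set (take k vs) - S)" arbitrary: S x rule: less_induct)
  case less
  let ?v = "vs ! k"
  have dist: "distinct vs" using top by (simp add: topological_order_def)
  have v: "?v \<in> set vs" "?v \<notin> set (take k vs)" using nth_notin_take[OF dist] k by auto
  show ?case
  proof (cases "S = set (take k vs)")
    case True
    then show ?thesis
      using marg_prefix_eq_prod[OF P top K eq, of k x] marg_prefix_eq_prod[OF P top K eq, of "Suc k" x]
        k v less.prems by (simp add: set_take_Suc)
  next
    case False
    then obtain u where u: "u \<in> set (take k vs)" "u \<notin> S" using less.prems by blast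
    have u': "u \<in> set vs" using u(1) by (rule in_set_takeD)
    have uv: "u \<noteq> ?v" "u \<notin> parents E {?v}" using u v less.prems by auto
    have smaller: "card (set (take k vs) - insert u S) < card (set (take k vs) - S)"
      by (rule psubset_card_mono) (use u in auto)
    have "marg P (insert ?v S) x = (\<Sum>t<c u. marg P (insert ?v (insert u S)) (x(u := t)))"
      using marg_split[OF P u', of "insert ?v S" x] u uv by (simp add: insert_commute)
    also have "\<dots> = (\<Sum>t<c u. marg P (insert u S) (x(u := t)) * kernel_prob E K (x(u := t)) ?v)"
      by (intro sum.cong refl less.hyps smaller outcomes_upd) (use less.prems u u' in auto)
    also have "\<dots> = (\<Sum>t<c u. marg P (insert u S) (x(u := t))) * kernel_prob E K x ?v"
      by (simp add: kernel_prob_upd_parents[OF uv] sum_distrib_right)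
    also have "\<dots> = marg P S x * kernel_prob E K x ?v"
      using marg_split[OF P u' u(2)] by simp
    finally show ?thesis .
  qed
qed

lemma factorizes_iff_ordered_markov:
  fixes vs :: "'v list"
  assumes P: "P \<in> prob_simplex (set vs) c" and top: "topological_order E vs"
    and pos: "\<And>v. v \<in> set vs \<Longrightarrow> 0 < c v"
  shows "(\<exists>K. (\<forall>v\<in>set vs. \<forall>t. set_pmf (K v t) \<subseteq> {..<c v}) \<and>
    (\<forall>x\<in>outcomes (set vs) c. pmf P x = (\<Prod>v\<in>set vs. kernel_prob E K x v))) \<longleftrightarrow>
    ordered_markov E vs c P"
proof
  assume "\<exists>K. (\<forall>v\<in>set vs. \<forall>t. set_pmf (K v t) \<subseteq> {..<c v}) \<and>
    (\<forall>x\<in>outcomes (set vs) c. pmf P x = (\<Prod>v\<in>set vs. kernel_prob E K x v))"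
  then obtain K where K: "\<And>v t. v \<in> set vs \<Longrightarrow> set_pmf (K v t) \<subseteq> {..<c v}"
    and eq: "\<And>x. x \<in> outcomes (set vs) c \<Longrightarrow> pmf P x = (\<Prod>v\<in>set vs. kernel_prob E K x v)"
    by blast
  show "ordered_markov E vs c P"
    unfolding ordered_markov_def
  proof (intro ballI allI impI)
    fix x k assume x: "x \<in> outcomes (set vs) c" and k: "k < length vs"
    have pa: "parents E {vs ! k} \<subseteq> set (take k vs)" using top k by (simp add: topological_order_def)
    have *: "marg P (insert (vs ! k) S) x = marg P S x * kernel_prob E K x (vs ! k)"
      if "parents E {vs ! k} \<subseteq> S" "S \<subseteq> set (take k vs)" for S
      by (rule marg_insert_eq_kernel[OF P top K eq k that x])
    show "marg P (set (take (Suc k) vs)) x * marg P (parents E {vs ! k}) x =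
       marg P (set (take k vs)) x * marg P (insert (vs ! k) (parents E {vs ! k})) x"
      using *[OF pa order_refl] *[OF order_refl pa] k by (simp add: set_take_Suc)
  qed
next
  assume om: "ordered_markov E vs c P"
  define A where "A v t = {y :: 'v \<Rightarrow> nat. \<forall>i\<in>parents E {v}. y i = t i}" for v and t :: "'v \<Rightarrow> nat"
  \<comment> \<open>The conditional law given the parents; where the condition is null, the point
    mass at 0, an admissible value because cardinalities are positive.\<close>
  define K where "K v t = (if v \<in> set vs \<and> set_pmf P \<inter> A v t \<noteq> {}
    then map_pmf (\<lambda>y. y v) (cond_pmf P (A v t)) else return_pmf 0)" for v t
  have K: "set_pmf (K v t) \<subseteq> {..<c v}" if "v \<in> set vs" for v t
    using P pos[OF that] that by (auto simp: K_def prob_simplex_def outcomes_def)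
  have cond: "marg P (parents E {v}) x * kernel_prob E K x v = marg P (insert v (parents E {v})) x"
    if v: "v \<in> set vs" and m: "marg P (parents E {v}) x \<noteq> 0" for v x
  proof -
    have A: "A v (restrict x (parents E {v})) = {y. \<forall>i\<in>parents E {v}. y i = x i}"
      by (auto simp: A_def)
    have "set_pmf P \<inter> A v (restrict x (parents E {v})) \<noteq> {}"
      using m unfolding marg_def A by (simp add: measure_pmf_zero_iff)
    then have "kernel_prob E K x v =
        measure_pmf.prob P (A v (restrict x (parents E {v})) \<inter> {y. y v = x v}) /
        measure_pmf.prob P (A v (restrict x (parents E {v})))"
      using v by (simp add: kernel_prob_def K_def pmf_map vimage_def prob_cond_pmf)
    moreover have "A v (restrict x (parents E {v})) \<inter> {y. y v = x v} =
        {y. \<forall>i\<in>insert v (parents E {v}). y i = x i}" unfolding A by auto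
    ultimately show ?thesis using m by (simp add: marg_def A)
  qed
  have "marg P (set (take k vs)) x = (\<Prod>v\<in>set (take k vs). kernel_prob E K x v)"
    if x: "x \<in> outcomes (set vs) c" and "k \<le> length vs" for k x
    using that(2)
  proof (induction k)
    case (Suc k)
    let ?v = "vs ! k"
    have k: "k < length vs" using Suc.prems by simp
    have v: "?v \<notin> set (take k vs)" using top k nth_notin_take by (auto simp: topological_order_def)
    have pa: "parents E {?v} \<subseteq> set (take k vs)" using top k by (simp add: topological_order_def)
    have mk: "marg P (set (take (Suc k) vs)) x * marg P (parents E {?v}) x =
       marg P (set (take k vs)) x * marg P (insert ?v (parents E {?v})) x"
      using om x k by (simp add: ordered_markov_def)
    have "marg P (set (take (Suc k) vs)) x = marg P (set (take k vs)) x * kernel_prob E K x ?v"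
    proof (cases "marg P (parents E {?v}) x = 0")
      \<comment> \<open>A null parent value makes every marginal that refines it null, so both sides
        are 0.\<close>
      case True
      have "marg P (set (take k vs)) x \<le> 0" using marg_mono[OF pa, of P x] True by simp
      moreover have "marg P (set (take (Suc k) vs)) x \<le> marg P (set (take k vs)) x"
        by (rule marg_mono) (use k in \<open>auto simp: set_take_Suc\<close>)
      moreover have "marg P (set (take (Suc k) vs)) x \<ge> 0" "marg P (set (take k vs)) x \<ge> 0"
        by (simp_all add: marg_def)
      ultimately show ?thesis by simp
    next
      case False
      have "marg P (set (take (Suc k) vs)) x * marg P (parents E {?v}) x =
          marg P (set (take k vs)) x * kernel_prob E K x ?v * marg P (parents E {?v}) x"
        unfolding mk cond[OF nth_mem[OF k] False, symmetric] by simp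
      then show ?thesis using False by (simp only: mult_cancel_right) simp
    qed
    then show ?case using Suc v k by (simp add: set_take_Suc)
  qed simp
  from this[of _ "length vs"] have "pmf P x = (\<Prod>v\<in>set vs. kernel_prob E K x v)"
    if "x \<in> outcomes (set vs) c" for x
    using marg_full[OF P that] that by simp
  then show "\<exists>K. (\<forall>v\<in>set vs. \<forall>t. set_pmf (K v t) \<subseteq> {..<c v}) \<and>
    (\<forall>x\<in>outcomes (set vs) c. pmf P x = (\<Prod>v\<in>set vs. kernel_prob E K x v))"
    using K by blast
qed

text \<open>Marginals are linear in the point probabilities, so every Markov equation is a
  difference of products of two linear forms.\<close>

lemma ordered_markov_algebraic:
  shows "\<exists>Z. real_algebraic_set (outcomes (set vs) c) Z \<and>
    {P \<in> prob_simplex (set vs) c. ordered_markov E vs c P} = {P \<in> prob_simplex (set vs) c. pmf P \<in> Z}"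
proof -
  let ?O = "outcomes (set vs) c"
  define M where "M S x z = (\<Sum>y\<in>{y \<in> ?O. \<forall>i\<in>S. y i = x i}. z y)"
    for S and x :: "'a \<Rightarrow> nat" and z :: "('a \<Rightarrow> nat) \<Rightarrow> real"
  define g where "g xk z = (let x = fst xk; k = snd xk in
     M (set (take (Suc k) vs)) x z * M (parents E {vs ! k}) x z -
     M (set (take k vs)) x z * M (insert (vs ! k) (parents E {vs ! k})) x z)" for xk z
  have fin: "finite ?O" by (simp add: finite_outcomes)
  have "poly_fun ?O (M S x)" for S x
    unfolding M_def[abs_def] using fin by (intro poly_fun_sum poly_fun_var) auto
  then have "poly_fun ?O (g xk)" for xk
    unfolding g_def[abs_def] Let_def by (intro poly_fun_diff poly_fun_mult)
  then have "real_algebraic_set ?O {z. \<forall>xk\<in>?O \<times> {..<length vs}. g xk z = 0}"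
    by (rule real_algebraic_set_zeros)
  moreover have "ordered_markov E vs c P \<longleftrightarrow> pmf P \<in> {z. \<forall>xk\<in>?O \<times> {..<length vs}. g xk z = 0}"
    if P: "P \<in> prob_simplex (set vs) c" for P
  proof -
    have "M S x (pmf P) = marg P S x" for S x
      using marg_eq_sum[OF _ P, of S x] by (simp add: M_def)
    then show ?thesis by (auto simp: ordered_markov_def g_def Let_def)
  qed
  ultimately show ?thesis by blast
qed

lemma algebraic_mdag_if_no_confounding:
  assumes G: "is_mdag G" and ne: "nodes G \<noteq> {}" and top: "topological_order (edges G) vs"
    and vs: "set vs = nodes G" and single: "\<And>A. A \<in> faces G \<Longrightarrow> \<exists>v\<in>nodes G. A \<subseteq> {v}"
  shows "algebraic_mdag G"
  unfolding algebraic_mdag_def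
proof (intro allI impI)
  fix c :: "'a \<Rightarrow> nat" assume pos: "\<forall>v\<in>nodes G. 0 < c v"
  have fin: "finite (nodes G)" using G by (simp add: is_mdag_def)
  obtain \<phi> where \<phi>: "\<And>A. A \<in> faces G \<Longrightarrow> \<phi> A \<in> nodes G \<and> A \<subseteq> {\<phi> A}" using single by metis
  have "sem_model (nodes G) (edges G) (faces G) id c \<subseteq> sem_model (nodes G) (edges G) (nodes G) (\<lambda>v. {v}) c"
    by (rule sem_model_mono[where \<phi> = \<phi>]) (use finite_faces[OF G] fin pos \<phi> in auto)
  moreover have "sem_model (nodes G) (edges G) (nodes G) (\<lambda>v. {v}) c \<subseteq> sem_model (nodes G) (edges G) (faces G) id c"
    by (rule sem_model_mono[where \<phi> = "\<lambda>v. {v}"])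
      (use finite_faces[OF G] fin pos G in \<open>auto simp: is_mdag_def\<close>)
  ultimately have "mdag_model G c = sem_model (nodes G) (edges G) (nodes G) (\<lambda>v. {v}) c"
    using mdag_model_eq_sem_model(2)[OF G, of c] pos by auto
  also have "\<dots> = {P \<in> prob_simplex (set vs) c. ordered_markov (edges G) vs c P}"
    using sem_model_singletons[OF fin, of c "edges G"] factorizes_iff_ordered_markov[OF _ top, of _ c] pos
    unfolding vs by (simp cong: conj_cong)
  finally show "\<exists>Z. real_algebraic_set (outcomes (nodes G) c) Z \<and>
      mdag_model G c = {P \<in> prob_simplex (nodes G) c. pmf P \<in> Z}"
    using ordered_markov_algebraic[of vs c "edges G"] vs by simp
qed

section \<open>Splicing latents\<close>

lemma solution_unique:
  assumes wf: "wf E" and E: "E \<subseteq> N \<times> N" and loc: "local_eqs E L sc f"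
    and x: "\<And>v. v \<in> N \<Longrightarrow> x v = f v x u" and y: "\<And>v. v \<in> N \<Longrightarrow> y v = f v y u" and v: "v \<in> N"
  shows "x v = y v"
  using wf v
proof (induction v rule: wf_induct_rule)
  case (less v)
  have "f v x u = f v y u" by (rule local_eqsD[OF loc]) (use less E in auto)
  then show ?case using x[OF less(2)] y[OF less(2)] by simp
qed

lemma solution_exists:
  assumes wf: "wf E" and E: "E \<subseteq> N \<times> N" and loc: "local_eqs E L sc f"
  shows "\<exists>x\<in>extensional N. u \<in> solutions N f x"
proof -
  define F where "F X v = (if v \<in> N then f v X u else undefined)" for X v
  define x where "x = wfrec E F"
  have x_eq: "x v = F x v" for v
  proof -
    have "x v = F (cut x E v) v" unfolding x_def by (rule wfrec[OF wf])
    also have "\<dots> = F x v"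
      unfolding F_def by (simp, intro impI local_eqsD[OF loc]) (auto simp: cut_def)
    finally show ?thesis .
  qed
  then have "x v = f v x u" if "v \<in> N" for v using x_eq[of v] that by (simp add: F_def)
  moreover have "x v = undefined" if "v \<notin> N" for v using x_eq[of v] that by (simp add: F_def)
  ultimately show ?thesis by (auto simp: solutions_def extensional_def)
qed

text \<open>Solutions are unique along a well-founded edge relation, so the latent values that solve
  the equations at \<open>x\<close> are those that \<open>X\<close> maps to \<open>x\<close>.
  Membership of an explicit distribution thus reduces to checking that \<open>X\<close> satisfies
  the mechanisms.\<close>

lemma sem_model_map_pmf:
  fixes N :: "'v set" and Q :: "'i \<Rightarrow> 'l pmf"
  assumes wf: "wf E" and E: "E \<subseteq> N \<times> N" and fin: "finite L" and pos: "\<And>v. v \<in> N \<Longrightarrow> 0 < c v"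
    and Q: "\<And>l. l \<in> L \<Longrightarrow> finite (set_pmf (Q l))" and loc: "local_eqs E L sc f"
    and bd: "\<And>v x u. v \<in> N \<Longrightarrow> f v x u < c v"
    and X: "\<And>u. X u \<in> outcomes N c" "\<And>u v. v \<in> N \<Longrightarrow> X u v = f v (X u) u"
  shows "map_pmf X (Pi_pmf L d Q) \<in> sem_model N E L sc c"
proof (rule sem_modelI[where Q = Q and f = f and d = d])
  show "map_pmf X (Pi_pmf L d Q) \<in> prob_simplex N c" using X by (auto simp: prob_simplex_def)
  fix x assume x: "x \<in> outcomes N c"
  have "X u = x \<longleftrightarrow> u \<in> solutions N f x" for u
  proof
    assume u: "u \<in> solutions N f x"
    have "X u v = x v" if "v \<in> N" for v
      by (rule solution_unique[OF wf E loc _ _ that]) (use u X in \<open>auto simp: solutions_def\<close>)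
    then show "X u = x" using X(1)[of u] x unfolding outcomes_def by (intro PiE_ext) auto
  qed (use X in \<open>auto simp: solutions_def\<close>)
  then have "X -` {x} = solutions N f x" by auto
  then show "pmf (map_pmf X (Pi_pmf L d Q)) x = measure_pmf.prob (Pi_pmf L d Q) (solutions N f x)"
    by (simp add: pmf_map)
qed (use assms in auto)

text \<open>Only the supports \<open>S l\<close> of the latents are kept. Independence becomes the
  last clause: any choice of values from the separate supports occurs jointly and yields an outcome
  of positive probability.\<close>

lemma sem_model_support:
  fixes N :: "'v set" and L :: "'i set"
  assumes P: "P \<in> sem_model N E L sc c" and wf: "wf E" and E: "E \<subseteq> N \<times> N" and fin: "finite L"
  obtains f and S :: "'i \<Rightarrow> nat set" where "local_eqs E L sc f"
    "\<And>x. x \<in> set_pmf P \<Longrightarrow> \<exists>u. (\<forall>l\<in>L. u l \<in> S l) \<and> (\<forall>v\<in>N. x v = f v x u)"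
    "\<And>u. (\<And>l. l \<in> L \<Longrightarrow> u l \<in> S l) \<Longrightarrow> \<exists>x\<in>set_pmf P. \<forall>v\<in>N. x v = f v x u"
proof -
  obtain Q :: "'i \<Rightarrow> nat pmf" and f
    where simplex: "P \<in> prob_simplex N c" and loc: "local_eqs E L sc f"
      and bd: "\<And>v x u. v \<in> N \<Longrightarrow> f v x u < c v"
      and eq: "\<And>x. x \<in> outcomes N c \<Longrightarrow>
        pmf P x = measure_pmf.prob (Pi_pmf L undefined Q) (solutions N f x)"
    using P unfolding sem_model_def by blast
  show thesis
  proof (rule that[of f "\<lambda>l. set_pmf (Q l)"])
    fix x assume x: "x \<in> set_pmf P"
    then have "x \<in> outcomes N c" using simplex by (auto simp: prob_simplex_def)
    then have "measure_pmf.prob (Pi_pmf L undefined Q) (solutions N f x) \<noteq> 0"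
      using eq x by (metis pmf_eq_0_set_pmf)
    then obtain u where "u \<in> set_pmf (Pi_pmf L undefined Q)" "u \<in> solutions N f x"
      by (auto simp: measure_pmf_zero_iff)
    then show "\<exists>u. (\<forall>l\<in>L. u l \<in> set_pmf (Q l)) \<and> (\<forall>v\<in>N. x v = f v x u)"
      using fin by (auto simp: set_Pi_pmf PiE_dflt_def solutions_def)
  next
    fix u :: "'i \<Rightarrow> nat" assume u: "\<And>l. l \<in> L \<Longrightarrow> u l \<in> set_pmf (Q l)"
    \<comment> \<open>Points in the support of \<open>Pi_pmf\<close> have the default value outside
      \<open>L\<close>; locality makes the change invisible to the mechanisms.\<close>
    define u' where "u' l = (if l \<in> L then u l else undefined)" for l
    obtain x where x: "x \<in> extensional N" "u' \<in> solutions N f x"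
      using solution_exists[OF wf E loc] by blast
    have sol: "x v = f v x u'" if "v \<in> N" for v using x that by (simp add: solutions_def)
    have x': "x \<in> outcomes N c"
      unfolding outcomes_def PiE_def using x(1) sol bd by (auto intro: Pi_I)
    have "u' \<in> set_pmf (Pi_pmf L undefined Q)" using u fin by (auto simp: set_Pi_pmf PiE_dflt_def u'_def)
    then have "measure_pmf.prob (Pi_pmf L undefined Q) (solutions N f x) > 0"
      using x(2) by (rule measure_pmf_posI)
    then have "x \<in> set_pmf P" using eq[OF x'] by (simp add: set_pmf_iff)
    moreover have "f v x u' = f v x u" for v by (rule local_eqsD[OF loc]) (auto simp: u'_def)
    ultimately show "\<exists>x\<in>set_pmf P. \<forall>v\<in>N. x v = f v x u" using sol by auto
  qed (rule loc)
qed

section \<open>mDAGs presented by generating faces\<close>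

definition mk_mdag :: "'v rel \<Rightarrow> 'v set set \<Rightarrow> 'v::finite mdag" where
  "mk_mdag E F = \<lparr>nodes = UNIV, edges = E, faces = {A. (\<exists>v. A \<subseteq> {v}) \<or> (\<exists>B\<in>F. A \<subseteq> B)}\<rparr>"

lemma mk_mdag_simps [simp]:
  "nodes (mk_mdag E F) = UNIV" "edges (mk_mdag E F) = E"
  "faces (mk_mdag E F) = {A. (\<exists>v. A \<subseteq> {v}) \<or> (\<exists>B\<in>F. A \<subseteq> B)}"
  by (simp_all add: mk_mdag_def)

lemma is_mdag_mk_mdag:
  assumes "acyclic E" shows "is_mdag (mk_mdag E F)"
proof -
  have "B \<in> faces (mk_mdag E F)" if "A \<in> faces (mk_mdag E F)" "B \<subseteq> A" for A B
    using that unfolding mk_mdag_simps mem_Collect_eq by (meson order_trans)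
  then show ?thesis unfolding is_mdag_def using assms by simp
qed

lemma wf_rel: "acyclic E \<Longrightarrow> wf (E :: 'v::finite rel)"
  by (simp add: finite_acyclic_wf)

text \<open>Every face lies in a generator or in a singleton, so latents on these suffice. Setting
  the supports to \<open>UNIV\<close> at all other indices allows quantification over all
  \<open>l\<close>, and spliced assignments then carry no side conditions.\<close>

lemma mk_mdag_support:
  fixes F :: "'v::finite set set"
  assumes P: "P \<in> mdag_model (mk_mdag E F) c" and E: "acyclic E" and pos: "\<And>v. 0 < c v"
  shows "\<exists>f (S :: 'v set \<Rightarrow> nat set). local_eqs E (F \<union> range (\<lambda>v. {v})) id f \<and>
    (\<forall>x\<in>set_pmf P. \<exists>u. (\<forall>l. u l \<in> S l) \<and> (\<forall>v. x v = f v x u)) \<and>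
    (\<forall>u. (\<forall>l. u l \<in> S l) \<longrightarrow> (\<exists>x\<in>set_pmf P. \<forall>v. x v = f v x u))"
proof -
  let ?L = "F \<union> range (\<lambda>v. {v})"
  have "\<exists>B. A \<in> faces (mk_mdag E F) \<longrightarrow> B \<in> ?L \<and> A \<subseteq> B" for A
    unfolding mk_mdag_simps mem_Collect_eq by blast
  then obtain \<phi> where \<phi>: "\<And>A. A \<in> faces (mk_mdag E F) \<Longrightarrow> \<phi> A \<in> ?L \<and> A \<subseteq> \<phi> A" by metis
  have "P \<in> sem_model UNIV E (faces (mk_mdag E F)) id c"
    using P mdag_model_eq_sem_model(2)[OF is_mdag_mk_mdag[OF E], of F c] pos by simp
  also have "sem_model UNIV E (faces (mk_mdag E F)) id c \<subseteq> sem_model UNIV E ?L id c"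
    by (rule sem_model_mono[where \<phi> = \<phi>]) (use pos \<phi> in auto)
  finally obtain f and S :: "'v set \<Rightarrow> nat set" where loc: "local_eqs E ?L id f"
    and 1: "\<And>x. x \<in> set_pmf P \<Longrightarrow> \<exists>u. (\<forall>l\<in>?L. u l \<in> S l) \<and> (\<forall>v\<in>UNIV. x v = f v x u)"
    and 2: "\<And>u. (\<And>l. l \<in> ?L \<Longrightarrow> u l \<in> S l) \<Longrightarrow> \<exists>x\<in>set_pmf P. \<forall>v\<in>UNIV. x v = f v x u"
    by (rule sem_model_support[OF _ wf_rel[OF E]]) auto
  define S' where "S' l = (if l \<in> ?L then S l else UNIV)" for l
  have "\<exists>u. (\<forall>l. u l \<in> S' l) \<and> (\<forall>v. x v = f v x u)" if "x \<in> set_pmf P" for x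
    using 1[OF that] by (fastforce simp: S'_def)
  moreover have "\<exists>x\<in>set_pmf P. \<forall>v. x v = f v x u" if u: "\<forall>l. u l \<in> S' l" for u
  proof -
    have "u l \<in> S l" if "l \<in> ?L" for l using u[rule_format, of l] that unfolding S'_def by simp
    from 2[OF this] show ?thesis by simp
  qed
  ultimately show ?thesis using loc by blast
qed

lemma mix_latents:
  assumes loc: "local_eqs E L id f" and u: "\<forall>v. x v = f v x u" "\<forall>v. y v = f v y u'"
    and agree: "\<And>w. (w, v) \<in> E \<Longrightarrow> x w = y w" "\<And>l. l \<in> L \<Longrightarrow> v \<in> l \<Longrightarrow> u l = u' l"
  shows "x v = y v"
proof -
  have "f v x u = f v y u'" by (rule local_eqsD[OF loc]) (use agree in auto)
  then show ?thesis using u by simp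
qed

text \<open>Every distribution that is shown to lie in a model has this form: an image of three
  independent bits. One membership lemma then covers all of them.\<close>

definition bits3 :: "real \<Rightarrow> real \<Rightarrow> real \<Rightarrow> (bool \<Rightarrow> bool \<Rightarrow> bool \<Rightarrow> 'a) \<Rightarrow> 'a pmf" where
  "bits3 s t r X = bind_pmf (bernoulli_pmf s) (\<lambda>i. bind_pmf (bernoulli_pmf t) (\<lambda>j.
     bind_pmf (bernoulli_pmf r) (\<lambda>k. return_pmf (X i j k))))"

lemma set_bits3:
  "set_pmf (bits3 (1/2) (1/2) (1/2) X) = (\<Union>i. \<Union>j. \<Union>k. {X i j k})"
  by (simp add: bits3_def)

lemma set_bits3_subset: "set_pmf (bits3 s t r X) \<subseteq> (\<Union>i. \<Union>j. \<Union>k. {X i j k})"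
  by (auto simp: bits3_def)

lemma pmf_bits3:
  assumes "s \<in> {0..1}" "t \<in> {0..1}" "r \<in> {0..1}"
  shows "pmf (bits3 s t r X) x =
    s * (t * (r * pmf (return_pmf (X True True True)) x + (1 - r) * pmf (return_pmf (X True True False)) x) +
     (1 - t) * (r * pmf (return_pmf (X True False True)) x + (1 - r) * pmf (return_pmf (X True False False)) x)) +
    (1 - s) * (t * (r * pmf (return_pmf (X False True True)) x + (1 - r) * pmf (return_pmf (X False True False)) x) +
     (1 - t) * (r * pmf (return_pmf (X False False True)) x + (1 - r) * pmf (return_pmf (X False False False)) x))"
  unfolding bits3_def using assms by (simp add: pmf_bind_bernoulli)

text \<open>The latents are indexed by 0, 1, 2 and not by their faces, so that two bits may sit on
  the same face. An idle bit is given the empty face.\<close>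

lemma bits3_in_model:
  fixes F :: "'v::finite set set" and X :: "bool \<Rightarrow> bool \<Rightarrow> bool \<Rightarrow> 'v \<Rightarrow> nat"
  assumes E: "acyclic E" and pos: "\<And>v. 0 < c v"
    and faces: "{A, B, C} \<subseteq> faces (mk_mdag E F)"
    and loc: "\<And>v x x' i i' j j' k k'. (\<And>w. (w, v) \<in> E \<Longrightarrow> x w = x' w) \<Longrightarrow> (v \<in> A \<Longrightarrow> i = i') \<Longrightarrow>
      (v \<in> B \<Longrightarrow> j = j') \<Longrightarrow> (v \<in> C \<Longrightarrow> k = k') \<Longrightarrow> f v x i j k = f v x' i' j' k'"
    and bd: "\<And>v x i j k. f v x i j k < c v"
    and X: "\<And>i j k v. X i j k v = f v (X i j k) i j k"
  shows "bits3 s t r X \<in> mdag_model (mk_mdag E F) c"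
proof -
  let ?L = "{0, 1, 2 :: nat}"
  define sc where "sc l = (if l = 0 then A else if l = 1 then B else C)" for l :: nat
  define Q where "Q l = bernoulli_pmf (if l = 0 then s else if l = 1 then t else r)" for l :: nat
  define f' where "f' v x u = f v x (u 0) (u 1) (u 2)" for v x and u :: "nat \<Rightarrow> bool"
  define Y where "Y u = X (u 0) (u 1) (u 2)" for u :: "nat \<Rightarrow> bool"
  have "bits3 s t r X = map_pmf Y (Pi_pmf ?L False Q)"
  proof -
    have "Pi_pmf ?L False Q = Pi_pmf (insert 2 (insert 1 (insert 0 {}))) False Q"
      by (rule Pi_pmf_cong) auto
    also have "map_pmf Y \<dots> = bits3 s t r X"
      by (simp add: Pi_pmf_insert_bind map_bind_pmf bind_return_pmf bind_assoc_pmf bind_map_pmf pmf.map_comp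
          bits3_def Q_def Y_def o_def del: insert_commute) (simp add: map_pmf_def)
    finally show ?thesis by simp
  qed
  also have "\<dots> \<in> sem_model UNIV E ?L sc c"
  proof (rule sem_model_map_pmf[OF wf_rel[OF E], where f = f'])
    show "local_eqs E ?L sc f'"
      unfolding local_eqs_def f'_def by (intro allI impI loc) (auto simp: sc_def)
    have "X i j k v < c v" for i j k v using X[of i j k v] bd by simp
    then show "Y u \<in> outcomes UNIV c" for u by (simp add: Y_def outcomes_def PiE_def)
    show "Y u v = f' v (Y u) u" for u v unfolding Y_def f'_def by (rule X)
  qed (use pos bd in \<open>auto simp: f'_def\<close>)
  also have "sem_model UNIV E ?L sc c \<subseteq> sem_model UNIV E (faces (mk_mdag E F)) id c"
    by (rule sem_model_mono[where \<phi> = sc]) (use pos faces in \<open>auto simp: sc_def\<close>)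
  finally show ?thesis
    using mdag_model_eq_sem_model(2)[OF is_mdag_mk_mdag[OF E], of F c] pos by simp
qed

section \<open>Three nodes: distributions excluded by splicing\<close>

abbreviation (input) "ab \<equiv> (Node_a, Node_b)"
abbreviation (input) "ac \<equiv> (Node_a, Node_c)"
abbreviation (input) "bc \<equiv> (Node_b, Node_c)"
abbreviation (input) "AB \<equiv> {Node_a, Node_b}"
abbreviation (input) "AC \<equiv> {Node_a, Node_c}"
abbreviation (input) "BC \<equiv> {Node_b, Node_c}"
abbreviation (input) "ABC \<equiv> {Node_a, Node_b, Node_c}"

lemma UNIV_abc: "(UNIV :: abc set) = ABC"
  using abc.exhaust by auto

instance abc :: finite
  by standard (simp add: UNIV_abc)

lemma all_abc: "(\<forall>v. p v) \<longleftrightarrow> p Node_a \<and> p Node_b \<and> p Node_c"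
  by (metis abc.exhaust)

definition triple :: "nat \<Rightarrow> nat \<Rightarrow> nat \<Rightarrow> abc \<Rightarrow> nat" where
  "triple i j k v = (case v of Node_a \<Rightarrow> i | Node_b \<Rightarrow> j | Node_c \<Rightarrow> k)"

lemma triple_simps [simp]:
  "triple i j k Node_a = i" "triple i j k Node_b = j" "triple i j k Node_c = k"
  by (simp_all add: triple_def)

lemma triple_eq_iff [simp]: "triple i j k = triple i' j' k' \<longleftrightarrow> i = i' \<and> j = j' \<and> k = k'"
  by (metis triple_simps)

lemma acyclic_abc:
  assumes "distinct [x, y, z]" "E \<subseteq> {(x, y), (x, z), (y, z)}" shows "acyclic E"
proof -
  define r :: "'a \<Rightarrow> nat" where "r v = (if v = x then 0 else if v = y then 1 else 2)" for v
  have "E \<subseteq> Wellfounded.measure r" using assms by (auto simp: r_def)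
  then show ?thesis by (meson acyclic_subset wf_acyclic wf_measure)
qed

text \<open>The mechanisms are run on latents taken from the sample of \<open>y\<close> where
  \<open>p\<close> holds and from that of \<open>z\<close> elsewhere. A node whose latents all have
  one origin, and whose parents agree with that origin, cannot tell the spliced world from the
  sample. Values of further nodes come from the fact that \<open>x\<close> lies in the
  support.\<close>

lemma splice_support:
  fixes F :: "'v::finite set set"
  assumes P: "P \<in> mdag_model (mk_mdag E F) c" and E: "acyclic E" and pos: "\<And>v. 0 < c v"
    and y: "y \<in> set_pmf P" and z: "z \<in> set_pmf P"
  shows "\<exists>x\<in>set_pmf P. \<forall>v.
    ((\<forall>w. (w, v) \<in> E \<longrightarrow> x w = y w) \<longrightarrow> (\<forall>l\<in>F \<union> range (\<lambda>v. {v}). v \<in> l \<longrightarrow> p l) \<longrightarrow> x v = y v) \<and>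
    ((\<forall>w. (w, v) \<in> E \<longrightarrow> x w = z w) \<longrightarrow> (\<forall>l\<in>F \<union> range (\<lambda>v. {v}). v \<in> l \<longrightarrow> \<not> p l) \<longrightarrow> x v = z v)"
proof -
  obtain f and S :: "'v set \<Rightarrow> nat set" where loc: "local_eqs E (F \<union> range (\<lambda>v. {v})) id f"
    and 1: "\<forall>x\<in>set_pmf P. \<exists>u. (\<forall>l. u l \<in> S l) \<and> (\<forall>v. x v = f v x u)"
    and 2: "\<forall>u. (\<forall>l. u l \<in> S l) \<longrightarrow> (\<exists>x\<in>set_pmf P. \<forall>v. x v = f v x u)"
    using mk_mdag_support[OF P E pos] by (elim exE conjE)
  obtain u where u: "\<forall>l. u l \<in> S l" "\<forall>v. y v = f v y u" using 1 y by metis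
  obtain u' where u': "\<forall>l. u' l \<in> S l" "\<forall>v. z v = f v z u'" using 1 z by metis
  define w where "w l = (if p l then u l else u' l)" for l
  have "\<forall>l. w l \<in> S l" using u(1) u'(1) by (simp add: w_def)
  then obtain x where x: "x \<in> set_pmf P" "\<forall>v. x v = f v x w"
    using 2 by blast
  have "x v = y v" if "\<forall>w. (w, v) \<in> E \<longrightarrow> x w = y w" "\<forall>l\<in>F \<union> range (\<lambda>v. {v}). v \<in> l \<longrightarrow> p l" for v
    by (rule mix_latents[OF loc x(2) u(2)]) (use that in \<open>auto simp: w_def\<close>)
  moreover have "x v = z v" if "\<forall>w. (w, v) \<in> E \<longrightarrow> x w = z w" "\<forall>l\<in>F \<union> range (\<lambda>v. {v}). v \<in> l \<longrightarrow> \<not> p l" for v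
    by (rule mix_latents[OF loc x(2) u'(2)]) (use that in \<open>auto simp: w_def\<close>)
  ultimately show ?thesis using x(1) by blast
qed

text \<open>Node a is constant on the support, so its outgoing edges transmit nothing, and b and c
  have no common latent. The splice is (0, 0, 1).\<close>

lemma bc_correlation_not_in_hub:
  assumes pos: "\<And>v. 0 < c v"
    and set: "set_pmf P = {triple 0 0 0, triple 0 1 1}"
  shows "P \<notin> mdag_model (mk_mdag {ab, ac} {AB, AC}) c"
proof
  assume P: "P \<in> mdag_model (mk_mdag {ab, ac} {AB, AC}) c"
  have E: "acyclic {ab, ac}" by (rule acyclic_abc[of Node_a Node_b Node_c]) auto
  have yz: "triple 0 0 0 \<in> set_pmf P" "triple 0 1 1 \<in> set_pmf P" by (simp_all add: set)
  obtain x where x: "x \<in> set_pmf P" and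
    mix: "\<forall>v. ((\<forall>w. (w, v) \<in> {ab, ac} \<longrightarrow> x w = triple 0 0 0 w) \<longrightarrow>
        (\<forall>l\<in>{AB, AC} \<union> range (\<lambda>v. {v}). v \<in> l \<longrightarrow> Node_b \<in> l) \<longrightarrow> x v = triple 0 0 0 v) \<and>
      ((\<forall>w. (w, v) \<in> {ab, ac} \<longrightarrow> x w = triple 0 1 1 w) \<longrightarrow>
        (\<forall>l\<in>{AB, AC} \<union> range (\<lambda>v. {v}). v \<in> l \<longrightarrow> \<not> Node_b \<in> l) \<longrightarrow> x v = triple 0 1 1 v)"
    using splice_support[OF P E pos yz, of "\<lambda>l. Node_b \<in> l"] by (elim bexE)
  have x0: "x Node_b = triple 0 0 0 Node_b"
    by (rule mix[rule_format, THEN conjunct1, rule_format]) (use x set  in auto)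
  have x1: "x Node_c = triple 0 1 1 Node_c"
    by (rule mix[rule_format, THEN conjunct2, rule_format]) (use x set x0 in auto)
  show False using x set x0 x1 by auto
qed

text \<open>The only path of edges from a to c runs through b, which is constant on the support, and
  a and c have no common latent. The splice is (0, 0, 1).\<close>

lemma ac_correlation_not_in_instrumental:
  assumes pos: "\<And>v. 0 < c v"
    and set: "set_pmf P = {triple 0 0 0, triple 1 0 1}"
  shows "P \<notin> mdag_model (mk_mdag {ab, bc} {AB, BC}) c"
proof
  assume P: "P \<in> mdag_model (mk_mdag {ab, bc} {AB, BC}) c"
  have E: "acyclic {ab, bc}" by (rule acyclic_abc[of Node_a Node_b Node_c]) auto
  have yz: "triple 0 0 0 \<in> set_pmf P" "triple 1 0 1 \<in> set_pmf P" by (simp_all add: set)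
  obtain x where x: "x \<in> set_pmf P" and
    mix: "\<forall>v. ((\<forall>w. (w, v) \<in> {ab, bc} \<longrightarrow> x w = triple 0 0 0 w) \<longrightarrow>
        (\<forall>l\<in>{AB, BC} \<union> range (\<lambda>v. {v}). v \<in> l \<longrightarrow> Node_a \<in> l) \<longrightarrow> x v = triple 0 0 0 v) \<and>
      ((\<forall>w. (w, v) \<in> {ab, bc} \<longrightarrow> x w = triple 1 0 1 w) \<longrightarrow>
        (\<forall>l\<in>{AB, BC} \<union> range (\<lambda>v. {v}). v \<in> l \<longrightarrow> \<not> Node_a \<in> l) \<longrightarrow> x v = triple 1 0 1 v)"
    using splice_support[OF P E pos yz, of "\<lambda>l. Node_a \<in> l"] by (elim bexE)
  have x0: "x Node_a = triple 0 0 0 Node_a"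
    by (rule mix[rule_format, THEN conjunct1, rule_format]) (use x set  in auto)
  have x1: "x Node_c = triple 1 0 1 Node_c"
    by (rule mix[rule_format, THEN conjunct2, rule_format]) (use x set x0 in auto)
  show False using x set x0 x1 by auto
qed

text \<open>Nodes a and b have neither parents nor a common latent, so they would be independent:
  the splice has a = 0 and b = 1.\<close>

lemma ab_correlation_not_in_collider:
  assumes pos: "\<And>v. 0 < c v"
    and set: "set_pmf P = {triple 0 0 0, triple 1 1 0}"
  shows "P \<notin> mdag_model (mk_mdag {ac, bc} {AC, BC}) c"
proof
  assume P: "P \<in> mdag_model (mk_mdag {ac, bc} {AC, BC}) c"
  have E: "acyclic {ac, bc}" by (rule acyclic_abc[of Node_a Node_b Node_c]) auto
  have yz: "triple 0 0 0 \<in> set_pmf P" "triple 1 1 0 \<in> set_pmf P" by (simp_all add: set)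
  obtain x where x: "x \<in> set_pmf P" and
    mix: "\<forall>v. ((\<forall>w. (w, v) \<in> {ac, bc} \<longrightarrow> x w = triple 0 0 0 w) \<longrightarrow>
        (\<forall>l\<in>{AC, BC} \<union> range (\<lambda>v. {v}). v \<in> l \<longrightarrow> Node_a \<in> l) \<longrightarrow> x v = triple 0 0 0 v) \<and>
      ((\<forall>w. (w, v) \<in> {ac, bc} \<longrightarrow> x w = triple 1 1 0 w) \<longrightarrow>
        (\<forall>l\<in>{AC, BC} \<union> range (\<lambda>v. {v}). v \<in> l \<longrightarrow> \<not> Node_a \<in> l) \<longrightarrow> x v = triple 1 1 0 v)"
    using splice_support[OF P E pos yz, of "\<lambda>l. Node_a \<in> l"] by (elim bexE)
  have x0: "x Node_a = triple 0 0 0 Node_a"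
    by (rule mix[rule_format, THEN conjunct1, rule_format]) (use x set  in auto)
  have x1: "x Node_b = triple 1 1 0 Node_b"
    by (rule mix[rule_format, THEN conjunct2, rule_format]) (use x set x0 in auto)
  show False using x set x0 x1 by auto
qed

text \<open>In the fork b and c are independent given a. The two samples agree in a = 0, and
  splicing them yields (0, 0, 1), which has odd parity.\<close>

lemma xor_not_in_fork:
  assumes pos: "\<And>v. 0 < c v"
    and set: "set_pmf P = {triple 0 0 0, triple 0 1 1, triple 1 0 1, triple 1 1 0}"
  shows "P \<notin> mdag_model (mk_mdag {ab, ac} {}) c"
proof
  assume P: "P \<in> mdag_model (mk_mdag {ab, ac} {}) c"
  have E: "acyclic {ab, ac}" by (rule acyclic_abc[of Node_a Node_b Node_c]) auto
  have yz: "triple 0 0 0 \<in> set_pmf P" "triple 0 1 1 \<in> set_pmf P" by (simp_all add: set)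
  obtain x where x: "x \<in> set_pmf P" and
    mix: "\<forall>v. ((\<forall>w. (w, v) \<in> {ab, ac} \<longrightarrow> x w = triple 0 0 0 w) \<longrightarrow>
        (\<forall>l\<in>{} \<union> range (\<lambda>v. {v}). v \<in> l \<longrightarrow> Node_c \<notin> l) \<longrightarrow> x v = triple 0 0 0 v) \<and>
      ((\<forall>w. (w, v) \<in> {ab, ac} \<longrightarrow> x w = triple 0 1 1 w) \<longrightarrow>
        (\<forall>l\<in>{} \<union> range (\<lambda>v. {v}). v \<in> l \<longrightarrow> \<not> Node_c \<notin> l) \<longrightarrow> x v = triple 0 1 1 v)"
    using splice_support[OF P E pos yz, of "\<lambda>l. Node_c \<notin> l"] by (elim bexE)
  have x0: "x Node_a = triple 0 0 0 Node_a"
    by (rule mix[rule_format, THEN conjunct1, rule_format]) (use x set  in auto)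
  have x1: "x Node_b = triple 0 0 0 Node_b"
    by (rule mix[rule_format, THEN conjunct1, rule_format]) (use x set x0 in auto)
  have x2: "x Node_c = triple 0 1 1 Node_c"
    by (rule mix[rule_format, THEN conjunct2, rule_format]) (use x set x0 x1 in auto)
  show False using x set x0 x1 x2 by auto
qed

text \<open>In the chain a and c are independent given b. The two samples agree in b = 0, and
  splicing them again yields the odd outcome (0, 0, 1).\<close>

lemma xor_not_in_chain:
  assumes pos: "\<And>v. 0 < c v"
    and set: "set_pmf P = {triple 0 0 0, triple 0 1 1, triple 1 0 1, triple 1 1 0}"
  shows "P \<notin> mdag_model (mk_mdag {ab, bc} {}) c"
proof
  assume P: "P \<in> mdag_model (mk_mdag {ab, bc} {}) c"
  have E: "acyclic {ab, bc}" by (rule acyclic_abc[of Node_a Node_b Node_c]) auto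
  have yz: "triple 0 0 0 \<in> set_pmf P" "triple 1 0 1 \<in> set_pmf P" by (simp_all add: set)
  obtain x where x: "x \<in> set_pmf P" and
    mix: "\<forall>v. ((\<forall>w. (w, v) \<in> {ab, bc} \<longrightarrow> x w = triple 0 0 0 w) \<longrightarrow>
        (\<forall>l\<in>{} \<union> range (\<lambda>v. {v}). v \<in> l \<longrightarrow> Node_c \<notin> l) \<longrightarrow> x v = triple 0 0 0 v) \<and>
      ((\<forall>w. (w, v) \<in> {ab, bc} \<longrightarrow> x w = triple 1 0 1 w) \<longrightarrow>
        (\<forall>l\<in>{} \<union> range (\<lambda>v. {v}). v \<in> l \<longrightarrow> \<not> Node_c \<notin> l) \<longrightarrow> x v = triple 1 0 1 v)"
    using splice_support[OF P E pos yz, of "\<lambda>l. Node_c \<notin> l"] by (elim bexE)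
  have x0: "x Node_a = triple 0 0 0 Node_a"
    by (rule mix[rule_format, THEN conjunct1, rule_format]) (use x set  in auto)
  have x1: "x Node_b = triple 0 0 0 Node_b"
    by (rule mix[rule_format, THEN conjunct1, rule_format]) (use x set x0 in auto)
  have x2: "x Node_c = triple 1 0 1 Node_c"
    by (rule mix[rule_format, THEN conjunct2, rule_format]) (use x set x0 x1 in auto)
  show False using x set x0 x1 x2 by auto
qed

text \<open>The splice inherits c = 0 from the first sample, and the support then forces a = 0. So b
  sees the parent value and the latents of the second sample and becomes 1, but no supported outcome
  has b = 1 and c = 0.\<close>

lemma instrument_b_witness_not_in_instrument_c:
  assumes pos: "\<And>v. 0 < c v"
    and set: "set_pmf P = {triple 0 0 0, triple 0 1 1, triple 1 0 1, triple 1 1 1}"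
  shows "P \<notin> mdag_model (mk_mdag {ab} {AB, AC}) c"
proof
  assume P: "P \<in> mdag_model (mk_mdag {ab} {AB, AC}) c"
  have E: "acyclic {ab}" by (rule acyclic_abc[of Node_a Node_b Node_c]) auto
  have yz: "triple 0 0 0 \<in> set_pmf P" "triple 0 1 1 \<in> set_pmf P" by (simp_all add: set)
  obtain x where x: "x \<in> set_pmf P" and
    mix: "\<forall>v. ((\<forall>w. (w, v) \<in> {ab} \<longrightarrow> x w = triple 0 0 0 w) \<longrightarrow>
        (\<forall>l\<in>{AB, AC} \<union> range (\<lambda>v. {v}). v \<in> l \<longrightarrow> Node_c \<in> l) \<longrightarrow> x v = triple 0 0 0 v) \<and>
      ((\<forall>w. (w, v) \<in> {ab} \<longrightarrow> x w = triple 0 1 1 w) \<longrightarrow>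
        (\<forall>l\<in>{AB, AC} \<union> range (\<lambda>v. {v}). v \<in> l \<longrightarrow> \<not> Node_c \<in> l) \<longrightarrow> x v = triple 0 1 1 v)"
    using splice_support[OF P E pos yz, of "\<lambda>l. Node_c \<in> l"] by (elim bexE)
  have x0: "x Node_c = triple 0 0 0 Node_c"
    by (rule mix[rule_format, THEN conjunct1, rule_format]) (use x set  in auto)
  have x1: "x Node_b = triple 0 1 1 Node_b"
    by (rule mix[rule_format, THEN conjunct2, rule_format]) (use x set x0 in auto)
  show False using x set x0 x1 by auto
qed

text \<open>The mirror image under the exchange of b and c.\<close>

lemma instrument_c_witness_not_in_instrument_b:
  assumes pos: "\<And>v. 0 < c v"
    and set: "set_pmf P = {triple 0 0 0, triple 0 1 1, triple 1 1 0, triple 1 1 1}"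
  shows "P \<notin> mdag_model (mk_mdag {ac} {AB, AC}) c"
proof
  assume P: "P \<in> mdag_model (mk_mdag {ac} {AB, AC}) c"
  have E: "acyclic {ac}" by (rule acyclic_abc[of Node_a Node_b Node_c]) auto
  have yz: "triple 0 0 0 \<in> set_pmf P" "triple 0 1 1 \<in> set_pmf P" by (simp_all add: set)
  obtain x where x: "x \<in> set_pmf P" and
    mix: "\<forall>v. ((\<forall>w. (w, v) \<in> {ac} \<longrightarrow> x w = triple 0 0 0 w) \<longrightarrow>
        (\<forall>l\<in>{AB, AC} \<union> range (\<lambda>v. {v}). v \<in> l \<longrightarrow> Node_b \<in> l) \<longrightarrow> x v = triple 0 0 0 v) \<and>
      ((\<forall>w. (w, v) \<in> {ac} \<longrightarrow> x w = triple 0 1 1 w) \<longrightarrow>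
        (\<forall>l\<in>{AB, AC} \<union> range (\<lambda>v. {v}). v \<in> l \<longrightarrow> \<not> Node_b \<in> l) \<longrightarrow> x v = triple 0 1 1 v)"
    using splice_support[OF P E pos yz, of "\<lambda>l. Node_b \<in> l"] by (elim bexE)
  have x0: "x Node_b = triple 0 0 0 Node_b"
    by (rule mix[rule_format, THEN conjunct1, rule_format]) (use x set  in auto)
  have x1: "x Node_c = triple 0 1 1 Node_c"
    by (rule mix[rule_format, THEN conjunct2, rule_format]) (use x set x0 in auto)
  show False using x set x0 x1 by auto
qed

text \<open>Two splices are linked through b. In \<open>x\<close> node a receives only latents of
  the first sample, so \<open>x\<close> is all 0; in \<open>x'\<close> node c receives only latents
  of the second, so \<open>x'\<close> is all 1. Yet b receives the same latents in both.\<close>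

lemma ghz_not_in_triangle:
  assumes pos: "\<And>v. 0 < c v" and set: "set_pmf P = {triple 0 0 0, triple 1 1 1}"
  shows "P \<notin> mdag_model (mk_mdag {} {AB, AC, BC}) c"
    (is "P \<notin> mdag_model (mk_mdag {} ?F) c")
proof
  assume P: "P \<in> mdag_model (mk_mdag {} ?F) c"
  have E: "acyclic ({} :: abc rel)" by (simp add: acyclic_def)
  obtain f and S :: "abc set \<Rightarrow> nat set" where loc: "local_eqs {} (?F \<union> range (\<lambda>v. {v})) id f"
    and 1: "\<forall>x\<in>set_pmf P. \<exists>u. (\<forall>l. u l \<in> S l) \<and> (\<forall>v. x v = f v x u)"
    and 2: "\<forall>u. (\<forall>l. u l \<in> S l) \<longrightarrow> (\<exists>x\<in>set_pmf P. \<forall>v. x v = f v x u)"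
    using mk_mdag_support[OF P E pos] by (elim exE conjE)
  obtain u1 where u1: "\<forall>l. u1 l \<in> S l" "\<forall>v. triple 0 0 0 v = f v (triple 0 0 0) u1"
    using 1[rule_format, of "triple 0 0 0"] set by auto
  obtain u2 where u2: "\<forall>l. u2 l \<in> S l" "\<forall>v. triple 1 1 1 v = f v (triple 1 1 1) u2"
    using 1[rule_format, of "triple 1 1 1"] set by auto
  define u where "u l = (if Node_a \<in> l then u1 l else u2 l)" for l
  define u' where "u' l = (if Node_a \<in> l \<and> Node_b \<in> l then u1 l else u2 l)" for l
  have "\<forall>l. u l \<in> S l" using u1(1) u2(1) by (simp add: u_def)
  then obtain x where x: "x \<in> set_pmf P" "\<forall>v. x v = f v x u"
    using 2 by blast
  have "\<forall>l. u' l \<in> S l" using u1(1) u2(1) by (simp add: u'_def)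
  then obtain x' where x': "x' \<in> set_pmf P" "\<forall>v. x' v = f v x' u'"
    using 2 by blast
  have "x Node_a = triple 0 0 0 Node_a"
    by (rule mix_latents[OF loc x(2) u1(2)]) (auto simp: u_def)
  moreover have "x' Node_c = triple 1 1 1 Node_c"
    by (rule mix_latents[OF loc x'(2) u2(2)]) (auto simp: u'_def)
  moreover have "x Node_b = x' Node_b"
    by (rule mix_latents[OF loc x(2) x'(2)]) (auto simp: u_def u'_def)
  ultimately show False using x(1) x'(1) set by auto
qed

lemma exactly_one_not_in_triangle:
  assumes pos: "\<And>v. 0 < c v" and set: "set_pmf P = {triple 1 0 0, triple 0 1 0, triple 0 0 1}"
  shows "P \<notin> mdag_model (mk_mdag {} {AB, AC, BC}) c"
    (is "P \<notin> mdag_model (mk_mdag {} ?F) c")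
proof
  assume P: "P \<in> mdag_model (mk_mdag {} ?F) c"
  have E: "acyclic ({} :: abc rel)" by (simp add: acyclic_def)
  obtain f and S :: "abc set \<Rightarrow> nat set" where loc: "local_eqs {} (?F \<union> range (\<lambda>v. {v})) id f"
    and 1: "\<forall>x\<in>set_pmf P. \<exists>u. (\<forall>l. u l \<in> S l) \<and> (\<forall>v. x v = f v x u)"
    and 2: "\<forall>u. (\<forall>l. u l \<in> S l) \<longrightarrow> (\<exists>x\<in>set_pmf P. \<forall>v. x v = f v x u)"
    using mk_mdag_support[OF P E pos] by (elim exE conjE)
  obtain u1 where u1: "\<forall>l. u1 l \<in> S l" "\<forall>v. triple 1 0 0 v = f v (triple 1 0 0) u1"
    using 1[rule_format, of "triple 1 0 0"] set by auto
  obtain u2 where u2: "\<forall>l. u2 l \<in> S l" "\<forall>v. triple 0 1 0 v = f v (triple 0 1 0) u2"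
    using 1[rule_format, of "triple 0 1 0"] set by auto
  obtain u3 where u3: "\<forall>l. u3 l \<in> S l" "\<forall>v. triple 0 0 1 v = f v (triple 0 0 1) u3"
    using 1[rule_format, of "triple 0 0 1"] set by auto
  \<comment> \<open>Each private latent is fixed to the sample in which its node is 1, so a
    configuration is given by the origins of the latents on ab, ac and bc. The last one below, (2,
    1, 3), looks to a like (2, 1, 2), to b like (2, 3, 3) and to c like (1, 1, 3).\<close>
  define u where "u p q r l = (if l = {Node_a} then u1 l else if l = {Node_b} then u2 l
    else if l = {Node_c} then u3 l else if l = AB then p l
    else if l = AC then q l else r l)" for p q r :: "abc set \<Rightarrow> nat" and l
  have ex: "\<exists>x\<in>set_pmf P. \<forall>v. x v = f v x (u p q r)" if "p \<in> {u1, u2, u3}" "q \<in> {u1, u2, u3}" "r \<in> {u1, u2, u3}" for p q r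
  proof -
    have "p l \<in> S l" "q l \<in> S l" "r l \<in> S l" for l using that u1(1) u2(1) u3(1) by blast+
    then have "\<forall>l. u p q r l \<in> S l" using u1(1) u2(1) u3(1) by (simp add: u_def)
    then show ?thesis using 2 by blast
  qed
  have u_simps: "u p q r {Node_a} = u1 {Node_a}" "u p q r {Node_b} = u2 {Node_b}"
    "u p q r {Node_c} = u3 {Node_c}" "u p q r AB = p AB"
    "u p q r AC = q AC" "u p q r BC = r BC" for p q r
    by (simp_all add: u_def insert_eq_iff)
  \<comment> \<open>In each configuration below one node sees the latents of a sample where it equals 1, so the
    other two are 0; the last configuration then makes all three nodes 0.\<close>
  obtain x where x: "x \<in> set_pmf P" "\<forall>v. x v = f v x (u u1 u1 u3)" using ex[of u1 u1 u3] by blast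
  have "x Node_a = triple 1 0 0 Node_a"
    by (rule mix_latents[OF loc, where x = x and y = "triple 1 0 0", OF x(2) u1(2)]) (auto simp: u_simps)
  then have xc: "x Node_c = 0" using x(1) set by auto
  obtain y where y: "y \<in> set_pmf P" "\<forall>v. y v = f v y (u u2 u1 u2)" using ex[of u2 u1 u2] by blast
  have "y Node_b = triple 0 1 0 Node_b"
    by (rule mix_latents[OF loc, where x = y and y = "triple 0 1 0", OF y(2) u2(2)]) (auto simp: u_simps)
  then have ya: "y Node_a = 0" using y(1) set by auto
  obtain z where z: "z \<in> set_pmf P" "\<forall>v. z v = f v z (u u2 u3 u3)" using ex[of u2 u3 u3] by blast
  have "z Node_c = triple 0 0 1 Node_c"
    by (rule mix_latents[OF loc, where x = z and y = "triple 0 0 1", OF z(2) u3(2)]) (auto simp: u_simps)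
  then have zb: "z Node_b = 0" using z(1) set by auto
  obtain w where w: "w \<in> set_pmf P" "\<forall>v. w v = f v w (u u2 u1 u3)" using ex[of u2 u1 u3] by blast
  have "w Node_a = y Node_a" by (rule mix_latents[OF loc, where x = w and y = "y", OF w(2) y(2)]) (auto simp: u_simps)
  moreover have "w Node_b = z Node_b" by (rule mix_latents[OF loc, where x = w and y = "z", OF w(2) z(2)]) (auto simp: u_simps)
  moreover have "w Node_c = x Node_c" by (rule mix_latents[OF loc, where x = w and y = "x", OF w(2) x(2)]) (auto simp: u_simps)
  ultimately show False using w(1) set xc ya zb by auto
qed

section \<open>Distributions on three bits\<close>

lemma ab_correlation_in_model:
  "bits3 (1/2) (1/2) (1/2) (\<lambda>i j k. triple (of_bool i) (of_bool i) (0))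
    \<in> mdag_model (mk_mdag {ab} {AB}) (\<lambda>_. 2)"
proof (rule bits3_in_model[where A = "AB" and B = "{}" and C = "{}"
    and f = "\<lambda>v x i j k. case v of Node_a \<Rightarrow> of_bool i | Node_b \<Rightarrow> of_bool i | Node_c \<Rightarrow> 0"])
  show "acyclic {ab}" by (rule acyclic_abc[of Node_a Node_b Node_c]) auto
qed (auto simp: triple_def split: abc.split)

lemma ac_correlation_in_model:
  "bits3 (1/2) (1/2) (1/2) (\<lambda>i j k. triple (of_bool i) (0) (of_bool i))
    \<in> mdag_model (mk_mdag {ac} {AC}) (\<lambda>_. 2)"
proof (rule bits3_in_model[where A = "AC" and B = "{}" and C = "{}"
    and f = "\<lambda>v x i j k. case v of Node_a \<Rightarrow> of_bool i | Node_b \<Rightarrow> 0 | Node_c \<Rightarrow> of_bool i"])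
  show "acyclic {ac}" by (rule acyclic_abc[of Node_a Node_b Node_c]) auto
qed (auto simp: triple_def split: abc.split)

lemma bc_correlation_in_model:
  "bits3 (1/2) (1/2) (1/2) (\<lambda>i j k. triple (0) (of_bool i) (of_bool i))
    \<in> mdag_model (mk_mdag {bc} {BC}) (\<lambda>_. 2)"
proof (rule bits3_in_model[where A = "BC" and B = "{}" and C = "{}"
    and f = "\<lambda>v x i j k. case v of Node_a \<Rightarrow> 0 | Node_b \<Rightarrow> of_bool i | Node_c \<Rightarrow> of_bool i"])
  show "acyclic {bc}" by (rule acyclic_abc[of Node_a Node_b Node_c]) auto
qed (auto simp: triple_def split: abc.split)

lemma xor_in_b_independent_c:
  "bits3 (1/2) (1/2) (1/2) (\<lambda>i j k. triple (of_bool (i \<noteq> j)) (of_bool i) (of_bool j))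
    \<in> mdag_model (mk_mdag {} {AB, AC}) (\<lambda>_. 2)"
proof (rule bits3_in_model[where A = "AB" and B = "AC" and C = "{}"
    and f = "\<lambda>v x i j k. case v of Node_a \<Rightarrow> of_bool (i \<noteq> j) | Node_b \<Rightarrow> of_bool i | Node_c \<Rightarrow> of_bool j"])
  show "acyclic ({} :: abc rel)" by (rule acyclic_abc[of Node_a Node_b Node_c]) auto
qed (auto simp: triple_def split: abc.split)

lemma xor_in_a_independent_c:
  "bits3 (1/2) (1/2) (1/2) (\<lambda>i j k. triple (of_bool i) (of_bool (i \<noteq> j)) (of_bool j))
    \<in> mdag_model (mk_mdag {ab} {AB, BC}) (\<lambda>_. 2)"
proof (rule bits3_in_model[where A = "AB" and B = "BC" and C = "{}"
    and f = "\<lambda>v x i j k. case v of Node_a \<Rightarrow> of_bool i | Node_b \<Rightarrow> of_bool (i \<noteq> j) | Node_c \<Rightarrow> of_bool j"])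
  show "acyclic {ab}" by (rule acyclic_abc[of Node_a Node_b Node_c]) auto
qed (auto simp: triple_def split: abc.split)

text \<open>\<open>min 1\<close> keeps the mechanism below the cardinality 2 for arguments that are
  not bits; on bits it is the identity.\<close>

lemma ghz_in_fork:
  "bits3 (1/2) (1/2) (1/2) (\<lambda>i j k. triple (of_bool i) (of_bool i) (of_bool i))
    \<in> mdag_model (mk_mdag {ab, ac} {}) (\<lambda>_. 2)"
proof (rule bits3_in_model[where A = "{Node_a}" and B = "{}" and C = "{}"
    and f = "\<lambda>v x i j k. case v of Node_a \<Rightarrow> of_bool i | Node_b \<Rightarrow> min 1 (x Node_a) | Node_c \<Rightarrow> min 1 (x Node_a)"])
  show "acyclic {ab, ac}" by (rule acyclic_abc[of Node_a Node_b Node_c]) auto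
qed (auto simp: triple_def split: abc.split)

lemma ghz_in_chain:
  "bits3 (1/2) (1/2) (1/2) (\<lambda>i j k. triple (of_bool i) (of_bool i) (of_bool i))
    \<in> mdag_model (mk_mdag {ab, bc} {}) (\<lambda>_. 2)"
proof (rule bits3_in_model[where A = "{Node_a}" and B = "{}" and C = "{}"
    and f = "\<lambda>v x i j k. case v of Node_a \<Rightarrow> of_bool i | Node_b \<Rightarrow> min 1 (x Node_a) | Node_c \<Rightarrow> min 1 (x Node_b)"])
  show "acyclic {ab, bc}" by (rule acyclic_abc[of Node_a Node_b Node_c]) auto
qed (auto simp: triple_def split: abc.split)

text \<open>If a = 0 then b = c, and if a = 1 then c = 1 whatever b is: c combines the value of a
  with the bit j that it shares with a.\<close>

lemma instrument_b_witness_in_model: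
  "bits3 (1/2) (1/2) (1/2) (\<lambda>i j k. triple (of_bool (i \<noteq> j)) (of_bool i) (of_bool (i = j \<longrightarrow> j)))
    \<in> mdag_model (mk_mdag {ac} {AB, AC}) (\<lambda>_. 2)"
proof (rule bits3_in_model[where A = "AB" and B = "AC" and C = "{}"
    and f = "\<lambda>v x i j k. case v of Node_a \<Rightarrow> of_bool (i \<noteq> j) | Node_b \<Rightarrow> of_bool i | Node_c \<Rightarrow> of_bool (x Node_a = 0 \<longrightarrow> j)"])
  show "acyclic {ac}" by (rule acyclic_abc[of Node_a Node_b Node_c]) auto
qed (auto simp: triple_def split: abc.split)

lemma instrument_c_witness_in_model:
  "bits3 (1/2) (1/2) (1/2) (\<lambda>i j k. triple (of_bool (i \<noteq> j)) (of_bool (i = j \<longrightarrow> j)) (of_bool i))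
    \<in> mdag_model (mk_mdag {ab} {AB, AC}) (\<lambda>_. 2)"
proof (rule bits3_in_model[where A = "AC" and B = "AB" and C = "{}"
    and f = "\<lambda>v x i j k. case v of Node_a \<Rightarrow> of_bool (i \<noteq> j) | Node_b \<Rightarrow> of_bool (x Node_a = 0 \<longrightarrow> j) | Node_c \<Rightarrow> of_bool i"])
  show "acyclic {ab}" by (rule acyclic_abc[of Node_a Node_b Node_c]) auto
qed (auto simp: triple_def split: abc.split)

text \<open>On the lines below, the instrument \<open>i\<close> and two latent bits \<open>j\<close>, \<open>k\<close> determine the treatment,
  which is 0 iff \<open>k\<close> and \<open>i = j\<close>; the outcome is then \<open>j\<close>, hence equal to the instrument, and 0
  otherwise.\<close>

lemma line_in_instrument_c:
  "bits3 (1/2) (1/2) t (\<lambda>i j k. triple (of_bool (\<not> (k \<and> i = j))) (of_bool (k \<and> i = j \<and> j)) (of_bool i))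
    \<in> mdag_model (mk_mdag {ab} {AB, AC}) (\<lambda>_. 2)"
proof (rule bits3_in_model[where A = "AC" and B = "AB" and C = "AB"
    and f = "\<lambda>v x i j k. case v of Node_a \<Rightarrow> of_bool (\<not> (k \<and> i = j)) | Node_b \<Rightarrow> of_bool (x Node_a = 0 \<and> j) | Node_c \<Rightarrow> of_bool i"])
  show "acyclic {ab}" by (rule acyclic_abc[of Node_a Node_b Node_c]) auto
qed (auto simp: triple_def split: abc.split)

lemma line_in_instrument_b:
  "bits3 (1/2) (1/2) t (\<lambda>i j k. triple (of_bool (\<not> (k \<and> i = j))) (of_bool i) (of_bool (k \<and> i = j \<and> j)))
    \<in> mdag_model (mk_mdag {ac} {AB, AC}) (\<lambda>_. 2)"
proof (rule bits3_in_model[where A = "AB" and B = "AC" and C = "AC"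
    and f = "\<lambda>v x i j k. case v of Node_a \<Rightarrow> of_bool (\<not> (k \<and> i = j)) | Node_b \<Rightarrow> of_bool i | Node_c \<Rightarrow> of_bool (x Node_a = 0 \<and> j)"])
  show "acyclic {ac}" by (rule acyclic_abc[of Node_a Node_b Node_c]) auto
qed (auto simp: triple_def split: abc.split)

lemma line_in_instrument_a:
  "bits3 (1/2) (1/2) t (\<lambda>i j k. triple (of_bool i) (of_bool (\<not> (k \<and> i = j))) (of_bool (k \<and> i = j \<and> j)))
    \<in> mdag_model (mk_mdag {ab, bc} {AB, BC}) (\<lambda>_. 2)"
proof (rule bits3_in_model[where A = "AB" and B = "BC" and C = "BC"
    and f = "\<lambda>v x i j k. case v of Node_a \<Rightarrow> of_bool i | Node_b \<Rightarrow> of_bool (\<not> (k \<and> i = j)) | Node_c \<Rightarrow> of_bool (x Node_b = 0 \<and> j)"])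
  show "acyclic {ab, bc}" by (rule acyclic_abc[of Node_a Node_b Node_c]) auto
qed (auto simp: triple_def split: abc.split)

text \<open>The events \<open>i \<and> \<not> j\<close>, \<open>k \<and> \<not> i\<close>, \<open>j \<and> \<not> k\<close> are disjoint, and for independent bits of
  bias \<open>s\<close> each has probability \<open>s (1 - s)\<close>, at most 1/4.\<close>

lemma exactly_one_line_in_triangle:
  "bits3 s s s (\<lambda>i j k. triple (of_bool (i \<and> \<not> j)) (of_bool (k \<and> \<not> i)) (of_bool (j \<and> \<not> k)))
    \<in> mdag_model (mk_mdag {} {AB, AC, BC}) (\<lambda>_. 2)"
proof (rule bits3_in_model[where A = "AB" and B = "AC" and C = "BC"
    and f = "\<lambda>v x i j k. case v of Node_a \<Rightarrow> of_bool (i \<and> \<not> j) | Node_b \<Rightarrow> of_bool (k \<and> \<not> i) | Node_c \<Rightarrow> of_bool (j \<and> \<not> k)"])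
  show "acyclic ({} :: abc rel)" by (rule acyclic_abc[of Node_a Node_b Node_c]) auto
qed (auto simp: triple_def split: abc.split)

text \<open>The treatment is to be 0 with probability t, and \<open>i = j\<close> has probability
  1/2, hence the bias 2 t of \<open>k\<close> and the bound on t. As \<open>j\<close> is uniform,
  that event is independent of the instrument \<open>i\<close>. At t = 1/2 the instrumental
  inequality is tight.\<close>

lemma instrumental_line:
  assumes "0 \<le> t" "t \<le> 1/2"
  shows "mixture t (bits3 (1/2) (1/2) (1/2) (\<lambda>i j k. triple 1 0 (of_bool i)))
      (bits3 (1/2) (1/2) (1/2) (\<lambda>i j k. triple 0 (of_bool i) (of_bool i))) =
    bits3 (1/2) (1/2) (2 * t) (\<lambda>i j k. triple (of_bool (\<not> (k \<and> i = j))) (of_bool (k \<and> i = j \<and> j)) (of_bool i))"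
  and "mixture t (bits3 (1/2) (1/2) (1/2) (\<lambda>i j k. triple 1 (of_bool i) 0))
      (bits3 (1/2) (1/2) (1/2) (\<lambda>i j k. triple 0 (of_bool i) (of_bool i))) =
    bits3 (1/2) (1/2) (2 * t) (\<lambda>i j k. triple (of_bool (\<not> (k \<and> i = j))) (of_bool i) (of_bool (k \<and> i = j \<and> j)))"
  and "mixture t (bits3 (1/2) (1/2) (1/2) (\<lambda>i j k. triple (of_bool i) 1 0))
      (bits3 (1/2) (1/2) (1/2) (\<lambda>i j k. triple (of_bool i) 0 (of_bool i))) =
    bits3 (1/2) (1/2) (2 * t) (\<lambda>i j k. triple (of_bool i) (of_bool (\<not> (k \<and> i = j))) (of_bool (k \<and> i = j \<and> j)))"
  by (intro pmf_eqI; use assms in \<open>simp add: pmf_mixture pmf_bits3 field_simps del: pmf_return\<close>)+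

definition exactly_one :: "(abc \<Rightarrow> nat) pmf" where
  "exactly_one = bind_pmf (bernoulli_pmf (1/3)) (\<lambda>i. if i then return_pmf (triple 1 0 0)
     else bind_pmf (bernoulli_pmf (1/2)) (\<lambda>j. return_pmf (if j then triple 0 1 0 else triple 0 0 1)))"

lemma set_exactly_one: "set_pmf exactly_one = {triple 1 0 0, triple 0 1 0, triple 0 0 1}"
  by (auto simp: exactly_one_def UNIV_bool)

lemma exactly_one_line:
  assumes t: "0 \<le> t" "t \<le> 3/4"
  obtains s where "mixture t (return_pmf (triple 0 0 0)) exactly_one =
    bits3 s s s (\<lambda>i j k. triple (of_bool (i \<and> \<not> j)) (of_bool (k \<and> \<not> i)) (of_bool (j \<and> \<not> k)))"
proof -
  \<comment> \<open>Together the three disjoint events must have probability t. So \<open>s\<close>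
    is the smaller root of 3 s (1 - s) = t, which is real up to t = 3/4.\<close>
  define r where "r = sqrt (1 - 4 * t / 3)"
  define s where "s = (1 - r) / 2"
  have r: "0 \<le> r" "r \<le> 1" "r\<^sup>2 = 1 - 4 * t / 3" using t by (simp_all add: r_def)
  have s: "0 \<le> s" "s \<le> 1" using r by (simp_all add: s_def)
  have "s * (1 - s) = (1 - r\<^sup>2) / 4" by (simp add: s_def power2_eq_square field_simps)
  then have t_eq: "t = 3 * (s * (1 - s))" unfolding r(3) by simp
  have "mixture t (return_pmf (triple 0 0 0)) exactly_one =
    bits3 s s s (\<lambda>i j k. triple (of_bool (i \<and> \<not> j)) (of_bool (k \<and> \<not> i)) (of_bool (j \<and> \<not> k)))"
    (is "?M = ?B")
  proof (rule pmf_eqI)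
    fix i
    have "pmf ?M i = pmf (return_pmf (triple 0 0 0)) i + t * (pmf exactly_one i - pmf (return_pmf (triple 0 0 0)) i)"
      by (rule pmf_mixture) (use t in auto)
    also have "\<dots> = pmf ?B i"
      unfolding t_eq using s
      by (simp add: pmf_bits3 exactly_one_def pmf_bind_bernoulli algebra_simps del: pmf_return)
    finally show "pmf ?M i = pmf ?B i" .
  qed
  then show thesis by (rule that)
qed

section \<open>Rule applications on three nodes\<close>

abbreviation (input) "reach \<equiv> (dominance_step ABC)\<^sup>*\<^sup>*"

text \<open>Besides (a, b, c), these are the node orders used by the chains below: (b, a, c), (b, c,
  a) and (a, c, b).\<close>

definition ordered_edges :: "abc rel \<Rightarrow> bool" where
  "ordered_edges E \<longleftrightarrow> E \<subseteq> {ab, ac, bc} \<or> E \<subseteq> {(Node_b, Node_a), bc, ac} \<or>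
     E \<subseteq> {bc, (Node_b, Node_a), (Node_c, Node_a)} \<or> E \<subseteq> {ac, ab, (Node_c, Node_b)}"

lemma acyclic_ordered_edges: "ordered_edges E \<Longrightarrow> acyclic E"
  unfolding ordered_edges_def
  using acyclic_abc[of Node_a Node_b Node_c E] acyclic_abc[of Node_b Node_a Node_c E]
    acyclic_abc[of Node_b Node_c Node_a E] acyclic_abc[of Node_a Node_c Node_b E]
  by (simp add: insert_commute) blast

lemma is_mdag_abc: "ordered_edges E \<Longrightarrow> is_mdag (mk_mdag E F)"
  by (rule is_mdag_mk_mdag[OF acyclic_ordered_edges])

lemma reach_structural:
  assumes "ordered_edges E" "E' \<subseteq> E" "\<forall>B\<in>F'. \<exists>B'\<in>F. B \<subseteq> B'"
  shows "reach (mk_mdag E F) (mk_mdag E' F')"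
proof -
  have "is_mdag (mk_mdag E F)" "is_mdag (mk_mdag E' F')"
    using is_mdag_mk_mdag acyclic_ordered_edges[OF assms(1)] acyclic_subset assms(2) by metis+
  moreover have "A \<in> faces (mk_mdag E F)" if "A \<in> faces (mk_mdag E' F')" for A
    using assms(3) that unfolding mk_mdag_simps mem_Collect_eq by (meson order_trans)
  then have "structural_dominance (mk_mdag E F) (mk_mdag E' F')"
    using assms(2) unfolding structural_dominance_def by (simp only: mk_mdag_simps(1,2)) blast
  ultimately have "dominance_step ABC (mk_mdag E F) (mk_mdag E' F')"
    unfolding dominance_step_def mk_mdag_simps(1) UNIV_abc by blast
  then show ?thesis by (rule r_into_rtranclp)
qed

lemma facets_mk_mdag:
  assumes "A \<in> facets (mk_mdag E F)" "x \<in> A" "B \<in> F" "x \<in> B"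
  shows "A \<in> F"
proof -
  consider v where "A \<subseteq> {v}" | B' where "B' \<in> F" "A \<subseteq> B'"
    using assms by (auto simp: facets_def)
  then show ?thesis
  proof cases
    case 1
    then have "A \<subseteq> B" using assms by auto
    then show ?thesis using assms by (auto simp: facets_def)
  next
    case 2
    then show ?thesis using assms by (auto simp: facets_def)
  qed
qed

text \<open>Some generator has to contain \<open>x\<close>: otherwise \<open>{x}\<close> would be a
  facet of its own, and it does not contain \<open>y\<close>.\<close>

lemma reach_hlp:
  assumes "ordered_edges E" "ordered_edges E'" "E' = insert (x, y) E"
    "\<forall>u. (u, x) \<in> E \<longrightarrow> (u, y) \<in> E" "\<exists>B\<in>F. x \<in> B" "\<forall>B\<in>F. x \<in> B \<longrightarrow> y \<in> B"
  shows "reach (mk_mdag E F) (mk_mdag E' F)"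
proof -
  obtain B where B: "B \<in> F" "x \<in> B" using assms(5) by blast
  have 1: "\<forall>A\<in>facets (mk_mdag E F). x \<in> A \<longrightarrow> y \<in> A"
    using facets_mk_mdag[OF _ _ B] assms(6) by blast
  have 2: "parents (edges (mk_mdag E F)) {x} \<subseteq> parents (edges (mk_mdag E F)) {y}"
    using assms(4) by (simp add: parents_def subset_iff)
  have 3: "mk_mdag E' F = (mk_mdag E F)\<lparr>edges := insert (x, y) (edges (mk_mdag E F))\<rparr>"
    by (simp add: mk_mdag_def assms(3))
  have "hlp_edge_adding (mk_mdag E F) (mk_mdag E' F)"
    unfolding hlp_edge_adding_def mk_mdag_simps(1) using 1 2 3 by (metis UNIV_I)
  then have "dominance_step ABC (mk_mdag E F) (mk_mdag E' F)"
    unfolding dominance_step_def mk_mdag_simps(1) UNIV_abc using is_mdag_abc assms(1,2) by blast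
  then show ?thesis by (rule r_into_rtranclp)
qed

text \<open>Instances of the rule in which \<open>C\<close> is a single node suffice for all
  chains.\<close>

lemma reach_weak_facet:
  assumes "ordered_edges E" "x \<notin> D" "(\<exists>v. D \<subseteq> {v}) \<or> D \<in> F" "\<forall>B\<in>F. x \<notin> B"
    "\<forall>d\<in>D. (x, d) \<in> E \<and> (\<forall>u. (u, x) \<in> E \<longrightarrow> (u, d) \<in> E)" "A = insert x D"
  shows "reach (mk_mdag E F) (mk_mdag E (insert A F))"
proof -
  have 1: "mk_mdag E (insert A F) = (mk_mdag E F)\<lparr>faces := faces (mk_mdag E F) \<union> Pow ({x} \<union> D)\<rparr>"
    using assms(6) by (auto simp: mk_mdag_def)
  have 2: "\<forall>d\<in>D. parents (edges (mk_mdag E F)) {x} \<union> {x} \<subseteq> parents (edges (mk_mdag E F)) {d}"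
    using assms(5) by (auto simp: parents_def)
  have 3: "\<forall>A\<in>faces (mk_mdag E F). A \<inter> {x} \<noteq> {} \<longrightarrow> A \<subseteq> {x}"
    using assms(4) unfolding mk_mdag_simps by blast
  have 4: "{x} \<in> faces (mk_mdag E F)" "D \<in> faces (mk_mdag E F)" "{x} \<inter> D = {}"
    using assms(2,3) by auto
  have "weak_facet_adding (mk_mdag E F) (mk_mdag E (insert A F))"
    unfolding weak_facet_adding_def
    by (rule bexI[OF bexI[OF _ 4(2)] 4(1)]) (intro conjI 4(3) 1 2 3)
  then have "dominance_step ABC (mk_mdag E F) (mk_mdag E (insert A F))"
    unfolding dominance_step_def mk_mdag_simps(1) UNIV_abc using is_mdag_abc assms(1) by blast
  then show ?thesis by (rule r_into_rtranclp)
qed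

definition has_face :: "abc set set \<Rightarrow> abc set \<Rightarrow> bool" where
  "has_face F A \<longleftrightarrow> (\<exists>B\<in>F. A \<subseteq> B)"

lemma reach_above:
  assumes "ordered_edges E" "E' \<subseteq> E" "\<forall>B\<in>F'. has_face F B" "reach (mk_mdag E' F') H"
  shows "reach (mk_mdag E F) H"
  using reach_structural[OF assms(1,2)] assms(3,4) by (metis has_face_def rtranclp_trans)

lemma reach_step_hlp:
  assumes "reach (mk_mdag (insert (x, y) E) F) H" "ordered_edges E" "ordered_edges (insert (x, y) E)"
    "\<forall>u. (u, x) \<in> E \<longrightarrow> (u, y) \<in> E" "\<exists>B\<in>F. x \<in> B" "\<forall>B\<in>F. x \<in> B \<longrightarrow> y \<in> B"
  shows "reach (mk_mdag E F) H"
  using reach_hlp[OF assms(2,3) refl assms(4-6)] assms(1) by (rule rtranclp_trans)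

lemma reach_step_weak:
  assumes "reach (mk_mdag E (insert (insert x D) F)) H" "ordered_edges E" "x \<notin> D"
    "(\<exists>v. D \<subseteq> {v}) \<or> D \<in> F" "\<forall>B\<in>F. x \<notin> B"
    "\<forall>d\<in>D. (x, d) \<in> E \<and> (\<forall>u. (u, x) \<in> E \<longrightarrow> (u, d) \<in> E)"
  shows "reach (mk_mdag E F) H"
  using reach_weak_facet[OF assms(2-6) refl] assms(1) by (rule rtranclp_trans)

lemma reach_final:
  assumes "ordered_edges E" "E' \<subseteq> E" "\<forall>B\<in>F'. has_face F B"
  shows "reach (mk_mdag E F) (mk_mdag E' F')"
  by (rule reach_above[OF assms rtranclp.rtrancl_refl])

lemmas edge_simps = ordered_edges_def has_face_def

section \<open>Chains of rule applications into the representatives\<close>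

lemma chain1_latent: "reach (mk_mdag {} {AB}) (mk_mdag {ab} {AB})"
  by (rule reach_step_hlp[of Node_a Node_b],
    rule reach_final)
    (auto simp: edge_simps)


lemma chain1_edge: "reach (mk_mdag {ab} {}) (mk_mdag {ab} {AB})"
  by (rule reach_step_weak[of _ Node_a "{Node_b}"],
    rule reach_final)
    (auto simp: edge_simps)


lemma chain2_latent: "reach (mk_mdag {} {AC}) (mk_mdag {ac} {AC})"
  by (rule reach_step_hlp[of Node_a Node_c],
    rule reach_final)
    (auto simp: edge_simps)


lemma chain2_edge: "reach (mk_mdag {ac} {}) (mk_mdag {ac} {AC})"
  by (rule reach_step_weak[of _ Node_a "{Node_c}"],
    rule reach_final)
    (auto simp: edge_simps)


lemma chain3_latent: "reach (mk_mdag {} {BC}) (mk_mdag {bc} {BC})"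
  by (rule reach_step_hlp[of Node_b Node_c],
    rule reach_final)
    (auto simp: edge_simps)


lemma chain3_edge: "reach (mk_mdag {bc} {}) (mk_mdag {bc} {BC})"
  by (rule reach_step_weak[of _ Node_b "{Node_c}"],
    rule reach_final)
    (auto simp: edge_simps)


lemma chain5_latent: "reach (mk_mdag {} {AB, BC}) (mk_mdag {ab} {AB, BC})"
  by (rule reach_step_hlp[of Node_a Node_b],
    rule reach_final)
    (auto simp: edge_simps)


lemma chain5_edge: "reach (mk_mdag {ab} {BC}) (mk_mdag {ab} {AB, BC})"
  by (rule reach_step_weak[of _ Node_a "{Node_b}"],
    rule reach_final)
    (auto simp: edge_simps)


lemma chain6_edges: "reach (mk_mdag {ac, bc} {}) (mk_mdag {ac, bc} {AC, BC})"
  by (rule reach_step_weak[of _ Node_a "{Node_c}"],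
    rule reach_step_weak[of _ Node_b "{Node_c}"],
    rule reach_final)
    (auto simp: edge_simps)


lemma chain6_edge_ac: "reach (mk_mdag {ac} {BC}) (mk_mdag {ac, bc} {AC, BC})"
  by (rule reach_step_hlp[of Node_b Node_c],
    rule reach_above[of _ "{ac, bc}" "{}", rotated 3],
    rule chain6_edges)
    (auto simp: edge_simps)


lemma chain6_edge_bc: "reach (mk_mdag {bc} {AC}) (mk_mdag {ac, bc} {AC, BC})"
  by (rule reach_step_hlp[of Node_a Node_c],
    rule reach_above[of _ "{ac, bc}" "{}", rotated 3],
    rule chain6_edges)
    (auto simp: edge_simps)


lemma chain6_latent: "reach (mk_mdag {} {AC, BC}) (mk_mdag {ac, bc} {AC, BC})"
  by (rule reach_step_hlp[of Node_b Node_c],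
    rule reach_step_hlp[of Node_a Node_c],
    rule reach_final)
    (auto simp: edge_simps)


text \<open>The order matters: BC must be a face before a is joined to it, because once a lies in a
  face with another node, the rule with C = {a} is blocked.\<close>

lemma chain8_edges: "reach (mk_mdag {ab, ac, bc} {}) (mk_mdag {ab, ac, bc} {ABC})"
  by (rule reach_step_weak[of _ Node_b "{Node_c}"],
    rule reach_step_weak[of _ Node_a "BC"],
    rule reach_final)
    (auto simp: edge_simps)


text \<open>The edges out of a come first, so that every parent of b is a parent of c when b
  \<rightarrow> c is added.\<close>

lemma chain8_latent: "reach (mk_mdag {} {ABC}) (mk_mdag {ab, ac, bc} {ABC})"
  by (rule reach_step_hlp[of Node_a Node_b],
    rule reach_step_hlp[of Node_a Node_c],
    rule reach_step_hlp[of Node_b Node_c],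
    rule reach_final)
    (auto simp: edge_simps)


lemma chain8_ab_ac: "reach (mk_mdag {ab, ac} {BC}) (mk_mdag {ab, ac, bc} {ABC})"
  by (rule reach_step_hlp[of Node_b Node_c],
    rule reach_above[of _ "{ab, ac, bc}" "{}", rotated 3],
    rule chain8_edges)
    (auto simp: edge_simps)


lemma chain8_ab: "reach (mk_mdag {ab} {AC, BC}) (mk_mdag {ab, ac, bc} {ABC})"
  by (rule reach_step_hlp[of Node_a Node_c],
    rule reach_above[of _ "{ab, ac}" "{BC}", rotated 3],
    rule chain8_ab_ac)
    (auto simp: edge_simps)


lemma chain8_ac: "reach (mk_mdag {ac} {AB, BC}) (mk_mdag {ab, ac, bc} {ABC})"
  by (rule reach_step_hlp[of Node_a Node_b],
    rule reach_above[of _ "{ab, ac}" "{BC}", rotated 3],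
    rule chain8_ab_ac)
    (auto simp: edge_simps)


lemma chain8_ab_bc: "reach (mk_mdag {ab, bc} {AC}) (mk_mdag {ab, ac, bc} {ABC})"
  by (rule reach_step_hlp[of Node_a Node_c],
    rule reach_above[of _ "{ab, ac, bc}" "{}", rotated 3],
    rule chain8_edges)
    (auto simp: edge_simps)


lemma chain8_ac_bc: "reach (mk_mdag {ac, bc} {AB}) (mk_mdag {ab, ac, bc} {ABC})"
  by (rule reach_step_hlp[of Node_a Node_b],
    rule reach_above[of _ "{ab, ac, bc}" "{}", rotated 3],
    rule chain8_edges)
    (auto simp: edge_simps)


text \<open>This chain leaves the ordering. The faces AB and AC are traded for b \<rightarrow> a and
  a \<rightarrow> c, which completes the DAG in the order (b, a, c); the full facet is built there,
  and then all edges are dropped and replaced by those of the original order.\<close>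

lemma chain8_bc: "reach (mk_mdag {bc} {AB, AC}) (mk_mdag {ab, ac, bc} {ABC})"
  by (rule reach_step_hlp[of Node_b Node_a],
    rule reach_above[of _ "{(Node_b, Node_a), bc}" "{AC}", rotated 3],
    rule reach_step_hlp[of Node_a Node_c],
    rule reach_above[of _ "{(Node_b, Node_a), ac, bc}" "{}", rotated 3],
    rule reach_step_weak[of _ Node_a "{Node_c}"],
    rule reach_step_weak[of _ Node_b "AC"],
    rule reach_above[of _ "{}" "{ABC}", rotated 3],
    rule chain8_latent)
    (auto simp: edge_simps)


lemma chain9_ab: "reach (mk_mdag {ab} {AC}) (mk_mdag {ab, ac} {})"
  by (rule reach_step_hlp[of Node_a Node_c],
    rule reach_final)
    (auto simp: edge_simps)


lemma chain9_ac: "reach (mk_mdag {ac} {AB}) (mk_mdag {ab, ac} {})"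
  by (rule reach_step_hlp[of Node_a Node_b],
    rule reach_final)
    (auto simp: edge_simps)


text \<open>AB and AC can each be added, but adding one blocks the rule for the other. This class
  therefore has two maximal members and is represented without faces.\<close>

lemma chain9_AB: "reach (mk_mdag {ab, ac} {}) (mk_mdag {ab, ac} {AB})"
  by (rule reach_step_weak[of _ Node_a "{Node_b}"],
    rule reach_final)
    (auto simp: edge_simps)


lemma chain9_AC: "reach (mk_mdag {ab, ac} {}) (mk_mdag {ab, ac} {AC})"
  by (rule reach_step_weak[of _ Node_a "{Node_c}"],
    rule reach_final)
    (auto simp: edge_simps)


lemma chain12_latent: "reach (mk_mdag {bc} {AB}) (mk_mdag {ab, bc} {})"
  by (rule reach_step_hlp[of Node_a Node_b],
    rule reach_final)
    (auto simp: edge_simps)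


lemma chain12_AB: "reach (mk_mdag {ab, bc} {}) (mk_mdag {ab, bc} {AB})"
  by (rule reach_step_weak[of _ Node_a "{Node_b}"],
    rule reach_final)
    (auto simp: edge_simps)


lemma chain13_latent: "reach (mk_mdag {bc} {AB, BC}) (mk_mdag {ab, bc} {AB, BC})"
  by (rule reach_step_hlp[of Node_a Node_b],
    rule reach_final)
    (auto simp: edge_simps)


lemma chain13_edge: "reach (mk_mdag {ab, bc} {BC}) (mk_mdag {ab, bc} {AB, BC})"
  by (rule reach_step_weak[of _ Node_a "{Node_b}"],
    rule reach_final)
    (auto simp: edge_simps)


text \<open>The collider b \<rightarrow> a \<leftarrow> c is an unconfounded form outside the
  ordering; it serves to show that this class is algebraic.\<close>

lemma chain4_to_network: "reach (mk_mdag {} {AB, AC}) (mk_mdag {(Node_b, Node_a), (Node_c, Node_a)} {})"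
  by (rule reach_step_hlp[of Node_b Node_a],
    rule reach_step_hlp[of Node_c Node_a],
    rule reach_final)
    (auto simp: edge_simps)


lemma chain4_from_network: "reach (mk_mdag {(Node_b, Node_a), (Node_c, Node_a)} {}) (mk_mdag {} {AB, AC})"
  by (rule reach_step_weak[of _ Node_b "{Node_a}"],
    rule reach_step_weak[of _ Node_c "{Node_a}"],
    rule reach_final)
    (auto simp: edge_simps)


lemma chain5_to_network: "reach (mk_mdag {ab} {AB, BC}) (mk_mdag {ab, (Node_c, Node_b)} {})"
  by (rule reach_step_hlp[of Node_c Node_b],
    rule reach_final)
    (auto simp: edge_simps)


lemma chain5_from_network: "reach (mk_mdag {ab, (Node_c, Node_b)} {}) (mk_mdag {ab} {AB, BC})"
  by (rule reach_step_weak[of _ Node_c "{Node_b}"],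
    rule reach_step_weak[of _ Node_a "{Node_b}"],
    rule reach_final)
    (auto simp: edge_simps)

section \<open>Classification\<close>

lemmas reach_refl = rtranclp.rtrancl_refl[of "dominance_step ABC"]

lemma reach_rep0:
  assumes "E \<subseteq> {ab, ac, bc}"
  shows "reach (mk_mdag E F) (mk_mdag {} {})"
  by (rule reach_above[OF _ _ _ reach_refl]) (use assms in \<open>auto simp: ordered_edges_def\<close>)

lemma reach_rep1:
  assumes "E \<subseteq> {ab, ac, bc}" "(ab \<in> E \<or> has_face F AB)"
  shows "reach (mk_mdag E F) (mk_mdag {ab} {AB})"
proof -
  consider "ab \<in> E" | "has_face F AB"
    using assms(2) by blast
  then show ?thesis
  proof cases
    case 1
    then show ?thesis
      by (intro reach_above[OF _ _ _ chain1_edge]) (use assms in \<open>auto simp: ordered_edges_def\<close>)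
  next
    case 2
    then show ?thesis
      by (intro reach_above[OF _ _ _ chain1_latent]) (use assms in \<open>auto simp: ordered_edges_def\<close>)
  qed
qed

lemma reach_rep2:
  assumes "E \<subseteq> {ab, ac, bc}" "(ac \<in> E \<or> has_face F AC)"
  shows "reach (mk_mdag E F) (mk_mdag {ac} {AC})"
proof -
  consider "ac \<in> E" | "has_face F AC"
    using assms(2) by blast
  then show ?thesis
  proof cases
    case 1
    then show ?thesis
      by (intro reach_above[OF _ _ _ chain2_edge]) (use assms in \<open>auto simp: ordered_edges_def\<close>)
  next
    case 2
    then show ?thesis
      by (intro reach_above[OF _ _ _ chain2_latent]) (use assms in \<open>auto simp: ordered_edges_def\<close>)
  qed
qed

lemma reach_rep3:
  assumes "E \<subseteq> {ab, ac, bc}" "(bc \<in> E \<or> has_face F BC)"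
  shows "reach (mk_mdag E F) (mk_mdag {bc} {BC})"
proof -
  consider "bc \<in> E" | "has_face F BC"
    using assms(2) by blast
  then show ?thesis
  proof cases
    case 1
    then show ?thesis
      by (intro reach_above[OF _ _ _ chain3_edge]) (use assms in \<open>auto simp: ordered_edges_def\<close>)
  next
    case 2
    then show ?thesis
      by (intro reach_above[OF _ _ _ chain3_latent]) (use assms in \<open>auto simp: ordered_edges_def\<close>)
  qed
qed

lemma reach_rep4:
  assumes "E \<subseteq> {ab, ac, bc}" "has_face F AB \<and> has_face F AC"
  shows "reach (mk_mdag E F) (mk_mdag {} {AB, AC})"
  by (rule reach_above[OF _ _ _ reach_refl]) (use assms in \<open>auto simp: ordered_edges_def\<close>)

lemma reach_rep5:
  assumes "E \<subseteq> {ab, ac, bc}" "(ab \<in> E \<or> has_face F AB) \<and> has_face F BC"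
  shows "reach (mk_mdag E F) (mk_mdag {ab} {AB, BC})"
proof -
  consider "ab \<in> E" | "has_face F AB"
    using assms(2) by blast
  then show ?thesis
  proof cases
    case 1
    then show ?thesis
      by (intro reach_above[OF _ _ _ chain5_edge]) (use assms in \<open>auto simp: ordered_edges_def\<close>)
  next
    case 2
    then show ?thesis
      by (intro reach_above[OF _ _ _ chain5_latent]) (use assms in \<open>auto simp: ordered_edges_def\<close>)
  qed
qed

lemma reach_rep6:
  assumes "E \<subseteq> {ab, ac, bc}" "(ac \<in> E \<or> has_face F AC) \<and> (bc \<in> E \<or> has_face F BC)"
  shows "reach (mk_mdag E F) (mk_mdag {ac, bc} {AC, BC})"
proof -
  consider "ac \<in> E \<and> bc \<in> E" | "ac \<in> E \<and> has_face F BC" | "bc \<in> E \<and> has_face F AC" | "has_face F AC \<and> has_face F BC"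
    using assms(2) by blast
  then show ?thesis
  proof cases
    case 1
    then show ?thesis
      by (intro reach_above[OF _ _ _ chain6_edges]) (use assms in \<open>auto simp: ordered_edges_def\<close>)
  next
    case 2
    then show ?thesis
      by (intro reach_above[OF _ _ _ chain6_edge_ac]) (use assms in \<open>auto simp: ordered_edges_def\<close>)
  next
    case 3
    then show ?thesis
      by (intro reach_above[OF _ _ _ chain6_edge_bc]) (use assms in \<open>auto simp: ordered_edges_def\<close>)
  next
    case 4
    then show ?thesis
      by (intro reach_above[OF _ _ _ chain6_latent]) (use assms in \<open>auto simp: ordered_edges_def\<close>)
  qed
qed

lemma reach_rep7:
  assumes "E \<subseteq> {ab, ac, bc}" "has_face F AB \<and> has_face F AC \<and> has_face F BC"
  shows "reach (mk_mdag E F) (mk_mdag {} {AB, AC, BC})"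
  by (rule reach_above[OF _ _ _ reach_refl]) (use assms in \<open>auto simp: ordered_edges_def\<close>)

lemma reach_rep8:
  assumes "E \<subseteq> {ab, ac, bc}" "(ab \<in> E \<or> has_face F AB) \<and> (ac \<in> E \<or> has_face F AC) \<and> (bc \<in> E \<or> has_face F BC) \<and> (ab \<in> E \<or> ac \<in> E \<or> bc \<in> E) \<or> has_face F ABC"
  shows "reach (mk_mdag E F) (mk_mdag {ab, ac, bc} {ABC})"
proof -
  \<comment> \<open>After the full facet, the cases are the seven nonempty sets of edges, the
    remaining pairs being joined by faces.\<close>
  consider "has_face F ABC" | "ab \<in> E \<and> ac \<in> E \<and> bc \<in> E" | "ab \<in> E \<and> ac \<in> E \<and> has_face F BC" | "ab \<in> E \<and> bc \<in> E \<and> has_face F AC" | "ac \<in> E \<and> bc \<in> E \<and> has_face F AB" | "ab \<in> E \<and> has_face F AC \<and> has_face F BC" | "ac \<in> E \<and> has_face F AB \<and> has_face F BC" | "bc \<in> E \<and> has_face F AB \<and> has_face F AC"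
    using assms(2) by blast
  then show ?thesis
  proof cases
    case 1
    then show ?thesis
      by (intro reach_above[OF _ _ _ chain8_latent]) (use assms in \<open>auto simp: ordered_edges_def\<close>)
  next
    case 2
    then show ?thesis
      by (intro reach_above[OF _ _ _ chain8_edges]) (use assms in \<open>auto simp: ordered_edges_def\<close>)
  next
    case 3
    then show ?thesis
      by (intro reach_above[OF _ _ _ chain8_ab_ac]) (use assms in \<open>auto simp: ordered_edges_def\<close>)
  next
    case 4
    then show ?thesis
      by (intro reach_above[OF _ _ _ chain8_ab_bc]) (use assms in \<open>auto simp: ordered_edges_def\<close>)
  next
    case 5
    then show ?thesis
      by (intro reach_above[OF _ _ _ chain8_ac_bc]) (use assms in \<open>auto simp: ordered_edges_def\<close>)
  next
    case 6
    then show ?thesis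
      by (intro reach_above[OF _ _ _ chain8_ab]) (use assms in \<open>auto simp: ordered_edges_def\<close>)
  next
    case 7
    then show ?thesis
      by (intro reach_above[OF _ _ _ chain8_ac]) (use assms in \<open>auto simp: ordered_edges_def\<close>)
  next
    case 8
    then show ?thesis
      by (intro reach_above[OF _ _ _ chain8_bc]) (use assms in \<open>auto simp: ordered_edges_def\<close>)
  qed
qed

lemma reach_rep9:
  assumes "E \<subseteq> {ab, ac, bc}" "(ab \<in> E \<or> has_face F AB) \<and> (ac \<in> E \<or> has_face F AC) \<and> (ab \<in> E \<or> ac \<in> E)"
  shows "reach (mk_mdag E F) (mk_mdag {ab, ac} {})"
proof -
  consider "ab \<in> E \<and> ac \<in> E" | "ab \<in> E \<and> has_face F AC" | "ac \<in> E \<and> has_face F AB"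
    using assms(2) by blast
  then show ?thesis
  proof cases
    case 1
    then show ?thesis
      by (intro reach_above[OF _ _ _ reach_refl]) (use assms in \<open>auto simp: ordered_edges_def\<close>)
  next
    case 2
    then show ?thesis
      by (intro reach_above[OF _ _ _ chain9_ab]) (use assms in \<open>auto simp: ordered_edges_def\<close>)
  next
    case 3
    then show ?thesis
      by (intro reach_above[OF _ _ _ chain9_ac]) (use assms in \<open>auto simp: ordered_edges_def\<close>)
  qed
qed

lemma reach_rep10:
  assumes "E \<subseteq> {ab, ac, bc}" "ab \<in> E \<and> has_face F AB \<and> has_face F AC"
  shows "reach (mk_mdag E F) (mk_mdag {ab} {AB, AC})"
  by (rule reach_above[OF _ _ _ reach_refl]) (use assms in \<open>auto simp: ordered_edges_def\<close>)

lemma reach_rep11: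
  assumes "E \<subseteq> {ab, ac, bc}" "ac \<in> E \<and> has_face F AB \<and> has_face F AC"
  shows "reach (mk_mdag E F) (mk_mdag {ac} {AB, AC})"
  by (rule reach_above[OF _ _ _ reach_refl]) (use assms in \<open>auto simp: ordered_edges_def\<close>)

lemma reach_rep12:
  assumes "E \<subseteq> {ab, ac, bc}" "(ab \<in> E \<or> has_face F AB) \<and> bc \<in> E"
  shows "reach (mk_mdag E F) (mk_mdag {ab, bc} {})"
proof -
  consider "ab \<in> E" | "has_face F AB"
    using assms(2) by blast
  then show ?thesis
  proof cases
    case 1
    then show ?thesis
      by (intro reach_above[OF _ _ _ reach_refl]) (use assms in \<open>auto simp: ordered_edges_def\<close>)
  next
    case 2
    then show ?thesis
      by (intro reach_above[OF _ _ _ chain12_latent]) (use assms in \<open>auto simp: ordered_edges_def\<close>)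
  qed
qed

lemma reach_rep13:
  assumes "E \<subseteq> {ab, ac, bc}" "(ab \<in> E \<or> has_face F AB) \<and> bc \<in> E \<and> has_face F BC"
  shows "reach (mk_mdag E F) (mk_mdag {ab, bc} {AB, BC})"
proof -
  consider "ab \<in> E" | "has_face F AB"
    using assms(2) by blast
  then show ?thesis
  proof cases
    case 1
    then show ?thesis
      by (intro reach_above[OF _ _ _ chain13_edge]) (use assms in \<open>auto simp: ordered_edges_def\<close>)
  next
    case 2
    then show ?thesis
      by (intro reach_above[OF _ _ _ chain13_latent]) (use assms in \<open>auto simp: ordered_edges_def\<close>)
  qed
qed

lemma reach_rep14:
  assumes "E \<subseteq> {ab, ac, bc}" "ab \<in> E \<and> ac \<in> E \<and> has_face F AB \<and> has_face F AC"
  shows "reach (mk_mdag E F) (mk_mdag {ab, ac} {AB, AC})"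
  by (rule reach_above[OF _ _ _ reach_refl]) (use assms in \<open>auto simp: ordered_edges_def\<close>)

section \<open>The fifteen representatives and the order between them\<close>

definition reps :: "abc mdag list" where
  "reps = [mk_mdag {} {},
     mk_mdag {ab} {AB},
     mk_mdag {ac} {AC},
     mk_mdag {bc} {BC},
     mk_mdag {} {AB, AC},
     mk_mdag {ab} {AB, BC},
     mk_mdag {ac, bc} {AC, BC},
     mk_mdag {} {AB, AC, BC},
     mk_mdag {ab, ac, bc} {ABC},
     mk_mdag {ab, ac} {},
     mk_mdag {ab} {AB, AC},
     mk_mdag {ac} {AB, AC},
     mk_mdag {ab, bc} {},
     mk_mdag {ab, bc} {AB, BC},
     mk_mdag {ab, ac} {AB, AC}]"

text \<open>\<open>below ! i\<close> lists the indices of the representatives dominated by \<open>reps ! i\<close>.\<close>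

definition below :: "nat list list" where
  "below = [[0],
     [0, 1],
     [0, 2],
     [0, 3],
     [0, 1, 2, 4],
     [0, 1, 3, 5],
     [0, 2, 3, 6],
     [0, 1, 2, 3, 4, 5, 6, 7],
     [0, 1, 2, 3, 4, 5, 6, 7, 8, 9, 10, 11, 12, 13, 14],
     [0, 1, 2, 9],
     [0, 1, 2, 4, 9, 10],
     [0, 1, 2, 4, 9, 11],
     [0, 1, 3, 12],
     [0, 1, 3, 5, 12, 13],
     [0, 1, 2, 4, 9, 10, 11, 14]]"

lemma nth_reps:
  "reps ! 0 = mk_mdag {} {}"
  "reps ! 1 = mk_mdag {ab} {AB}"
  "reps ! 2 = mk_mdag {ac} {AC}"
  "reps ! 3 = mk_mdag {bc} {BC}"
  "reps ! 4 = mk_mdag {} {AB, AC}"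
  "reps ! 5 = mk_mdag {ab} {AB, BC}"
  "reps ! 6 = mk_mdag {ac, bc} {AC, BC}"
  "reps ! 7 = mk_mdag {} {AB, AC, BC}"
  "reps ! 8 = mk_mdag {ab, ac, bc} {ABC}"
  "reps ! 9 = mk_mdag {ab, ac} {}"
  "reps ! 10 = mk_mdag {ab} {AB, AC}"
  "reps ! 11 = mk_mdag {ac} {AB, AC}"
  "reps ! 12 = mk_mdag {ab, bc} {}"
  "reps ! 13 = mk_mdag {ab, bc} {AB, BC}"
  "reps ! 14 = mk_mdag {ab, ac} {AB, AC}"
  by (simp_all add: reps_def)

lemma less_15_cases:
  assumes "(i::nat) < 15"
  shows "i \<in> {0, 1, 2, 3, 4, 5, 6, 7, 8, 9, 10, 11, 12, 13, 14}"
  unfolding insert_iff empty_iff using assms by presburger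

lemma reach_below:
  assumes i: "i < 15" and j: "j \<in> set (below ! i)"
  shows "reach (reps ! i) (reps ! j)"
  using less_15_cases[OF i] j
  by (auto simp: below_def reps_def has_face_def
      intro!: reach_rep0 reach_rep1 reach_rep2 reach_rep3 reach_rep4 reach_rep5 reach_rep6 reach_rep7 reach_rep8 reach_rep9 reach_rep10 reach_rep11 reach_rep12 reach_rep13 reach_rep14)

definition represented :: "abc mdag \<Rightarrow> nat \<Rightarrow> bool" where
  "represented G i \<longleftrightarrow> i < 15 \<and> reach G (reps ! i) \<and> reach (reps ! i) G"

lemma has_face_pairs:
  assumes "F \<subseteq> {AB, AC, BC}"
  shows "has_face F AB \<longleftrightarrow> AB \<in> F" "has_face F AC \<longleftrightarrow> AC \<in> F" "has_face F BC \<longleftrightarrow> BC \<in> F"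
  using assms by (auto simp: has_face_def)

lemma represented_reach:
  assumes "represented G i" "represented H j"
  shows "reach (reps ! i) (reps ! j) \<Longrightarrow> reach G H"
  using assms unfolding represented_def by (meson rtranclp_trans)

lemma reach_sub:
  assumes "ordered_edges E2" "E \<subseteq> E2" "F \<subseteq> F2"
  shows "reach (mk_mdag E2 F2) (mk_mdag E F)"
  by (rule reach_final[OF assms(1,2)]) (use assms(3) in \<open>auto simp: has_face_def\<close>)

text \<open>Except for 9 and 12, each representative is the largest member of its class, so it
  dominates the other members structurally. Representatives 9 and 12 have no shared latents and may
  first have to gain one.\<close>

lemma ex_represented_pairs:
  assumes E: "E \<subseteq> {ab, ac, bc}" and F: "F \<subseteq> {AB, AC, BC}"
  shows "\<exists>i. represented (mk_mdag E F) i"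
proof -
  consider (0) "ab \<notin> E \<and> AB \<notin> F \<and> ac \<notin> E \<and> AC \<notin> F \<and> bc \<notin> E \<and> BC \<notin> F"
    | (1) "(ab \<in> E \<or> AB \<in> F) \<and> ac \<notin> E \<and> AC \<notin> F \<and> bc \<notin> E \<and> BC \<notin> F"
    | (2) "(ac \<in> E \<or> AC \<in> F) \<and> ab \<notin> E \<and> AB \<notin> F \<and> bc \<notin> E \<and> BC \<notin> F"
    | (3) "(bc \<in> E \<or> BC \<in> F) \<and> ab \<notin> E \<and> AB \<notin> F \<and> ac \<notin> E \<and> AC \<notin> F"
    | (4) "AB \<in> F \<and> AC \<in> F \<and> ab \<notin> E \<and> ac \<notin> E \<and> bc \<notin> E \<and> BC \<notin> F"
    | (5) "(ab \<in> E \<or> AB \<in> F) \<and> ac \<notin> E \<and> AC \<notin> F \<and> BC \<in> F \<and> bc \<notin> E"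
    | (6) "ab \<notin> E \<and> AB \<notin> F \<and> (ac \<in> E \<or> AC \<in> F) \<and> (bc \<in> E \<or> BC \<in> F)"
    | (7) "ab \<notin> E \<and> ac \<notin> E \<and> bc \<notin> E \<and> AB \<in> F \<and> AC \<in> F \<and> BC \<in> F"
    | (8) "(ab \<in> E \<or> AB \<in> F) \<and> (ac \<in> E \<or> AC \<in> F) \<and> (bc \<in> E \<or> BC \<in> F) \<and> (ab \<in> E \<or> ac \<in> E \<or> bc \<in> E)"
    | (9) "(ab \<in> E \<or> AB \<in> F) \<and> (ac \<in> E \<or> AC \<in> F) \<and> bc \<notin> E \<and> BC \<notin> F \<and> (ab \<in> E \<or> ac \<in> E) \<and> (AB \<notin> F \<or> AC \<notin> F)"
    | (10) "ab \<in> E \<and> ac \<notin> E \<and> AB \<in> F \<and> AC \<in> F \<and> bc \<notin> E \<and> BC \<notin> F"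
    | (11) "ab \<notin> E \<and> ac \<in> E \<and> AB \<in> F \<and> AC \<in> F \<and> bc \<notin> E \<and> BC \<notin> F"
    | (12) "(ab \<in> E \<or> AB \<in> F) \<and> ac \<notin> E \<and> AC \<notin> F \<and> bc \<in> E \<and> BC \<notin> F"
    | (13) "(ab \<in> E \<or> AB \<in> F) \<and> ac \<notin> E \<and> AC \<notin> F \<and> bc \<in> E \<and> BC \<in> F"
    | (14) "ab \<in> E \<and> ac \<in> E \<and> AB \<in> F \<and> AC \<in> F \<and> bc \<notin> E \<and> BC \<notin> F"
    by (cases "ab \<in> E"; cases "ac \<in> E"; cases "bc \<in> E";
        cases "AB \<in> F"; cases "AC \<in> F"; cases "BC \<in> F"; simp)
  then show ?thesis
  proof cases
    case 0
    have "reach (mk_mdag E F) (reps ! 0)"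
      unfolding nth_reps by (rule reach_rep0[OF E])
    moreover have "reach (reps ! 0) (mk_mdag E F)"
      unfolding nth_reps by (rule reach_sub; (simp add: ordered_edges_def; fail)?; use 0 E F in blast)
    ultimately show ?thesis unfolding represented_def by (intro exI[of _ 0]) simp
  next
    case 1
    have "reach (mk_mdag E F) (reps ! 1)"
      unfolding nth_reps by (rule reach_rep1[OF E]) (use 1 in \<open>simp add: has_face_pairs[OF F]\<close>)
    moreover have "reach (reps ! 1) (mk_mdag E F)"
      unfolding nth_reps by (rule reach_sub; (simp add: ordered_edges_def; fail)?; use 1 E F in blast)
    ultimately show ?thesis unfolding represented_def by (intro exI[of _ 1]) simp
  next
    case 2
    have "reach (mk_mdag E F) (reps ! 2)"
      unfolding nth_reps by (rule reach_rep2[OF E]) (use 2 in \<open>simp add: has_face_pairs[OF F]\<close>)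
    moreover have "reach (reps ! 2) (mk_mdag E F)"
      unfolding nth_reps by (rule reach_sub; (simp add: ordered_edges_def; fail)?; use 2 E F in blast)
    ultimately show ?thesis unfolding represented_def by (intro exI[of _ 2]) simp
  next
    case 3
    have "reach (mk_mdag E F) (reps ! 3)"
      unfolding nth_reps by (rule reach_rep3[OF E]) (use 3 in \<open>simp add: has_face_pairs[OF F]\<close>)
    moreover have "reach (reps ! 3) (mk_mdag E F)"
      unfolding nth_reps by (rule reach_sub; (simp add: ordered_edges_def; fail)?; use 3 E F in blast)
    ultimately show ?thesis unfolding represented_def by (intro exI[of _ 3]) simp
  next
    case 4
    have "reach (mk_mdag E F) (reps ! 4)"
      unfolding nth_reps by (rule reach_rep4[OF E]) (use 4 in \<open>simp add: has_face_pairs[OF F]\<close>)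
    moreover have "reach (reps ! 4) (mk_mdag E F)"
      unfolding nth_reps by (rule reach_sub; (simp add: ordered_edges_def; fail)?; use 4 E F in blast)
    ultimately show ?thesis unfolding represented_def by (intro exI[of _ 4]) simp
  next
    case 5
    have "reach (mk_mdag E F) (reps ! 5)"
      unfolding nth_reps by (rule reach_rep5[OF E]) (use 5 in \<open>simp add: has_face_pairs[OF F]\<close>)
    moreover have "reach (reps ! 5) (mk_mdag E F)"
      unfolding nth_reps by (rule reach_sub; (simp add: ordered_edges_def; fail)?; use 5 E F in blast)
    ultimately show ?thesis unfolding represented_def by (intro exI[of _ 5]) simp
  next
    case 6
    have "reach (mk_mdag E F) (reps ! 6)"
      unfolding nth_reps by (rule reach_rep6[OF E]) (use 6 in \<open>simp add: has_face_pairs[OF F]\<close>)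
    moreover have "reach (reps ! 6) (mk_mdag E F)"
      unfolding nth_reps by (rule reach_sub; (simp add: ordered_edges_def; fail)?; use 6 E F in blast)
    ultimately show ?thesis unfolding represented_def by (intro exI[of _ 6]) simp
  next
    case 7
    have "reach (mk_mdag E F) (reps ! 7)"
      unfolding nth_reps by (rule reach_rep7[OF E]) (use 7 in \<open>simp add: has_face_pairs[OF F]\<close>)
    moreover have "reach (reps ! 7) (mk_mdag E F)"
      unfolding nth_reps by (rule reach_sub; (simp add: ordered_edges_def; fail)?; use 7 E F in blast)
    ultimately show ?thesis unfolding represented_def by (intro exI[of _ 7]) simp
  next
    case 8
    have "reach (mk_mdag E F) (reps ! 8)"
      unfolding nth_reps by (rule reach_rep8[OF E]) (use 8 in \<open>simp add: has_face_pairs[OF F]\<close>)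
    moreover have "reach (reps ! 8) (mk_mdag E F)"
      unfolding nth_reps by (rule reach_above[OF _ _ _ reach_sub[OF _ E F]]) (simp_all add: edge_simps)
    ultimately show ?thesis unfolding represented_def by (intro exI[of _ 8]) simp
  next
    case 9
    have "reach (mk_mdag E F) (reps ! 9)"
      unfolding nth_reps by (rule reach_rep9[OF E]) (use 9 in \<open>simp add: has_face_pairs[OF F]\<close>)
    moreover have "reach (reps ! 9) (mk_mdag E F)"
    proof (cases "AB \<in> F")
      case True
      show ?thesis unfolding nth_reps
        by (rule rtranclp_trans[OF chain9_AB reach_sub]; (simp add: ordered_edges_def; fail)?; use True 9 E F in blast)
    next
      case False
      show ?thesis unfolding nth_reps
        by (rule rtranclp_trans[OF chain9_AC reach_sub]; (simp add: ordered_edges_def; fail)?; use False 9 E F in blast)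
    qed
    ultimately show ?thesis unfolding represented_def by (intro exI[of _ 9]) simp
  next
    case 10
    have "reach (mk_mdag E F) (reps ! 10)"
      unfolding nth_reps by (rule reach_rep10[OF E]) (use 10 in \<open>simp add: has_face_pairs[OF F]\<close>)
    moreover have "reach (reps ! 10) (mk_mdag E F)"
      unfolding nth_reps by (rule reach_sub; (simp add: ordered_edges_def; fail)?; use 10 E F in blast)
    ultimately show ?thesis unfolding represented_def by (intro exI[of _ 10]) simp
  next
    case 11
    have "reach (mk_mdag E F) (reps ! 11)"
      unfolding nth_reps by (rule reach_rep11[OF E]) (use 11 in \<open>simp add: has_face_pairs[OF F]\<close>)
    moreover have "reach (reps ! 11) (mk_mdag E F)"
      unfolding nth_reps by (rule reach_sub; (simp add: ordered_edges_def; fail)?; use 11 E F in blast)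
    ultimately show ?thesis unfolding represented_def by (intro exI[of _ 11]) simp
  next
    case 12
    have "reach (mk_mdag E F) (reps ! 12)"
      unfolding nth_reps by (rule reach_rep12[OF E]) (use 12 in \<open>simp add: has_face_pairs[OF F]\<close>)
    moreover have "reach (reps ! 12) (mk_mdag E F)"
      unfolding nth_reps by (rule rtranclp_trans[OF chain12_AB reach_sub]; (simp add: ordered_edges_def; fail)?; use 12 E F in blast)
    ultimately show ?thesis unfolding represented_def by (intro exI[of _ 12]) simp
  next
    case 13
    have "reach (mk_mdag E F) (reps ! 13)"
      unfolding nth_reps by (rule reach_rep13[OF E]) (use 13 in \<open>simp add: has_face_pairs[OF F]\<close>)
    moreover have "reach (reps ! 13) (mk_mdag E F)"
      unfolding nth_reps by (rule reach_sub; (simp add: ordered_edges_def; fail)?; use 13 E F in blast)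
    ultimately show ?thesis unfolding represented_def by (intro exI[of _ 13]) simp
  next
    case 14
    have "reach (mk_mdag E F) (reps ! 14)"
      unfolding nth_reps by (rule reach_rep14[OF E]) (use 14 in \<open>simp add: has_face_pairs[OF F]\<close>)
    moreover have "reach (reps ! 14) (mk_mdag E F)"
      unfolding nth_reps by (rule reach_sub; (simp add: ordered_edges_def; fail)?; use 14 E F in blast)
    ultimately show ?thesis unfolding represented_def by (intro exI[of _ 14]) simp
  qed
qed

section \<open>Enumeration of the 72 mDAGs\<close>

lemma three_mdags_eq:
  "three_mdags = {G. is_mdag G \<and> nodes G = ABC \<and> edges G \<subseteq> {ab, ac, bc}}"
proof -
  have "consistent_with [Node_a, Node_b, Node_c] G \<longleftrightarrow> edges G \<subseteq> {ab, ac, bc}"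
    if G: "is_mdag G" and n: "nodes G = ABC" for G
  proof
    assume "consistent_with [Node_a, Node_b, Node_c] G"
    then have fwd: "([Node_a, Node_b, Node_c] ! j, [Node_a, Node_b, Node_c] ! i) \<notin> (edges G)\<^sup>+"
      if "i < j" "j < 3" for i j
      using that by (simp add: consistent_with_def)
    have "(Node_b, Node_a) \<notin> edges G" "(Node_c, Node_a) \<notin> edges G" "(Node_c, Node_b) \<notin> edges G"
      using fwd[of 0 1] fwd[of 0 2] fwd[of 1 2] by auto
    moreover have "(v, v) \<notin> edges G" for v using G by (auto simp: is_mdag_def acyclic_def)
    ultimately have "(u, v) \<notin> edges G \<or> (u, v) \<in> {ab, ac, bc}" for u v
      by (cases u; cases v) auto
    then show "edges G \<subseteq> {ab, ac, bc}" by auto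
  next
    assume "edges G \<subseteq> {ab, ac, bc}"
    then have "(edges G)\<^sup>+ \<subseteq> {ab, ac, bc}\<^sup>+" by (rule trancl_mono_subset)
    also have "{ab, ac, bc}\<^sup>+ = {ab, ac, bc}" by (rule trancl_id) (auto simp: trans_def)
    finally have sub: "(edges G)\<^sup>+ \<subseteq> {ab, ac, bc}" .
    show "consistent_with [Node_a, Node_b, Node_c] G"
      unfolding consistent_with_def
    proof (intro conjI allI impI)
      fix i j :: nat assume "i < j \<and> j < length [Node_a, Node_b, Node_c]"
      then have "(i, j) \<in> {(0, 1), (0, 2), (1, 2)}" by auto
      then show "([Node_a, Node_b, Node_c] ! j, [Node_a, Node_b, Node_c] ! i) \<notin> (edges G)\<^sup>+"
        using sub by auto
    qed (use n in auto)
  qed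
  then show ?thesis unfolding three_mdags_def by auto
qed

text \<open>A normal form for generators: a complex containing the singletons of three nodes is the
  full simplex or is determined by its set of pairs. This gives 1 + 8 complexes, to be combined with
  8 edge sets.\<close>

definition mdag_code :: "abc mdag \<Rightarrow> abc rel \<times> abc set set" where
  "mdag_code G = (edges G, if ABC \<in> faces G then {ABC} else faces G \<inter> {AB, AC, BC})"

lemma mdag_code_mk_mdag:
  assumes "F \<in> insert {ABC} (Pow {AB, AC, BC})"
  shows "mdag_code (mk_mdag E F) = (E, F)"
proof (cases "F = {ABC}")
  case False
  then have F: "F \<subseteq> {AB, AC, BC}" using assms by auto
  have "ABC \<notin> faces (mk_mdag E F)"
  proof
    assume "ABC \<in> faces (mk_mdag E F)"
    then consider v where "ABC \<subseteq> {v}" | B where "B \<in> F" "ABC \<subseteq> B" by auto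
    then show False using F by cases auto
  qed
  moreover have "A \<in> faces (mk_mdag E F) \<longleftrightarrow> A \<in> F" if A: "A \<in> {AB, AC, BC}" for A
  proof
    assume "A \<in> faces (mk_mdag E F)"
    then consider v where "A \<subseteq> {v}" | B where "B \<in> F" "A \<subseteq> B" by auto
    then show "A \<in> F"
    proof cases
      case 1
      then show ?thesis using A by auto
    next
      case 2
      then have "B \<in> {AB, AC, BC}" using F by blast
      then have "A = B" using A 2(2) by auto
      then show ?thesis using 2(1) by simp
    qed
  qed auto
  ultimately have "faces (mk_mdag E F) \<inter> {AB, AC, BC} = F" "ABC \<notin> faces (mk_mdag E F)"
    using F by blast+
  then show ?thesis unfolding mdag_code_def by (simp only: mk_mdag_simps(2) if_False)
next
  case True
  then have "ABC \<in> faces (mk_mdag E F)" by auto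
  then show ?thesis unfolding mdag_code_def using True by (simp only: mk_mdag_simps(2) if_True)
qed

lemma ex_abc: "(\<exists>v. p v) \<longleftrightarrow> p Node_a \<or> p Node_b \<or> p Node_c"
  by (metis abc.exhaust)

lemma proper_abc_set: "A \<noteq> ABC \<Longrightarrow> (\<exists>v. A \<subseteq> {v}) \<or> A = AB \<or> A = AC \<or> A = BC"
  by (cases "Node_a \<in> A"; cases "Node_b \<in> A"; cases "Node_c \<in> A";
      simp add: set_eq_iff subset_iff all_abc ex_abc)

lemma mk_mdag_of_code:
  assumes G: "is_mdag G" and n: "nodes G = ABC"
  shows "mk_mdag (edges G) (snd (mdag_code G)) = G"
proof -
  let ?F = "snd (mdag_code G)"
  have sub: "faces G \<subseteq> Pow ABC" using G unfolding is_mdag_def n by (elim conjE)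
  have down: "B \<in> faces G" if "A \<in> faces G" "B \<subseteq> A" for A B using G that unfolding is_mdag_def by blast
  have "\<forall>v\<in>ABC. {v} \<in> faces G" using G unfolding is_mdag_def n by (elim conjE)
  then have single: "{v} \<in> faces G" for v using UNIV_abc by blast
  have F: "?F = (if ABC \<in> faces G then {ABC} else faces G \<inter> {AB, AC, BC})" by (simp add: mdag_code_def)
  have "A \<in> faces G \<longleftrightarrow> (\<exists>v. A \<subseteq> {v}) \<or> (\<exists>B\<in>?F. A \<subseteq> B)" for A
  proof
    assume A: "A \<in> faces G"
    then have A_sub: "A \<subseteq> ABC" using sub by blast
    show "(\<exists>v. A \<subseteq> {v}) \<or> (\<exists>B\<in>?F. A \<subseteq> B)"
    proof (cases "ABC \<in> faces G")
      case True
      then have "ABC \<in> ?F" unfolding F by (simp only: if_True insertI1)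
      then show ?thesis using A_sub by blast
    next
      case False
      then have "A \<noteq> ABC" using A by metis
      then have "(\<exists>v. A \<subseteq> {v}) \<or> A \<in> {AB, AC, BC}" using proper_abc_set by blast
      moreover have "?F = faces G \<inter> {AB, AC, BC}" using F False by (simp only: if_False)
      ultimately show ?thesis using A by blast
    qed
  next
    have "?F \<subseteq> faces G" unfolding F by auto
    then show "(\<exists>v. A \<subseteq> {v}) \<or> (\<exists>B\<in>?F. A \<subseteq> B) \<Longrightarrow> A \<in> faces G"
      using down single by blast
  qed
  then have "{A. (\<exists>v. A \<subseteq> {v}) \<or> (\<exists>B\<in>?F. A \<subseteq> B)} = faces G" by blast
  then show ?thesis unfolding mk_mdag_def using n UNIV_abc by simp
qed

lemma three_mdags_image:
  "three_mdags = (\<lambda>(E, F). mk_mdag E F) ` (Pow {ab, ac, bc} \<times> insert {ABC} (Pow {AB, AC, BC}))"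
  (is "_ = ?m ` ?C")
proof (intro equalityI subsetI)
  fix G assume "G \<in> three_mdags"
  then have G: "is_mdag G" "nodes G = ABC" "edges G \<subseteq> {ab, ac, bc}" by (auto simp: three_mdags_eq)
  have "(edges G, snd (mdag_code G)) \<in> ?C" using G(3) by (simp add: mdag_code_def)
  then show "G \<in> ?m ` ?C" using mk_mdag_of_code[OF G(1,2)] by (metis (no_types, lifting) case_prod_conv image_eqI)
next
  fix G assume "G \<in> ?m ` ?C"
  then obtain E F where "G = mk_mdag E F" "E \<subseteq> {ab, ac, bc}" by auto
  then show "G \<in> three_mdags" by (simp add: three_mdags_eq is_mdag_abc ordered_edges_def UNIV_abc)
qed

lemma card_three_mdags: "card three_mdags = 72"
proof -
  have "inj_on (\<lambda>(E, F). mk_mdag E F) (Pow {ab, ac, bc} \<times> insert {ABC} (Pow {AB, AC, BC}))"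
  proof (rule inj_on_inverseI[where g = mdag_code])
    fix EF assume EF: "EF \<in> Pow {ab, ac, bc} \<times> insert {ABC} (Pow {AB, AC, BC})"
    obtain E F where "EF = (E, F)" by (rule prod.exhaust)
    then show "mdag_code (case EF of (E, F) \<Rightarrow> mk_mdag E F) = EF"
      using EF mdag_code_mk_mdag[of F E] by (simp only: prod.case mem_Times_iff fst_conv snd_conv)
  qed
  then have "card three_mdags = card (Pow {ab, ac, bc}) * card (insert {ABC} (Pow {AB, AC, BC}))"
    unfolding three_mdags_image by (simp only: card_image card_cartesian_product)
  moreover have "card (Pow {ab, ac, bc}) = 8" by (simp add: card_Pow)
  moreover have "card (insert {ABC} (Pow {AB, AC, BC})) = 9"
  proof -
    have "AB \<noteq> AC" "AB \<noteq> BC" "AC \<noteq> BC" by (simp_all add: doubleton_eq_iff)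
    then have "card {AB, AC, BC} = 3" by simp
    moreover have "finite (Pow {AB, AC, BC})" by simp
    moreover have "{ABC} \<notin> Pow {AB, AC, BC}"
      unfolding Pow_iff insert_subset insert_iff empty_iff set_eq_iff by (simp add: all_abc)
    ultimately have "card (insert {ABC} (Pow {AB, AC, BC})) = Suc (2 ^ 3)"
      by (metis card_insert_disjoint card_Pow finite_Pow_iff)
    then show ?thesis by simp
  qed
  ultimately show ?thesis by simp
qed

lemma ex_represented:
  assumes "G \<in> three_mdags" shows "\<exists>i. represented G i"
proof -
  obtain E F where G: "G = mk_mdag E F" and E: "E \<subseteq> {ab, ac, bc}" and F: "F = {ABC} \<or> F \<subseteq> {AB, AC, BC}"
    using assms unfolding three_mdags_image by auto
  show ?thesis
  proof (cases "F = {ABC}")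
    case True
    have "reach G (reps ! 8)" unfolding G nth_reps True
      by (rule reach_rep8[OF E]) (simp add: has_face_def)
    moreover have "reach (reps ! 8) G" unfolding G nth_reps True
      by (rule reach_sub) (use E in \<open>auto simp: ordered_edges_def\<close>)
    ultimately have "represented G 8" by (simp add: represented_def)
    then show ?thesis ..
  qed (use ex_represented_pairs[OF E] F G in blast)
qed

lemma reps_in_three_mdags:
  assumes "i < 15" shows "reps ! i \<in> three_mdags"
proof -
  have "is_mdag (reps ! i) \<and> nodes (reps ! i) = UNIV \<and> edges (reps ! i) \<subseteq> {ab, ac, bc}"
    using less_15_cases[OF assms]
    by (elim insertE emptyE) (simp_all add: reps_def is_mdag_abc ordered_edges_def)
  then show ?thesis unfolding three_mdags_eq UNIV_abc[symmetric] by simp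
qed

section \<open>Separation of the classes\<close>

lemma not_dominatesI:
  assumes "P \<in> mdag_model H (\<lambda>_. 2)" "P \<notin> mdag_model G (\<lambda>_. 2)"
  shows "\<not> obs_dominates G H"
proof
  assume "obs_dominates G H"
  then have "mdag_model H (\<lambda>_. 2) \<subseteq> mdag_model G (\<lambda>_. 2)" by (simp add: obs_dominates_def)
  then show False using assms by blast
qed

lemma not_dominates_reps:
  "\<not> obs_dominates (reps ! 14) (reps ! 3)" "\<not> obs_dominates (reps ! 13) (reps ! 2)"
  "\<not> obs_dominates (reps ! 6) (reps ! 1)" "\<not> obs_dominates (reps ! 7) (reps ! 9)"
  "\<not> obs_dominates (reps ! 7) (reps ! 12)" "\<not> obs_dominates (reps ! 9) (reps ! 4)"
  "\<not> obs_dominates (reps ! 12) (reps ! 5)" "\<not> obs_dominates (reps ! 10) (reps ! 11)"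
  "\<not> obs_dominates (reps ! 11) (reps ! 10)"
  unfolding nth_reps
  by (rule not_dominatesI[OF bc_correlation_in_model], rule bc_correlation_not_in_hub,
      simp, simp add: set_bits3 UNIV_bool insert_commute)
    (rule not_dominatesI[OF ac_correlation_in_model], rule ac_correlation_not_in_instrumental,
      simp, simp add: set_bits3 UNIV_bool insert_commute,
     rule not_dominatesI[OF ab_correlation_in_model], rule ab_correlation_not_in_collider,
      simp, simp add: set_bits3 UNIV_bool insert_commute,
     rule not_dominatesI[OF ghz_in_fork], rule ghz_not_in_triangle,
      simp, simp add: set_bits3 UNIV_bool insert_commute,
     rule not_dominatesI[OF ghz_in_chain], rule ghz_not_in_triangle,
      simp, simp add: set_bits3 UNIV_bool insert_commute,
     rule not_dominatesI[OF xor_in_b_independent_c], rule xor_not_in_fork,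
      simp, simp add: set_bits3 UNIV_bool insert_commute,
     rule not_dominatesI[OF xor_in_a_independent_c], rule xor_not_in_chain,
      simp, simp add: set_bits3 UNIV_bool insert_commute,
     rule not_dominatesI[OF instrument_b_witness_in_model], rule instrument_b_witness_not_in_instrument_c,
      simp, simp add: set_bits3 UNIV_bool insert_commute,
     rule not_dominatesI[OF instrument_c_witness_in_model], rule instrument_c_witness_not_in_instrument_b,
      simp, simp add: set_bits3 UNIV_bool insert_commute)

text \<open>A pair \<open>(p, q)\<close> of representatives with \<open>q\<close> not dominated by \<open>p\<close> separates everything that
  \<open>p\<close> dominates from everything that dominates \<open>q\<close>; nine pairs separate all classes.\<close>

lemma separating_pairs:
  "\<forall>i\<in>set [0..<15]. \<forall>j\<in>set [0..<15]. j \<in> set (below ! i) \<or>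
    (\<exists>(p, q)\<in>set [(14, 3), (13, 2), (6, 1), (7, 9), (7, 12), (9, 4), (12, 5), (10, 11), (11, 10)].
       i \<in> set (below ! p) \<and> q \<in> set (below ! j))"
  by code_simp

lemma below_antisym:
  "\<forall>i\<in>set [0..<15]. \<forall>j\<in>set [0..<15]. j \<in> set (below ! i) \<and> i \<in> set (below ! j) \<longrightarrow> i = j"
  by code_simp

lemma obs_dominates_trans: "obs_dominates G H \<Longrightarrow> obs_dominates H K \<Longrightarrow> obs_dominates G K"
  unfolding obs_dominates_def by (metis subset_trans)

lemma obs_dominates_below: "i < 15 \<Longrightarrow> j \<in> set (below ! i) \<Longrightarrow> obs_dominates (reps ! i) (reps ! j)"
  by (rule dominance_chain_sound[OF reach_below])

lemma obs_dominates_reps_iff: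
  assumes i: "i < 15" and j: "j < 15"
  shows "obs_dominates (reps ! i) (reps ! j) \<longleftrightarrow> j \<in> set (below ! i)"
proof
  assume dom: "obs_dominates (reps ! i) (reps ! j)"
  show "j \<in> set (below ! i)"
  proof (rule ccontr)
    assume notin: "j \<notin> set (below ! i)"
    have ij: "i \<in> set [0..<15]" "j \<in> set [0..<15]" using i j by simp_all
    have "\<exists>x\<in>set [(14, 3), (13, 2), (6, 1), (7, 9), (7, 12), (9, 4), (12, 5), (10, 11), (11, 10)].
        case x of (p, q) \<Rightarrow> i \<in> set (below ! p) \<and> q \<in> set (below ! j)"
      by (rule separating_pairs[THEN bspec, OF ij(1), THEN bspec, OF ij(2), unfolded disj_imp, THEN mp, OF notin])
    then obtain x where x: "x \<in> set [(14, 3), (13, 2), (6, 1), (7, 9), (7, 12), (9, 4), (12, 5), (10, 11), (11, 10)]"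
        "case x of (p, q) \<Rightarrow> i \<in> set (below ! p) \<and> q \<in> set (below ! j)"
      by (rule bexE)
    obtain p q where x_eq: "x = (p, q)" by (rule prod.exhaust)
    have pq: "(p, q) \<in> set [(14, 3), (13, 2), (6, 1), (7, 9), (7, 12), (9, 4), (12, 5), (10, 11), (11, 10)]" using x(1) unfolding x_eq .
    have ip_qj: "i \<in> set (below ! p) \<and> q \<in> set (below ! j)" using x(2) unfolding x_eq prod.case .
    note ip = conjunct1[OF ip_qj] and qj = conjunct2[OF ip_qj]
    have "p < 15" using pq by auto
    then have "obs_dominates (reps ! p) (reps ! i)" using ip by (rule obs_dominates_below)
    moreover have "obs_dominates (reps ! j) (reps ! q)" using j qj by (rule obs_dominates_below)
    \<comment> \<open>\<open>p\<close> dominates \<open>i\<close>, which by assumption dominates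
      \<open>j\<close>, which dominates \<open>q\<close>; but \<open>(p, q)\<close> is one of the
      refuted pairs.\<close>
    ultimately have "obs_dominates (reps ! p) (reps ! q)"
      using dom by (intro obs_dominates_trans[of "reps ! p" "reps ! i" "reps ! q"]
          obs_dominates_trans[of "reps ! i" "reps ! j" "reps ! q"])
    moreover have "(p, q) \<in> {(14, 3), (13, 2), (6, 1), (7, 9), (7, 12), (9, 4), (12, 5), (10, 11), (11, 10)}"
      using pq by simp
    ultimately show False
      by (elim insertE emptyE; simp only: prod.inject not_dominates_reps)
  qed
qed (rule obs_dominates_below[OF i])

lemma represented_dominates:
  assumes "represented G i"
  shows "obs_dominates G (reps ! i)" "obs_dominates (reps ! i) G"
proof -
  have r: "reach G (reps ! i)" "reach (reps ! i) G" using assms by (simp_all only: represented_def)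
  show "obs_dominates G (reps ! i)" by (rule dominance_chain_sound[OF r(1)])
  show "obs_dominates (reps ! i) G" by (rule dominance_chain_sound[OF r(2)])
qed

lemma obs_dominates_iff_below:
  assumes G: "represented G i" and H: "represented H j"
  shows "obs_dominates G H \<longleftrightarrow> j \<in> set (below ! i)" "reach G H \<longleftrightarrow> j \<in> set (below ! i)"
proof -
  have ij: "i < 15" "j < 15" using assms by (simp_all add: represented_def)
  note dom = represented_dominates[OF G] represented_dominates[OF H]
  show 1: "obs_dominates G H \<longleftrightarrow> j \<in> set (below ! i)"
    unfolding obs_dominates_reps_iff[OF ij, symmetric]
  proof
    show "obs_dominates (reps ! i) (reps ! j)" if "obs_dominates G H"
      using obs_dominates_trans[OF dom(2) obs_dominates_trans[OF that dom(3)]] .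
    show "obs_dominates G H" if "obs_dominates (reps ! i) (reps ! j)"
      using obs_dominates_trans[OF dom(1) obs_dominates_trans[OF that dom(4)]] .
  qed
  show "reach G H \<longleftrightarrow> j \<in> set (below ! i)"
  proof
    show "reach G H" if "j \<in> set (below ! i)"
      by (rule represented_reach[OF G H reach_below[OF ij(1) that]])
    show "j \<in> set (below ! i)" if "reach G H"
      using dominance_chain_sound[OF that] unfolding 1 .
  qed
qed

lemma obs_equivalent_iff: "obs_equivalent G H \<longleftrightarrow> obs_dominates G H \<and> obs_dominates H G"
proof (cases "nodes G = nodes H")
  case True
  have "mdag_model H c = mdag_model G c \<longleftrightarrow> mdag_model H c \<subseteq> mdag_model G c \<and> mdag_model G c \<subseteq> mdag_model H c" for c
    by (rule set_eq_subset)
  then show ?thesis unfolding obs_equivalent_def obs_dominates_def True by (simp only: simp_thms) blast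
qed (simp add: obs_equivalent_def obs_dominates_def)

text \<open>Mutual dominance means that each index is below the other, and the table
  \<open>below\<close> is antisymmetric.\<close>

lemma represented_unique:
  assumes G: "represented G i" and H: "represented H j"
  shows "obs_equivalent G H \<longleftrightarrow> i = j"
proof -
  have ij: "i < 15" "j < 15" using assms by (simp_all add: represented_def)
  then have ij': "i \<in> set [0..<15]" "j \<in> set [0..<15]" by simp_all
  have "obs_equivalent G H \<longleftrightarrow> j \<in> set (below ! i) \<and> i \<in> set (below ! j)"
    unfolding obs_equivalent_iff obs_dominates_iff_below(1)[OF G H] obs_dominates_iff_below(1)[OF H G] ..
  moreover have "i \<in> set (below ! i)"
    unfolding obs_dominates_reps_iff[OF ij(1) ij(1), symmetric] by (simp add: obs_dominates_def)
  moreover note below_antisym[THEN bspec, OF ij'(1), THEN bspec, OF ij'(2)]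
  ultimately show ?thesis by auto
qed

definition class_of :: "nat \<Rightarrow> abc mdag set" where
  "class_of i = {G \<in> three_mdags. represented G i}"

lemma represented_reps: "i < 15 \<Longrightarrow> represented (reps ! i) i"
  by (simp add: represented_def)

lemma obs_classes_eq: "obs_classes = class_of ` {..<15}"
proof -
  let ?R = "{(G, G'). G \<in> three_mdags \<and> G' \<in> three_mdags \<and> obs_equivalent G G'}"
  have R: "?R `` {G} = class_of i" if "G \<in> three_mdags" "represented G i" for G i
  proof -
    have "obs_equivalent G H \<longleftrightarrow> represented H i" if "H \<in> three_mdags" for H
      using ex_represented[OF that] represented_unique[OF \<open>represented G i\<close>] by metis
    then show ?thesis using that(1) by (auto simp: class_of_def)
  qed
  show ?thesis
  proof (intro equalityI subsetI)
    fix K assume "K \<in> obs_classes"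
    then obtain G where G: "G \<in> three_mdags" "K = ?R `` {G}" unfolding obs_classes_def by (rule quotientE)
    obtain i where i: "represented G i" using ex_represented[OF G(1)] ..
    then have "i < 15" by (simp add: represented_def)
    then show "K \<in> class_of ` {..<15}" using R[OF G(1) i] G(2) by simp
  next
    fix K assume "K \<in> class_of ` {..<15}"
    then obtain i where i: "i < 15" "K = class_of i" by auto
    have "?R `` {reps ! i} \<in> obs_classes"
      unfolding obs_classes_def using reps_in_three_mdags[OF i(1)] by (rule quotientI)
    then show "K \<in> obs_classes" using R[OF reps_in_three_mdags[OF i(1)] represented_reps[OF i(1)]] i(2) by simp
  qed
qed

lemma reps_in_class_of: "i < 15 \<Longrightarrow> reps ! i \<in> class_of i"
  by (simp add: class_of_def reps_in_three_mdags represented_reps)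

lemma inj_class_of: "inj_on class_of {..<15}"
proof (rule inj_onI)
  fix i j :: nat assume "i \<in> {..<15}" "j \<in> {..<15}" "class_of i = class_of j"
  then have "represented (reps ! i) i" "represented (reps ! i) j"
    using reps_in_class_of[of i] by (auto simp: class_of_def)
  then show "i = j" using represented_unique by (metis obs_equivalent_def)
qed

section \<open>Algebraic and nonalgebraic classes\<close>

lemma algebraic_obs_equivalent:
  assumes "obs_equivalent G H" "algebraic_mdag H" shows "algebraic_mdag G"
  unfolding algebraic_mdag_def
proof (intro allI impI)
  fix c :: "'a \<Rightarrow> nat" assume pos: "\<forall>v\<in>nodes G. 0 < c v"
  have n: "nodes G = nodes H" using assms(1) by (simp add: obs_equivalent_def)
  have eq: "mdag_model H c = mdag_model G c" using assms(1) pos unfolding obs_equivalent_def by blast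
  have "\<exists>Z. real_algebraic_set (outcomes (nodes H) c) Z \<and>
      mdag_model H c = {P \<in> prob_simplex (nodes H) c. pmf P \<in> Z}"
    using assms(2) pos unfolding algebraic_mdag_def n by blast
  then show "\<exists>Z. real_algebraic_set (outcomes (nodes G) c) Z \<and>
      mdag_model G c = {P \<in> prob_simplex (nodes G) c. pmf P \<in> Z}"
    unfolding n eq .
qed

lemma algebraic_reach:
  assumes "reach G H" "reach H G" "algebraic_mdag H" shows "algebraic_mdag G"
  by (rule algebraic_obs_equivalent[OF _ assms(3)])
    (unfold obs_equivalent_iff, rule conjI[OF dominance_chain_sound[OF assms(1)] dominance_chain_sound[OF assms(2)]])

lemma algebraic_network:
  assumes "ordered_edges E" "topological_order E vs" "set vs = ABC"
  shows "algebraic_mdag (mk_mdag E {})"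
  by (rule algebraic_mdag_if_no_confounding[OF is_mdag_abc[OF assms(1)]])
    (use assms UNIV_abc in auto)

text \<open>Dropping the faces of the representative keeps the class, except for 4 and 5. These are
  equivalent to unconfounded colliders at a and at b, which need edges against the ordering.\<close>

lemma algebraic_rep:
  assumes "i \<in> {0, 1, 2, 3, 4, 5, 6, 8, 9, 12}" shows "algebraic_mdag (reps ! i)"
proof -
  have net: "algebraic_mdag (mk_mdag E {})" if "E \<subseteq> {ab, ac, bc}" for E
    by (rule algebraic_network[where vs = "[Node_a, Node_b, Node_c]"])
      (use that in \<open>auto simp: ordered_edges_def topological_order_def parents_def less_Suc_eq numeral_nat\<close>)
  have net4: "algebraic_mdag (mk_mdag {(Node_b, Node_a), (Node_c, Node_a)} {})"
    by (rule algebraic_network[where vs = "[Node_b, Node_c, Node_a]"])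
      (auto simp: ordered_edges_def topological_order_def parents_def less_Suc_eq numeral_nat)
  have net5: "algebraic_mdag (mk_mdag {ab, (Node_c, Node_b)} {})"
    by (rule algebraic_network[where vs = "[Node_a, Node_c, Node_b]"])
      (auto simp: ordered_edges_def topological_order_def parents_def less_Suc_eq numeral_nat)
  have sub: "reach (mk_mdag E F) (mk_mdag E {})" if "E \<subseteq> {ab, ac, bc}" for E F
    by (rule reach_sub) (use that in \<open>auto simp: ordered_edges_def\<close>)
  have "algebraic_mdag (reps ! 0)" "algebraic_mdag (reps ! 9)" "algebraic_mdag (reps ! 12)"
    unfolding nth_reps by (rule net, simp)+
  moreover have "algebraic_mdag (reps ! 1)" "algebraic_mdag (reps ! 2)" "algebraic_mdag (reps ! 3)"
    "algebraic_mdag (reps ! 6)" "algebraic_mdag (reps ! 8)"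
    unfolding nth_reps
    by (rule algebraic_reach[OF sub chain1_edge net], simp, simp)
      (rule algebraic_reach[OF sub chain2_edge net], simp, simp,
       rule algebraic_reach[OF sub chain3_edge net], simp, simp,
       rule algebraic_reach[OF sub chain6_edges net], simp, simp,
       rule algebraic_reach[OF sub chain8_edges net], simp, simp)
  moreover have "algebraic_mdag (reps ! 4)" "algebraic_mdag (reps ! 5)"
    unfolding nth_reps
    by (rule algebraic_reach[OF chain4_to_network chain4_from_network net4])
      (rule algebraic_reach[OF chain5_to_network chain5_from_network net5])
  ultimately show ?thesis using assms by (elim insertE emptyE) simp_all
qed

lemma bits3_in_simplex:
  assumes "\<And>i j k v. X i j k v < c v"
  shows "bits3 s t r X \<in> prob_simplex UNIV c"
  using set_bits3_subset[of s t r X] assms by (fastforce simp: prob_simplex_def outcomes_def PiE_def)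

lemma not_algebraic_mk_mdagI:
  assumes "0 < s" "s \<le> 1" "\<And>t. 0 \<le> t \<Longrightarrow> t \<le> s \<Longrightarrow> mixture t P R \<in> mdag_model (mk_mdag E F) (\<lambda>_. 2)"
    "R \<in> prob_simplex UNIV (\<lambda>_. 2)" "R \<notin> mdag_model (mk_mdag E F) (\<lambda>_. 2)"
  shows "\<not> algebraic_mdag (mk_mdag E F)"
  using algebraic_line_closed[of "mk_mdag E F" "\<lambda>_. 2" s P R] assms by auto

lemma model_subset_reps:
  assumes "i < 15" "j \<in> set (below ! i)"
  shows "mdag_model (reps ! j) (\<lambda>_. 2) \<subseteq> mdag_model (reps ! i) (\<lambda>_. 2)"
  using dominance_chain_sound[OF reach_below[OF assms]] by (simp add: obs_dominates_def)

text \<open>One endpoint serves three classes: \<open>?R\<close> lies outside the model of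
  \<open>reps ! 14\<close> and hence outside the smaller models of 10 and 11, while a segment inside
  the model of 10 is also inside that of 14.\<close>

lemma not_algebraic_rep:
  assumes "i \<in> {7, 10, 11, 13, 14}" shows "\<not> algebraic_mdag (reps ! i)"
proof -
  let ?R = "bits3 (1/2) (1/2) (1/2) (\<lambda>i j k. triple 0 (of_bool i) (of_bool i))"
  let ?P = "bits3 (1/2) (1/2) (1/2) (\<lambda>i j k. triple 1 0 (of_bool i))"
  let ?P' = "bits3 (1/2) (1/2) (1/2) (\<lambda>i j k. triple 1 (of_bool i) 0)"
  have R: "?R \<in> prob_simplex UNIV (\<lambda>_. 2)" by (rule bits3_in_simplex) (simp add: triple_def split: abc.split)
  have R14: "?R \<notin> mdag_model (reps ! 14) (\<lambda>_. 2)"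
    unfolding nth_reps by (rule bc_correlation_not_in_hub) (simp_all add: set_bits3 UNIV_bool insert_commute)
  have line10: "mixture t ?P ?R \<in> mdag_model (reps ! 10) (\<lambda>_. 2)" if "0 \<le> t" "t \<le> 1/2" for t
    unfolding nth_reps instrumental_line(1)[OF that] by (rule line_in_instrument_c)
  have line11: "mixture t ?P' ?R \<in> mdag_model (reps ! 11) (\<lambda>_. 2)" if "0 \<le> t" "t \<le> 1/2" for t
    unfolding nth_reps instrumental_line(2)[OF that] by (rule line_in_instrument_b)
  have sub: "mdag_model (reps ! 10) (\<lambda>_. 2) \<subseteq> mdag_model (reps ! 14) (\<lambda>_. 2)"
    "mdag_model (reps ! 11) (\<lambda>_. 2) \<subseteq> mdag_model (reps ! 14) (\<lambda>_. 2)"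
    by (rule model_subset_reps; simp add: below_def)+
  have "\<not> algebraic_mdag (reps ! 10)"
    unfolding nth_reps
    by (rule not_algebraic_mk_mdagI[of "1/2" ?P ?R]) (use line10 sub R R14 in \<open>auto simp: nth_reps\<close>)
  moreover have "\<not> algebraic_mdag (reps ! 11)"
    unfolding nth_reps
    by (rule not_algebraic_mk_mdagI[of "1/2" ?P' ?R]) (use line11 sub R R14 in \<open>auto simp: nth_reps\<close>)
  moreover have "\<not> algebraic_mdag (reps ! 14)"
    unfolding nth_reps
    by (rule not_algebraic_mk_mdagI[of "1/2" ?P ?R]) (use line10 sub R R14 in \<open>auto simp: nth_reps\<close>)
  moreover have "\<not> algebraic_mdag (reps ! 13)"
  proof -
    let ?R = "bits3 (1/2) (1/2) (1/2) (\<lambda>i j k. triple (of_bool i) 0 (of_bool i))"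
    let ?P = "bits3 (1/2) (1/2) (1/2) (\<lambda>i j k. triple (of_bool i) 1 0)"
    show ?thesis
      unfolding nth_reps
    proof (rule not_algebraic_mk_mdagI[of "1/2" ?P ?R])
      show "mixture t ?P ?R \<in> mdag_model (mk_mdag {ab, bc} {AB, BC}) (\<lambda>_. 2)" if "0 \<le> t" "t \<le> 1/2" for t
        unfolding instrumental_line(3)[OF that] by (rule line_in_instrument_a)
      show "?R \<in> prob_simplex UNIV (\<lambda>_. 2)" by (rule bits3_in_simplex) (simp add: triple_def split: abc.split)
      show "?R \<notin> mdag_model (mk_mdag {ab, bc} {AB, BC}) (\<lambda>_. 2)"
        by (rule ac_correlation_not_in_instrumental) (simp_all add: set_bits3 UNIV_bool insert_commute)
    qed simp_all
  qed
  moreover have "\<not> algebraic_mdag (reps ! 7)"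
    unfolding nth_reps
  \<comment> \<open>The bound 3/4 is the maximum of 3 s (1 - s), attained by fair bits.\<close>
  proof (rule not_algebraic_mk_mdagI[of "3/4" "return_pmf (triple 0 0 0)" exactly_one])
    show "mixture t (return_pmf (triple 0 0 0)) exactly_one \<in> mdag_model (mk_mdag {} {AB, AC, BC}) (\<lambda>_. 2)"
      if t: "0 \<le> t" "t \<le> 3/4" for t
    proof -
      obtain s where "mixture t (return_pmf (triple 0 0 0)) exactly_one =
        bits3 s s s (\<lambda>i j k. triple (of_bool (i \<and> \<not> j)) (of_bool (k \<and> \<not> i)) (of_bool (j \<and> \<not> k)))"
        by (rule exactly_one_line[OF t])
      then show ?thesis using exactly_one_line_in_triangle by simp
    qed
    show "exactly_one \<in> prob_simplex UNIV (\<lambda>_. 2)"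
      by (auto simp: prob_simplex_def outcomes_def PiE_def set_exactly_one triple_def split: abc.split)
    show "exactly_one \<notin> mdag_model (mk_mdag {} {AB, AC, BC}) (\<lambda>_. 2)"
      by (rule exactly_one_not_in_triangle) (simp_all add: set_exactly_one)
  qed simp_all
  ultimately show ?thesis using assms by (elim insertE emptyE) simp_all
qed

text \<open>Algebraicity is invariant under equivalence, so a class is decided by its
  representative.\<close>

lemma nonalgebraic_class_iff:
  assumes "i < 15"
  shows "(\<forall>G\<in>class_of i. \<not> algebraic_mdag G) \<longleftrightarrow> i \<in> {7, 10, 11, 13, 14}"
proof -
  have "(\<forall>G\<in>class_of i. \<not> algebraic_mdag G) \<longleftrightarrow> \<not> algebraic_mdag (reps ! i)"
    using reps_in_class_of[OF assms] algebraic_reach unfolding class_of_def represented_def by blast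
  also have "\<dots> \<longleftrightarrow> i \<in> {7, 10, 11, 13, 14}"
    using algebraic_rep[of i] not_algebraic_rep[of i] less_15_cases[OF assms] by blast
  finally show ?thesis .
qed

theorem mainTheorem3:
  "three_mdags = {G. is_mdag G \<and> nodes G = {Node_a, Node_b, Node_c} \<and>
      edges G \<subseteq> {(Node_a, Node_b), (Node_a, Node_c), (Node_b, Node_c)}} \<and>
   card three_mdags = 72 \<and>
   (\<forall>G\<in>three_mdags. \<forall>G'\<in>three_mdags.
      obs_dominates G G' \<longleftrightarrow> (dominance_step {Node_a, Node_b, Node_c})\<^sup>*\<^sup>* G G') \<and>
   card obs_classes = 15 \<and>
   card {K \<in> obs_classes. \<forall>G\<in>K. \<not> algebraic_mdag G} = 5"
proof (intro conjI ballI)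
  show "obs_dominates G G' \<longleftrightarrow> (dominance_step {Node_a, Node_b, Node_c})\<^sup>*\<^sup>* G G'"
    if "G \<in> three_mdags" "G' \<in> three_mdags" for G G'
    using ex_represented[OF that(1)] ex_represented[OF that(2)] obs_dominates_iff_below by metis
  show "card obs_classes = 15"
    unfolding obs_classes_eq using card_image[OF inj_class_of] by simp
  have "{K \<in> obs_classes. \<forall>G\<in>K. \<not> algebraic_mdag G} = class_of ` {7, 10, 11, 13, 14}"
  proof -
    have "{K \<in> class_of ` {..<15}. \<forall>G\<in>K. \<not> algebraic_mdag G} =
        class_of ` {i \<in> {..<15}. \<forall>G\<in>class_of i. \<not> algebraic_mdag G}" by blast
    also have "{i \<in> {..<15}. \<forall>G\<in>class_of i. \<not> algebraic_mdag G} = {i \<in> {..<15}. i \<in> {7, 10, 11, 13, 14}}"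
      by (rule Collect_cong) (simp only: lessThan_iff nonalgebraic_class_iff cong: conj_cong)
    also have "\<dots> = {7, 10, 11, 13, 14}" by auto
    finally show ?thesis unfolding obs_classes_eq .
  qed
  moreover have "inj_on class_of {7, 10, 11, 13, 14}"
    by (rule inj_on_subset[OF inj_class_of]) auto
  ultimately show "card {K \<in> obs_classes. \<forall>G\<in>K. \<not> algebraic_mdag G} = 5"
    by (simp add: card_image)
qed (rule three_mdags_eq card_three_mdags)+

end
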